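(* For every strict partition $\lambda$, the number of standard Young tableaux of shifted shape $\lambda$ equals the number of balanced shifted tableaux of shape $\lambda$, i.e. $|\mathrm{SYT}(\lambda)|=|\mathrm{BS}(\lambda)|$.
   Context: A strict partition $\lambda=(\lambda_1>\lambda_2>\cdots>\lambda_d>0)$ has $d$ parts and size $|\lambda|=\sum_i\lambda_i$. Its shifted diagram is $D(\lambda)=\{(i,\,j-d+i-1): 1\le i\le d,\ 1\le j\le \lambda_i\}$; thus row $i$ (rows numbered top to bottom) occupies the columns $i-d,\dots,\lambda_i-d+i-1$, and column indices may be negative. A shifted tableau of shape $\lambda$ is a filling of the boxes of $D(\lambda)$ by nonnegative integers; $B(i,j)$ denotes the entry in box $(i,j)$. Standard tableaux: $\mathrm{SYT}(\lambda)$ is the set of fillings of $D(\lambda)$ using each of $1,\dots,|\lambda|$ exactly once, increasing from left to right along rows and from top to bottom along columns. Hooks: for $(i,j)\in D(\lambda)$ with $j\ge 0$, the hook $H(i,j)$ consists of $(i,j)$, the boxes of $D(\lambda)$ in row $i$ to its right, and the boxes of $D(\lambda)$ in column $j$ below it. For $(i,-j)\in D(\lambda)$ with $j>0$, $H(i,-j)$ consists of $(i,-j)$, the boxes in row $i$ to its right, the boxes in column $-j$ below it, and all boxes of row $d-j+1$. The extended shape is $D(\lambda)\cup\{(i,-(d+1-i)):1\le i\le d\}$; for a filling $B$ of $D(\lambda)$, its extended filling $\tilde B$ agrees with $B$ on $D(\lambda)$ and has entry $B(i,0)$ in the added box $(i,-(d+1-i))$. The extended hook is $\tilde H(i,j)=H(i,j)$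 if $j\ge0$ and $\tilde H(i,-j)=H(i,-j)\cup\{(d+1-j,-j)\}$ if $j>0$. The rank is $\mathrm{rk}(i,j)=\lambda_i-d+i-j$ if $j\ge 0$ and $\mathrm{rk}(i,j)=\lambda_i-d+i+\lambda_{d+1+j}+j+1$ if $j<0$. Balanced shifted tableaux: $\mathrm{BS}(\lambda)$ is the set of fillings $B$ of $D(\lambda)$ using each of $1,\dots,|\lambda|$ exactly once such that for every $(i,j)\in D(\lambda)$, $B(i,j)$ is the $\mathrm{rk}(i,j)$-th largest of the entries of $\tilde B$ in the boxes of $\tilde H(i,j)$ (one entry per box, counted with multiplicity); equivalently exactly $\mathrm{rk}(i,j)-1$ boxes of $\tilde H(i,j)$ carry an entry of $\tilde B$ larger than $B(i,j)$. *)

theory Defs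
  imports "HOL-Library.Multiset" "HOL-Library.FuncSet"
begin

text \<open>
  A partition is the list of its parts \<open>[\<lambda>\<^sub>1, \<dots>, \<lambda>\<^sub>d]\<close>. Boxes are pairs (row, column) of integers,
  with rows numbered from 1; column indices may be negative.
\<close>

definition strict_partition :: "nat list \<Rightarrow> bool" where
  "strict_partition l \<longleftrightarrow> sorted_wrt (>) l \<and> (\<forall>x\<in>set l. x > 0)"

definition num_parts :: "nat list \<Rightarrow> int" where
  "num_parts l = int (length l)"

text \<open>The part \<open>\<lambda>\<^sub>i\<close> for \<open>1 \<le> i \<le> d\<close>.\<close>
definition part :: "nat list \<Rightarrow> int \<Rightarrow> int" where
  "part l i = int (l ! nat (i - 1))"

definition shifted_diagram :: "nat list \<Rightarrow> (int \<times> int) set" where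
  "shifted_diagram l =
     {(i, j - num_parts l + i - 1) | i j. 1 \<le> i \<and> i \<le> num_parts l \<and> 1 \<le> j \<and> j \<le> part l i}"

text \<open>
  Fillings using each of \<open>1, \<dots>, |\<lambda>|\<close> exactly once. Extensionality makes a function
  represent exactly one filling of the diagram, so that fillings can be counted.
\<close>
definition bijective_fillings :: "nat list \<Rightarrow> (int \<times> int \<Rightarrow> nat) set" where
  "bijective_fillings l =
     {B. B \<in> extensional (shifted_diagram l) \<and> bij_betw B (shifted_diagram l) {1..sum_list l}}"

definition SYT :: "nat list \<Rightarrow> (int \<times> int \<Rightarrow> nat) set" where
  "SYT l =
     {T \<in> bijective_fillings l.
        (\<forall>i j j'. (i, j) \<in> shifted_diagram l \<and> (i, j') \<in> shifted_diagram l \<and> j < j'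
           \<longrightarrow> T (i, j) < T (i, j')) \<and>
        (\<forall>i i' j. (i, j) \<in> shifted_diagram l \<and> (i', j) \<in> shifted_diagram l \<and> i < i'
           \<longrightarrow> T (i, j) < T (i', j))}"

text \<open>
  For a negative column \<open>j\<close>, the row \<open>d - (-j) + 1\<close> attached to that column is \<open>d + j + 1\<close>.
\<close>
definition hook :: "nat list \<Rightarrow> int \<Rightarrow> int \<Rightarrow> (int \<times> int) set" where
  "hook l i j =
     {(i, j)} \<union>
     {(i, j') | j'. (i, j') \<in> shifted_diagram l \<and> j < j'} \<union>
     {(i', j) | i'. (i', j) \<in> shifted_diagram l \<and> i < i'} \<union>
     (if j \<ge> 0 then {}
      else {(num_parts l + j + 1, j') | j'. (num_parts l + j + 1, j') \<in> shifted_diagram l})"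

definition extended_shape :: "nat list \<Rightarrow> (int \<times> int) set" where
  "extended_shape l =
     shifted_diagram l \<union> {(i, - (num_parts l + 1 - i)) | i. 1 \<le> i \<and> i \<le> num_parts l}"

definition extended_filling :: "nat list \<Rightarrow> (int \<times> int \<Rightarrow> nat) \<Rightarrow> int \<times> int \<Rightarrow> nat" where
  "extended_filling l B =
     (\<lambda>(i, j)\<in>extended_shape l. if (i, j) \<in> shifted_diagram l then B (i, j) else B (i, 0))"

definition extended_hook :: "nat list \<Rightarrow> int \<Rightarrow> int \<Rightarrow> (int \<times> int) set" where
  "extended_hook l i j =
     (if j \<ge> 0 then hook l i j else hook l i j \<union> {(num_parts l + 1 + j, j)})"

definition box_rank :: "nat list \<Rightarrow> int \<Rightarrow> int \<Rightarrow> int" where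
  "box_rank l i j =
     (if j \<ge> 0 then part l i - num_parts l + i - j
      else part l i - num_parts l + i + part l (num_parts l + 1 + j) + j + 1)"

text \<open>The \<open>k\<close>-th largest element, counted with multiplicity, for \<open>1 \<le> k \<le> size M\<close>.\<close>
definition kth_largest :: "nat \<Rightarrow> 'a::linorder multiset \<Rightarrow> 'a" where
  "kth_largest k M = rev (sorted_list_of_multiset M) ! (k - 1)"

text \<open>
  The multiset has one element per box, so the entry \<open>B (i', 0)\<close> repeated in the added box of
  row \<open>i'\<close> is counted twice when both boxes lie in the extended hook. On boxes of the diagram the
  rank is between 1 and the number of boxes of the extended hook.
\<close>
definition BS :: "nat list \<Rightarrow> (int \<times> int \<Rightarrow> nat) set" where
  "BS l =
     {B \<in> bijective_fillings l.
        \<forall>(i, j)\<in>shifted_diagram l.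
          B (i, j) = kth_largest (nat (box_rank l i j))
            (image_mset (extended_filling l B) (mset_set (extended_hook l i j)))}"

text \<open>
  Neither the cardinalities nor the multisets above degenerate: all sets involved are finite.
\<close>

lemma finite_shifted_diagram: "finite (shifted_diagram l)"
proof -
  have "shifted_diagram l \<subseteq>
      (\<lambda>(i, j). (i, j - num_parts l + i - 1)) ` (SIGMA i:{1..num_parts l}. {1..part l i})"
    by (force simp: shifted_diagram_def)
  then show ?thesis
    by (rule finite_subset) auto
qed

lemma finite_extended_hook: "finite (extended_hook l i j)"
proof -
  have "extended_hook l i j \<subseteq> shifted_diagram l \<union> {(i, j), (num_parts l + 1 + j, j)}"
    by (auto simp: extended_hook_def hook_def split: if_splits)
  then show ?thesis
    by (rule finite_subset) (simp add: finite_shifted_diagram)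
qed

lemma finite_bijective_fillings: "finite (bijective_fillings l)"
proof -
  have "bijective_fillings l \<subseteq> shifted_diagram l \<rightarrow>\<^sub>E {1..sum_list l}"
    by (auto simp: bijective_fillings_def PiE_def bij_betw_def)
  then show ?thesis
    by (rule finite_subset) (simp add: finite_PiE finite_shifted_diagram)
qed

lemma finite_SYT: "finite (SYT l)"
  by (rule finite_subset[OF _ finite_bijective_fillings]) (auto simp: SYT_def)

lemma finite_BS: "finite (BS l)"
  by (rule finite_subset[OF _ finite_bijective_fillings]) (auto simp: BS_def)

end

theory Submission
  imports Defs
begin

text \<open>
  Both sides count reduced words of signed permutations of the integers (odd bijections with finite
  support). Entries of a balanced tableau of shape \<open>\<lambda>\<close>, read as times at which inversions are created,
  are the reduced words of a dominant element: its row entries have Lehmer code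
  \<open>\<lambda>\<^sub>i - d + i - 1\<close>. Standard tableaux are the reduced words of the Grassmannian element whose negated
  values are the parts of \<open>\<lambda>\<close>. The two elements are connected by the type B transition equation, the
  Chevalley-type identity between the covers of an element that move a fixed position up and those that
  move it down; it follows by induction on the word length from the lifting property. Along the
  path from the dominant to the Grassmannian element every transition has a single term on each side, and
  it swaps two entries of the code, so that the code gets sorted.
\<close>

section \<open>Signed permutations and the transition equation\<close>

text \<open>Deleting the largest label from a balanced tableau leaves the dominant elements, so
  balance has to make sense for labellings of the inversions of every signed permutation. What
  depends on the shape is only the choice, for three positions with exactly two inversions, of the
  root whose hook records their forced order. This choice becomes a parameter, a relation on
  non-inversions that survives every deletion. The attached row and the repeated entry of an
  extended hook then come from encoding one root by several pairs of positions. A transition equates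
  two word counts only if it has one term on each side. This fails for arbitrary exchanges in the
  code. It holds if the code first increases and then decreases, and if the exchange takes the first
  descent and the first larger entry before it. The sorting is therefore an insertion sort, started
  from the decreasing code of the dominant element.\<close>

definition srefl :: "int \<Rightarrow> int \<Rightarrow> int \<Rightarrow> int" where
  "srefl a b v =
     (if v = a then b else if v = b then a
      else if v = - a then - b else if v = - b then - a else v)"

definition sperm :: "(int \<Rightarrow> int) \<Rightarrow> bool" where
  "sperm u \<longleftrightarrow> bij u \<and> (\<forall>x. u (- x) = - u x) \<and> (\<exists>m. \<forall>x. \<bar>x\<bar> > m \<longrightarrow> u x = x)"

text \<open>The simple reflections, acting on values.\<close>
definition sgen :: "int \<Rightarrow> int \<Rightarrow> int" where
  "sgen k = srefl (if k = 0 then - 1 else k) (k + 1)"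

definition desc :: "(int \<Rightarrow> int) \<Rightarrow> int \<Rightarrow> bool" where
  "desc u k \<longleftrightarrow> 0 \<le> k \<and> inv u (k + 1) < inv u k"

text \<open>
  The number of reduced words of \<open>u\<close> if \<open>n\<close> is its length, and \<open>0\<close> otherwise; this makes a length function
  unnecessary.
\<close>
fun num_words :: "nat \<Rightarrow> (int \<Rightarrow> int) \<Rightarrow> nat" where
  "num_words 0 u = (if u = id then 1 else 0)"
| "num_words (Suc n) u = (\<Sum>k\<in>{k. desc u k}. num_words n (sgen k \<circ> u))"

text \<open>
  Covering relation of the Bruhat order for the reflection exchanging the positions \<open>i\<close> and \<open>j\<close>; position
  \<open>0\<close> counts as an intermediate one, except for the reflections with \<open>j = -i\<close>.
\<close>
definition cov :: "(int \<Rightarrow> int) \<Rightarrow> int \<Rightarrow> int \<Rightarrow> bool" where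
  "cov u i j \<longleftrightarrow> i < j \<and> u i < u j \<and> i \<noteq> 0 \<and> j \<noteq> 0 \<and>
     (\<forall>e. i < e \<and> e < j \<and> u i < u e \<and> u e < u j \<longrightarrow> e = 0 \<and> i = - j)"

lemma srefl_invol [simp]: "a \<noteq> 0 \<Longrightarrow> b \<noteq> 0 \<Longrightarrow> srefl a b (srefl a b v) = v"
  by (auto simp: srefl_def)

lemma srefl_minus: "a \<noteq> 0 \<Longrightarrow> b \<noteq> 0 \<Longrightarrow> srefl a b (- v) = - srefl a b v"
  by (auto simp: srefl_def)

lemma srefl_commute: "a \<noteq> 0 \<Longrightarrow> b \<noteq> 0 \<Longrightarrow> srefl a b = srefl b a"
  by (rule ext) (auto simp: srefl_def)

lemma sgen_invol [simp]: "0 \<le> k \<Longrightarrow> sgen k (sgen k v) = v"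
  by (auto simp: sgen_def srefl_def)

lemma sgen_eq_iff [simp]: "0 \<le> k \<Longrightarrow> sgen k v = sgen k w \<longleftrightarrow> v = w"
  by (metis sgen_invol)

lemma sperm_refl: "a \<noteq> 0 \<Longrightarrow> b \<noteq> 0 \<Longrightarrow> sperm (srefl a b)"
  unfolding sperm_def
  by (intro conjI allI exI[of _ "\<bar>a\<bar> + \<bar>b\<bar>"])
     (auto simp: srefl_minus intro!: involuntory_imp_bij, auto simp: srefl_def)

lemma sperm_comp:
  assumes "sperm u" "sperm w"
  shows "sperm (u \<circ> w)"
proof -
  obtain m where m: "\<And>x. \<bar>x\<bar> > m \<Longrightarrow> u x = x" using assms(1) unfolding sperm_def by blast
  obtain n where n: "\<And>x. \<bar>x\<bar> > n \<Longrightarrow> w x = x" using assms(2) unfolding sperm_def by blast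
  have "(u \<circ> w) x = x" if "\<bar>x\<bar> > max m n" for x using that m[of x] n[of x] by simp
  then have "\<exists>m. \<forall>x. \<bar>x\<bar> > m \<longrightarrow> (u \<circ> w) x = x" by blast
  moreover have "(u \<circ> w) (- x) = - (u \<circ> w) x" for x using assms by (simp add: sperm_def)
  ultimately show ?thesis using assms unfolding sperm_def by (blast intro: bij_comp)
qed

lemma sperm_sgen: "0 \<le> k \<Longrightarrow> sperm (sgen k)"
  unfolding sgen_def by (rule sperm_refl) auto

lemma sperm_comp_refl: "sperm u \<Longrightarrow> a \<noteq> 0 \<Longrightarrow> b \<noteq> 0 \<Longrightarrow> sperm (u \<circ> srefl a b)"
  by (simp add: sperm_comp sperm_refl)

lemma sperm_sgen_comp: "sperm u \<Longrightarrow> 0 \<le> k \<Longrightarrow> sperm (sgen k \<circ> u)"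
  by (simp add: sperm_comp sperm_sgen)

lemma sperm_minus: "sperm u \<Longrightarrow> u (- x) = - u x"
  by (simp add: sperm_def)

lemma sperm_zero: "sperm u \<Longrightarrow> u 0 = 0"
  using sperm_minus[of u 0] by simp

lemma sperm_inj: "sperm u \<Longrightarrow> u x = u y \<longleftrightarrow> x = y"
  by (auto simp: sperm_def bij_def inj_def)

lemma sperm_zero_iff: "sperm u \<Longrightarrow> u x = 0 \<longleftrightarrow> x = 0"
  using sperm_inj[of u x 0] sperm_zero[of u] by simp

lemma sperm_inv: "sperm u \<Longrightarrow> inv u (u x) = x" "sperm u \<Longrightarrow> u (inv u x) = x"
  by (auto simp: sperm_def bij_def surj_f_inv_f)

lemma sperm_inv_sperm:
  assumes "sperm u"
  shows "sperm (inv u)"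
proof -
  obtain m where m: "\<And>x. \<bar>x\<bar> > m \<Longrightarrow> u x = x" using assms unfolding sperm_def by blast
  have "bij (inv u)" using assms by (simp add: sperm_def bij_imp_bij_inv)
  moreover have "inv u (- x) = - inv u x" for x
    by (metis assms sperm_inv sperm_minus)
  moreover have "inv u x = x" if "\<bar>x\<bar> > m" for x
    by (metis assms m sperm_inv(1) that)
  ultimately show ?thesis unfolding sperm_def by blast
qed

text \<open>Descending from a point beyond the support, strict monotonicity yields
  \<open>u x \<le> x\<close> everywhere; oddness turns this into the reverse inequality.\<close>

lemma sperm_strict_mono_id:
  assumes sp: "sperm u" and mono: "\<And>x y. x < y \<Longrightarrow> u x < u y"
  shows "u = id"
proof -
  obtain m where supp: "\<And>x. \<bar>x\<bar> > m \<Longrightarrow> u x = x" using sp unfolding sperm_def by blast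
  have up: "u (\<bar>m\<bar> + 1 - int k) \<le> \<bar>m\<bar> + 1 - int k" for k
  proof (induction k)
    case 0
    then show ?case using supp[of "\<bar>m\<bar> + 1"] by simp
  next
    case (Suc k)
    then show ?case using mono[of "\<bar>m\<bar> + 1 - int (Suc k)" "\<bar>m\<bar> + 1 - int k"] by simp
  qed
  have le: "u x \<le> x" for x
  proof (cases "x > \<bar>m\<bar>")
    case True
    then show ?thesis using supp[of x] by simp
  next
    case False
    then show ?thesis using up[of "nat (\<bar>m\<bar> + 1 - x)"] by simp
  qed
  have "u x = x" for x using le[of x] le[of "- x"] sperm_minus[OF sp, of x] by simp
  then show ?thesis by auto
qed

lemma inv_eq_iff_sperm: "sperm u \<Longrightarrow> inv u v = x \<longleftrightarrow> u x = v"
  by (metis sperm_inv)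

lemma inv_comp_refl:
  assumes "sperm u" "i \<noteq> 0" "j \<noteq> 0"
  shows "inv (u \<circ> srefl i j) v = inv u (srefl (u i) (u j) v)"
proof -
  have m: "u (- x) = - u x" for x using assms by (simp add: sperm_minus)
  have "u (srefl i j (inv u (srefl (u i) (u j) v))) = v"
  proof -
    have *: "srefl i j x = inv u (srefl (u i) (u j) (u x))" for x
      using assms by (auto simp: srefl_def sperm_inj sperm_inv m[symmetric])
    show ?thesis unfolding * using assms by (simp add: sperm_inv sperm_zero_iff)
  qed
  then show ?thesis
    using assms by (simp add: inv_eq_iff_sperm sperm_comp_refl)
qed

lemma inv_sgen_comp:
  assumes "sperm u" "0 \<le> k"
  shows "inv (sgen k \<circ> u) v = inv u (sgen k v)"
  using assms by (simp add: inv_eq_iff_sperm sperm_sgen_comp sperm_inv)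

text \<open>
  The lifting property for a cover, in terms of the function \<open>p\<close> from values to positions: \<open>a\<close> and \<open>b\<close> are
  the two exchanged values.
\<close>
lemma lifting_values:
  fixes p :: "int \<Rightarrow> int"
  assumes odd: "\<And>x. p (- x) = - p x" and inj: "\<And>x y. p x = p y \<longleftrightarrow> x = y"
    and k: "0 \<le> k" and ab: "a < b" "a \<noteq> 0" "b \<noteq> 0" "p a < p b"
    and n1: "\<not> (a = k \<and> b = k + 1)" and n2: "\<not> (a = - k - 1 \<and> b = - k)"
    and n3: "\<not> (k = 0 \<and> a = - 1 \<and> b = 1)"
  shows "(\<forall>c. a < c \<and> c < b \<and> p a < p c \<and> p c < p b \<longrightarrow> c = 0 \<and> a = - b) \<and>
           p (srefl a b (k + 1)) < p (srefl a b k) \<longleftrightarrow>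
         p (k + 1) < p k \<and> sgen k a < sgen k b \<and>
           (\<forall>c. sgen k a < sgen k c \<and> sgen k c < sgen k b \<and> p a < p c \<and> p c < p b
             \<longrightarrow> c = 0 \<and> a = - b)" (is "?L \<longleftrightarrow> ?R")
proof -
  define F where "F = {k, k + 1, - k, - k - 1}"
  \<comment> \<open>\<open>sgen k\<close> preserves the order of every pair of values that is not
    contained in \<open>F\<close>. For \<open>c\<close> outside \<open>F\<close> both betweenness
    conditions therefore agree and form \<open>Q\<close>; what remains is a finite check over
    \<open>F\<close>.\<close>
  define Q where "Q \<longleftrightarrow> (\<forall>c. c \<notin> F \<and> a < c \<and> c < b \<and> p a < p c \<and> p c < p b \<longrightarrow> c = 0 \<and> a = - b)"
  have p0: "p 0 = 0" using odd[of 0] by simp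
  have pm: "p (- k) = - p k" "p (- k - 1) = - p (k + 1)" "p (- 1 - k) = - p (k + 1)"
  proof -
    have "- k - 1 = - (k + 1)" "- 1 - k = - (k + 1)" by simp_all
    then show "p (- k) = - p k" "p (- k - 1) = - p (k + 1)" "p (- 1 - k) = - p (k + 1)"
      by (simp_all only: odd)
  qed
  have sF: "sgen k x = x" if "x \<notin> F" for x
    using that by (auto simp: F_def sgen_def srefl_def)
  have mono: "sgen k x < sgen k y \<longleftrightarrow> x < y" if "x \<notin> F \<or> y \<notin> F" for x y
    using that k by (auto simp: F_def sgen_def srefl_def)
  have L: "(\<forall>c. a < c \<and> c < b \<and> p a < p c \<and> p c < p b \<longrightarrow> c = 0 \<and> a = - b) \<longleftrightarrow>
    Q \<and> (\<forall>c\<in>F. a < c \<and> c < b \<and> p a < p c \<and> p c < p b \<longrightarrow> c = 0 \<and> a = - b)"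
    unfolding Q_def by blast
  have R: "(\<forall>c. sgen k a < sgen k c \<and> sgen k c < sgen k b \<and> p a < p c \<and> p c < p b
             \<longrightarrow> c = 0 \<and> a = - b) \<longleftrightarrow>
    Q \<and> (\<forall>c\<in>F. sgen k a < sgen k c \<and> sgen k c < sgen k b \<and> p a < p c \<and> p c < p b
             \<longrightarrow> c = 0 \<and> a = - b)"
    unfolding Q_def using mono by blast
  \<comment> \<open>For \<open>k \<noteq> 0\<close> the value 0 lies outside \<open>F\<close>, so
    \<open>Q\<close> can be applied to it.\<close>
  have Q0: "k \<noteq> 0 \<Longrightarrow> Q \<Longrightarrow> \<not> (a < 0 \<and> 0 < b \<and> p a < 0 \<and> 0 < p b \<and> a \<noteq> - b)"
    using k unfolding Q_def by (auto simp: F_def p0 dest!: spec[of _ 0])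
  have S: "sgen k k = (if k = 0 then 0 else k + 1)" "sgen k (k + 1) = (if k = 0 then - 1 else k)"
    "sgen k (- k) = (if k = 0 then 0 else - k - 1)" "sgen k (- k - 1) = (if k = 0 then 1 else - k)"
    using k by (auto simp: sgen_def srefl_def)
  have ball: "(\<forall>c\<in>F. R c) \<longleftrightarrow> R k \<and> R (k + 1) \<and> R (- k) \<and> R (- k - 1)" for R
    by (simp add: F_def)
  have rk: "srefl a b k = (if k = a then b else if k = b then a else if k = - a then - b else if k = - b then - a else k)"
    "srefl a b (k + 1) = (if k + 1 = a then b else if k + 1 = b then a else if k + 1 = - a then - b else if k + 1 = - b then - a else k + 1)"
    by (simp_all add: srefl_def)
  have pa: "p (- a) = - p a" "p (- b) = - p b" by (simp_all add: odd)
  have ne: "p k = p b \<longleftrightarrow> k = b" "p k = p a \<longleftrightarrow> k = a" "p (k + 1) = p b \<longleftrightarrow> k + 1 = b" "p (k + 1) = p a \<longleftrightarrow> k + 1 = a"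
     "p k = p (- b) \<longleftrightarrow> k = - b" "p k = p (- a) \<longleftrightarrow> k = - a" "p (k + 1) = p (- b) \<longleftrightarrow> k + 1 = - b" "p (k + 1) = p (- a) \<longleftrightarrow> k + 1 = - a"
     "p k = p (k + 1) \<longleftrightarrow> False" "p k = p 0 \<longleftrightarrow> k = 0" "p (k + 1) = p 0 \<longleftrightarrow> k + 1 = 0"
    by (simp_all add: inj)
  note ne' = ne[unfolded pa p0]
  have C4: ?thesis if aF: "a \<notin> F" and bF: "b \<notin> F"
  proof -
    have "srefl a b k = k" "srefl a b (k + 1) = k + 1"
      using aF bF by (auto simp: F_def srefl_def)
    then show ?thesis using mono[of a] mono[of _ b] aF bF ab(1) by (simp, blast)
  qed
  have sg: "sgen k x = (if x = k then (if k = 0 then 0 else k + 1)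
      else if x = k + 1 then (if k = 0 then - 1 else k)
      else if x = - k then (if k = 0 then 0 else - k - 1)
      else if x = - k - 1 then (if k = 0 then 1 else - k) else x)" for x
    using k by (auto simp: sgen_def srefl_def)
  have C1: ?thesis if "a \<in> F \<or> b \<in> F"
    unfolding L R unfolding ball rk
    using ab k ne' pm pa p0 Q0 n1 n2 n3 sg[of a] sg[of b] unfolding S
    by (smt (verit))
  show ?thesis using C1 C4 by blast
qed

lemma comp_srefl:
  assumes "sperm u"
  shows "u (srefl i j x) = srefl (u i) (u j) (u x)"
  using sperm_minus[OF assms, of i] sperm_minus[OF assms, of j]
  by (auto simp: srefl_def sperm_inj[OF assms] simp flip: sperm_minus[OF assms])

lemma comp_srefl_fun: "sperm u \<Longrightarrow> u \<circ> srefl i j = srefl (u i) (u j) \<circ> u"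
  by (auto simp: comp_srefl)

section \<open>Reflections exchanging adjacent nonzero values\<close>

definition succ0 :: "int \<Rightarrow> int" where
  "succ0 v = (if v = - 1 then 1 else v + 1)"

text \<open>The generator that exchanges \<open>v\<close> with its successor among the nonzero
  integers: the pairs \<open>(k, k + 1)\<close> and \<open>(- k - 1, - k)\<close> share the index
  \<open>k\<close>, and \<open>(- 1, 1)\<close> has index 0.\<close>

definition ascent_index :: "int \<Rightarrow> int" where
  "ascent_index v = (if v > 0 then v else - v - 1)"

lemma ascent_index_nonneg: "v \<noteq> 0 \<Longrightarrow> 0 \<le> ascent_index v"
  by (auto simp: ascent_index_def)

lemma srefl_succ0: "v \<noteq> 0 \<Longrightarrow> srefl v (succ0 v) = sgen (ascent_index v)"
  by (rule ext) (auto simp: srefl_def sgen_def succ0_def ascent_index_def)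

lemma sgen_moves:
  assumes "0 \<le> k" "a \<noteq> 0" "sgen k a \<noteq> a"
  shows "sgen k a = succ0 a \<and> k = ascent_index a \<or>
         a = succ0 (sgen k a) \<and> k = ascent_index (sgen k a)"
  using assms by (auto simp: srefl_def sgen_def succ0_def ascent_index_def split: if_splits)

lemma srefl_eq_sgen_iff:
  assumes "a \<noteq> 0" "b \<noteq> 0" "a \<noteq> b" "0 \<le> k"
  shows "srefl a b = sgen k \<longleftrightarrow>
    b = succ0 a \<and> k = ascent_index a \<or> a = succ0 b \<and> k = ascent_index b" (is "?L \<longleftrightarrow> ?R")
proof
  assume ?L
  moreover have "srefl a b a = b" by (simp add: srefl_def)
  ultimately have "sgen k a = b" by simp
  with sgen_moves[OF assms(4,1)] assms show ?R by auto
next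
  assume ?R
  then show ?L using srefl_succ0[OF assms(1)] srefl_succ0[OF assms(2)] srefl_commute[OF assms(1,2)] by auto
qed

lemma sgen_comp_srefl_eq_iff:
  assumes "sperm u" "i \<noteq> 0" "j \<noteq> 0" "0 \<le> k"
  shows "sgen k \<circ> u \<circ> srefl i j = u \<longleftrightarrow> srefl (u i) (u j) = sgen k"
proof -
  have nz: "u i \<noteq> 0" "u j \<noteq> 0" using assms by (auto simp: sperm_zero_iff)
  have "sgen k \<circ> u \<circ> srefl i j = u \<longleftrightarrow> (\<forall>x. sgen k (srefl (u i) (u j) (u x)) = u x)"
    by (auto simp: fun_eq_iff comp_srefl[OF assms(1)])
  also have "\<dots> \<longleftrightarrow> (\<forall>y. sgen k (srefl (u i) (u j) y) = y)"
    using sperm_inv(2)[OF assms(1)] by metis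
  also have "\<dots> \<longleftrightarrow> srefl (u i) (u j) = sgen k"
    unfolding fun_eq_iff using assms(4) by (metis sgen_invol)
  finally show ?thesis .
qed

text \<open>The excluded case means that \<open>sgen k\<close> exchanges the values
  \<open>u i\<close> and \<open>u j\<close>. In all other cases \<open>sgen k\<close> keeps their
  order, and passing to \<open>inv u\<close> reduces the claim to
  \<open>lifting_values\<close>.\<close>

lemma lifting:
  assumes u: "sperm u" and ij: "i < j" "i \<noteq> 0" "j \<noteq> 0" and k: "0 \<le> k"
    and ne: "sgen k \<circ> u \<circ> srefl i j \<noteq> u"
  shows "cov u i j \<and> desc (u \<circ> srefl i j) k \<longleftrightarrow> desc u k \<and> cov (sgen k \<circ> u) i j"
proof -
  let ?p = "inv u"
  have nz: "u i \<noteq> 0" "u j \<noteq> 0" using u ij by (auto simp: sperm_zero_iff[OF u])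
  have "srefl (u i) (u j) \<noteq> sgen k"
    using ne sgen_comp_srefl_eq_iff[OF u ij(2,3) k] by simp
  moreover have uij: "u i \<noteq> u j" using sperm_inj[OF u, of i j] ij(1) by simp
  ultimately have nadj: "\<not> (u j = succ0 (u i) \<and> k = ascent_index (u i))"
      "\<not> (u i = succ0 (u j) \<and> k = ascent_index (u j))"
    using srefl_eq_sgen_iff[OF nz uij k] by blast+
  show ?thesis
  proof (cases "u i < u j")
    case True
    have p: "?p (- x) = - ?p x" "?p x = ?p y \<longleftrightarrow> x = y" for x y
      using sperm_minus[OF sperm_inv_sperm[OF u]] sperm_inj[OF sperm_inv_sperm[OF u]] by auto
    have ex: "e = 0 \<and> i = - j \<longleftrightarrow> u e = 0 \<and> u i = - u j" for e
      using u by (simp add: sperm_zero_iff[OF u] sperm_inj[OF u] flip: sperm_minus[OF u])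
    have all: "(\<forall>e. P e) \<longleftrightarrow> (\<forall>c. P (?p c))" for P
      by (metis sperm_inv(1)[OF u])
    have *: "\<not> (u i = k \<and> u j = k + 1)" "\<not> (u i = - k - 1 \<and> u j = - k)"
        "\<not> (k = 0 \<and> u i = - 1 \<and> u j = 1)"
      using nadj nz k by (auto simp: succ0_def ascent_index_def)
    show ?thesis
      using lifting_values[of ?p k "u i" "u j", OF p k True nz _ *] ij True nz u
      unfolding cov_def desc_def all[of "\<lambda>e. i < e \<and> _ e \<longrightarrow> _ e"] ex
      by (simp add: sperm_inv inv_comp_refl k conj_ac)
  next
    case False
    then have "u j < u i" using uij by simp
    moreover have "\<not> sgen k (u i) < sgen k (u j)"
      using calculation nadj k nz by (auto simp: sgen_def srefl_def succ0_def ascent_index_def split: if_splits)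
    ultimately show ?thesis by (auto simp: cov_def)
  qed
qed

section \<open>Covers at a fixed position and the transition equation\<close>

definition covs :: "(int \<Rightarrow> int) \<Rightarrow> int \<Rightarrow> int \<Rightarrow> bool" where
  "covs u r s \<longleftrightarrow> cov u (min r s) (max r s)"

lemma covsD: "covs u r s \<Longrightarrow> s \<noteq> 0 \<and> s \<noteq> r"
  by (auto simp: covs_def cov_def min_def max_def split: if_splits)

text \<open>Finiteness matters because a sum over an infinite set would be 0 by convention.\<close>

lemma finite_desc:
  assumes "sperm u"
  shows "finite {k. desc u k}"
proof -
  obtain m where m: "\<And>x. \<bar>x\<bar> > m \<Longrightarrow> inv u x = x"
    using sperm_inv_sperm[OF assms] unfolding sperm_def by blast
  have "{k. desc u k} \<subseteq> {0..m}"
  proof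
    fix k assume "k \<in> {k. desc u k}"
    then have "0 \<le> k" "inv u (k + 1) < inv u k" by (auto simp: desc_def)
    then show "k \<in> {0..m}" using m[of k] m[of "k + 1"] by (cases "k \<le> m") auto
  qed
  then show ?thesis by (rule finite_subset) simp
qed

text \<open>The first position beyond the support and beyond \<open>r\<close> and \<open>u r\<close>
  is intermediate for every reflection that reaches further.\<close>

lemma finite_covs:
  assumes "sperm u"
  shows "finite {s. covs u r s}"
proof -
  obtain m0 where m0: "\<And>x. \<bar>x\<bar> > m0 \<Longrightarrow> u x = x"
    using assms unfolding sperm_def by blast
  define m where "m = max \<bar>m0\<bar> \<bar>r\<bar>"
  have m: "u x = x" if "\<bar>x\<bar> > m" for x using that m0[of x] by (auto simp: m_def)
  have r: "\<bar>r\<bar> \<le> m" by (simp add: m_def)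
  have bnd: "\<bar>u r\<bar> \<le> m"
  proof (rule ccontr)
    assume "\<not> \<bar>u r\<bar> \<le> m"
    then have "u (u r) = u r" by (intro m) simp
    then have "u r = r" using assms by (simp add: sperm_inj[OF assms])
    then show False using r \<open>\<not> \<bar>u r\<bar> \<le> m\<close> by simp
  qed
  have "s \<in> {- m - 1..m + 1}" if s: "covs u r s" for s
  proof (rule ccontr)
    assume "s \<notin> {- m - 1..m + 1}"
    then consider "s > m + 1" | "s < - m - 1" by fastforce
    then show False
    proof cases
      case 1
      then have "cov u r s" using s r by (simp add: covs_def min_def max_def split: if_splits)
      moreover have "u s = s" "u (m + 1) = m + 1" using 1 r by (auto intro!: m)
      ultimately show False using 1 r bnd unfolding cov_def by (auto dest!: spec[of _ "m + 1"])
    next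
      case 2
      then have "cov u s r" using s r by (simp add: covs_def min_def max_def split: if_splits)
      moreover have "u s = s" "u (- m - 1) = - m - 1" using 2 r by (auto intro!: m)
      ultimately show False using 2 r bnd unfolding cov_def by (auto dest!: spec[of _ "- m - 1"])
    qed
  qed
  then have "{s. covs u r s} \<subseteq> {- m - 1..m + 1}" by blast
  then show ?thesis by (rule finite_subset) simp
qed

text \<open>The only value that can lie between the two is 0, between -1 and 1. The positions are
  then opposite, which is the exemption in \<open>cov\<close>.\<close>

lemma cov_succ0:
  assumes "sperm u" "u j = succ0 (u i)" "i < j" "i \<noteq> 0" "j \<noteq> 0"
  shows "cov u i j"
proof -
  have "e = 0 \<and> i = - j" if "u i < u e" "u e < u j" for e
  proof -
    have "u i = - 1" "u e = 0" "u j = 1"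
      using that assms(2) by (auto simp: succ0_def split: if_splits)
    moreover from this have "u (- j) = u i" using sperm_minus[OF assms(1), of j] by simp
    ultimately show ?thesis
      using sperm_inj[OF assms(1), of "- j" i] sperm_zero_iff[OF assms(1), of e] by simp
  qed
  moreover have "u i < u j" using assms(2) by (auto simp: succ0_def)
  ultimately show ?thesis using assms by (auto simp: cov_def)
qed

lemma desc_succ0:
  assumes u: "sperm u" and "u j = succ0 (u i)" "i \<noteq> 0" "j \<noteq> 0"
  shows "desc u (ascent_index (u i)) \<longleftrightarrow> j < i"
proof -
  have p: "inv u (- x) = - inv u x" for x
    using sperm_inv_sperm[OF u] by (rule sperm_minus)
  have i: "inv u (u i) = i" "inv u (u j) = j" using u by (simp_all add: sperm_inv)
  have nz: "u i \<noteq> 0" using assms by (simp add: sperm_zero_iff[OF u])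
  consider "u i > 0" | "u i = - 1" | "u i < - 1" using nz by linarith
  then show ?thesis
  proof cases
    case 1
    then show ?thesis using i assms by (simp add: desc_def ascent_index_def succ0_def)
  next
    case 2
    then have "u j = 1" using assms by (simp add: succ0_def)
    then have "inv u 1 = j" "inv u 1 = - i" using i p[of 1] 2 by auto
    moreover have "inv u 0 = 0" using sperm_zero[OF sperm_inv_sperm[OF u]] .
    ultimately show ?thesis using 2 by (auto simp: desc_def ascent_index_def)
  next
    case 3
    then have "u j = u i + 1" using assms by (simp add: succ0_def)
    then have "inv u (- u i) = - i" "inv u (- u i - 1) = - j"
      using i p[of "u i"] p[of "u j"] by simp_all
    then show ?thesis using 3 by (simp add: desc_def ascent_index_def)
  qed
qed

text \<open>For adjacent values \<open>u \<circ> srefl i j\<close> coincides with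
  \<open>sgen k \<circ> u\<close>. A pair that escapes the lifting property thus occurs on exactly
  one side, decided by the order of \<open>i\<close> and \<open>j\<close>.\<close>

lemma succ0_cover_cases:
  assumes u: "sperm u" and ij: "u j = succ0 (u i)" "i \<noteq> 0" "j \<noteq> 0"
  defines "k \<equiv> ascent_index (u i)"
  shows "covs u i j \<and> desc (u \<circ> srefl i j) k \<longleftrightarrow> i < j"
    and "desc u k \<and> covs (sgen k \<circ> u) i j \<longleftrightarrow> j < i"
proof -
  have nz: "u i \<noteq> 0" using u ij by (simp add: sperm_zero_iff[OF u])
  have "u i < u j" using ij by (auto simp: succ0_def)
  then have neq: "i \<noteq> j" by auto
  define u' where "u' = u \<circ> srefl i j"
  have u': "sperm u'" unfolding u'_def using u ij by (simp add: sperm_comp_refl)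
  have v: "u' i = u j" "u' j = u i" by (simp_all add: u'_def srefl_def)
  have eq: "sgen k \<circ> u = u'"
    unfolding u'_def comp_srefl_fun[OF u] k_def ij(1) srefl_succ0[OF nz] ..
  have d': "desc u' k \<longleftrightarrow> i < j"
    using desc_succ0[OF u', of i j] ij v by (simp add: k_def)
  have d: "desc u k \<longleftrightarrow> j < i"
    using desc_succ0[OF u ij] by (simp add: k_def)
  have c: "covs u i j" if "i < j"
    using cov_succ0[OF u ij(1) that ij(2,3)] that by (simp add: covs_def min_def max_def)
  have c': "covs u' i j" if "j < i"
    using cov_succ0[OF u', of i j] ij v that by (simp add: covs_def min_def max_def)
  show "covs u i j \<and> desc (u \<circ> srefl i j) k \<longleftrightarrow> i < j"
    using c d' by (auto simp: u'_def)
  show "desc u k \<and> covs (sgen k \<circ> u) i j \<longleftrightarrow> j < i"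
    using c' d eq by auto
qed

lemma covs_commute: "covs u r s \<longleftrightarrow> covs u s r"
  by (simp add: covs_def min.commute max.commute)

text \<open>
  In the induction step the terms for \<open>u\<close> and those for all \<open>sgen k \<circ> u\<close> agree by the lifting property,
  except for the two reflections that map \<open>u r\<close> to an adjacent value, and these cancel.
\<close>
lemma transition_signed:
  assumes "sperm u" "r \<noteq> 0"
  shows "(\<Sum>s\<in>{s. covs u r s}. (if r < s then 1 else - 1) * int (num_words n (u \<circ> srefl r s))) = 0"
  using assms(1)
proof (induction n arbitrary: u)
  case 0
  have "num_words 0 (u \<circ> srefl r s) = 0" if s: "covs u r s" for s
  proof -
    define i j where "i = min r s" and "j = max r s"
    have *: "srefl r s = srefl i j"
      using srefl_commute[of r s] assms(2) covsD[OF s] by (auto simp: i_def j_def min_def max_def)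
    have "u i < u j" "i < j" using s by (auto simp: covs_def cov_def i_def j_def)
    then have "(u \<circ> srefl i j) j < (u \<circ> srefl i j) i" by (simp add: srefl_def)
    then have "u \<circ> srefl i j \<noteq> id" using \<open>i < j\<close> by (metis id_apply less_asym)
    then show ?thesis by (simp add: *)
  qed
  then show ?case by (intro sum.neutral ballI) (simp only: mem_Collect_eq mult_zero_right of_nat_0)
next
  case (Suc n)
  define eps :: "int \<Rightarrow> int" where "eps s = (if r < s then 1 else - 1)" for s
  define G where "G = (\<lambda>(s, k). eps s * int (num_words n (sgen k \<circ> u \<circ> srefl r s)))"
  \<comment> \<open>\<open>A\<close> applies the cover first and the descent afterwards,
    \<open>B\<close> the other way round. Both arrive at
    \<open>sgen k \<circ> u \<circ> srefl r s\<close>, so one summand \<open>G\<close> serves both;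
    \<open>X\<close> consists of the pairs to which lifting does not apply.\<close>
  define A where "A = (SIGMA s:{s. covs u r s}. {k. desc (u \<circ> srefl r s) k})"
  define B where "B = {(s, k). desc u k \<and> covs (sgen k \<circ> u) r s}"
  define B' where "B' = (SIGMA k:{k. desc u k}. {s. covs (sgen k \<circ> u) r s})"
  define X where "X = {(s, k). s \<noteq> 0 \<and> s \<noteq> r \<and> 0 \<le> k \<and> sgen k \<circ> u \<circ> srefl r s = u}"
  note u = Suc.prems
  have BB': "B = prod.swap ` B'" by (auto simp: B_def B'_def)
  have finB': "finite B'"
    unfolding B'_def using u
    by (intro finite_SigmaI finite_desc) (auto intro!: finite_covs sperm_sgen_comp simp: desc_def)
  then have finB: "finite B" by (simp add: BB')
  have finA: "finite A"
    unfolding A_def using u assms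
    by (intro finite_SigmaI finite_desc finite_covs sperm_comp_refl) (auto dest: covsD)
  have "(\<Sum>s\<in>{s. covs u r s}. eps s * int (num_words (Suc n) (u \<circ> srefl r s))) =
      (\<Sum>s\<in>{s. covs u r s}. \<Sum>k\<in>{k. desc (u \<circ> srefl r s) k}. G (s, k))"
    by (simp add: G_def sum_distrib_left o_assoc)
  also have "\<dots> = sum G A"
    unfolding A_def using u assms
    by (subst sum.Sigma) (auto intro!: finite_desc finite_covs sperm_comp_refl dest: covsD)
  finally have sumA: "(\<Sum>s\<in>{s. covs u r s}. eps s * int (num_words (Suc n) (u \<circ> srefl r s))) = sum G A" .
  have "sum G B = (\<Sum>x\<in>B'. G (prod.swap x))"
    unfolding BB' by (subst sum.reindex) auto
  also have "\<dots> = (\<Sum>k\<in>{k. desc u k}. \<Sum>s\<in>{s. covs (sgen k \<circ> u) r s}. G (s, k))"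
    unfolding B'_def using u
    by (subst sum.Sigma) (auto intro!: finite_desc finite_covs sperm_sgen_comp simp: desc_def split_def prod.swap_def)
  also have "\<dots> = 0"
  proof (rule sum.neutral, rule ballI)
    fix k assume "k \<in> {k. desc u k}"
    then have "sperm (sgen k \<circ> u)" using u by (simp add: desc_def sperm_sgen_comp)
    from Suc.IH[OF this] show "(\<Sum>s\<in>{s. covs (sgen k \<circ> u) r s}. G (s, k)) = 0"
      unfolding G_def eps_def by (simp only: prod.case)
  qed
  finally have sumB: "sum G B = 0" .
  have AB: "A - X = B - X"
  proof -
    have "(s, k) \<in> A \<longleftrightarrow> (s, k) \<in> B" if nX: "(s, k) \<notin> X" for s k
    proof (cases "s \<noteq> 0 \<and> s \<noteq> r \<and> 0 \<le> k")
      case True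
      define i j where "i = min r s" and "j = max r s"
      have *: "srefl r s = srefl i j"
        using srefl_commute[of r s] assms(2) True by (auto simp: i_def j_def min_def max_def)
      have "sgen k \<circ> u \<circ> srefl i j \<noteq> u" using nX True by (simp add: X_def *)
      then have "cov u i j \<and> desc (u \<circ> srefl i j) k \<longleftrightarrow> desc u k \<and> cov (sgen k \<circ> u) i j"
        using lifting[OF u, of i j k] True assms(2) by (auto simp: i_def j_def min_def max_def)
      then show ?thesis by (simp add: A_def B_def covs_def * flip: i_def j_def)
    next
      case False
      then show ?thesis by (auto simp: A_def B_def desc_def dest: covsD)
    qed
    then show ?thesis by auto
  qed
  \<comment> \<open>The positions of the next larger and the next smaller nonzero value.\<close>
  define U where "U = inv u (succ0 (u r))"
  define D where "D = inv u (if u r = 1 then - 1 else u r - 1)"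
  have ur: "u r \<noteq> 0" using u assms by (simp add: sperm_zero_iff[OF u])
  have uU: "u U = succ0 (u r)" using u by (simp add: U_def sperm_inv)
  have uD: "u r = succ0 (u D)" using u ur by (simp add: D_def sperm_inv succ0_def)
  have uD': "u D = (if u r = 1 then - 1 else u r - 1)" using u by (simp add: D_def sperm_inv)
  have nz: "U \<noteq> 0" "D \<noteq> 0" "U \<noteq> r" "D \<noteq> r" "U \<noteq> D"
    using uU uD' ur sperm_zero[OF u] by (auto simp: succ0_def split: if_splits)
  define xU xD where "xU = (U, ascent_index (u r))" and "xD = (D, ascent_index (u D))"
  have X: "X = {xU, xD}"
  proof -
    have "(s, k) \<in> X \<longleftrightarrow> (s, k) = xU \<or> (s, k) = xD" for s k
    proof (cases "s \<noteq> 0 \<and> s \<noteq> r \<and> 0 \<le> k")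
      case True
      have "(s, k) \<in> X \<longleftrightarrow> srefl (u r) (u s) = sgen k"
        using True sgen_comp_srefl_eq_iff[OF u assms(2), of s k] by (simp add: X_def)
      also have "\<dots> \<longleftrightarrow> u s = succ0 (u r) \<and> k = ascent_index (u r) \<or> u r = succ0 (u s) \<and> k = ascent_index (u s)"
        using True u ur by (intro srefl_eq_sgen_iff) (auto simp: sperm_zero_iff[OF u] sperm_inj[OF u])
      also have "u s = succ0 (u r) \<longleftrightarrow> s = U"
        using sperm_inj[OF u, of s U] uU by simp
      also have "u r = succ0 (u s) \<longleftrightarrow> s = D"
      proof -
        have "u r = succ0 (u s) \<longleftrightarrow> u s = u D"
          using uD' ur True sperm_zero_iff[OF u, of s] by (auto simp: succ0_def split: if_splits)
        then show ?thesis using sperm_inj[OF u] by simp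
      qed
      finally show ?thesis by (auto simp: xU_def xD_def)
    next
      case False
      have "0 \<le> ascent_index (u r)" "0 \<le> ascent_index (u D)"
        using ur nz u by (auto intro!: ascent_index_nonneg simp: sperm_zero_iff[OF u])
      then show ?thesis using False nz by (auto simp: X_def xU_def xD_def)
    qed
    then show ?thesis by auto
  qed
  have mU: "xU \<in> A \<longleftrightarrow> r < U" "xU \<in> B \<longleftrightarrow> U < r"
    using succ0_cover_cases[OF u uU assms(2) nz(1)] by (simp_all add: A_def B_def xU_def)
  have mD: "xD \<in> A \<longleftrightarrow> D < r" "xD \<in> B \<longleftrightarrow> r < D"
    using succ0_cover_cases[OF u uD nz(2) assms(2)] srefl_commute[OF assms(2) nz(2)]
    by (simp_all add: A_def B_def xD_def covs_commute[of _ r])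
  have GX: "G xU = eps U * int (num_words n u)" "G xD = eps D * int (num_words n u)"
  proof -
    have "xU \<in> X" "xD \<in> X" using X by auto
    then show "G xU = eps U * int (num_words n u)" "G xD = eps D * int (num_words n u)"
      by (simp_all add: X_def xU_def xD_def G_def)
  qed
  have "xU \<noteq> xD" using nz by (simp add: xU_def xD_def)
  have "sum G A - sum G B = sum G (A \<inter> X) - sum G (B \<inter> X)"
    using sum.subset_diff[of "A \<inter> X" A G] sum.subset_diff[of "B \<inter> X" B G] finA finB AB
    by (simp add: Diff_Int)
  also have "\<dots> = (if r < U then G xU else 0) + (if D < r then G xD else 0)
      - ((if U < r then G xU else 0) + (if r < D then G xD else 0))"
    using \<open>xU \<noteq> xD\<close> mU mD unfolding X by (simp add: Int_insert_right)
  \<comment> \<open>\<open>xU\<close> contributes \<open>num_words n u\<close> in either case: with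
    sign +1 in \<open>A\<close> if \<open>r < U\<close>, and with sign -1 in the subtracted sum over
    \<open>B\<close> if \<open>U < r\<close>. By the same reasoning \<open>xD\<close> contributes
    the negative of it.\<close>
  also have "\<dots> = 0" using nz by (auto simp: GX eps_def)
  finally have "sum G A = 0" using sumB by simp
  with sumA show ?case unfolding eps_def by (simp only:)
qed

theorem transition:
  assumes "sperm u" "r \<noteq> 0"
  shows "(\<Sum>s\<in>{s. cov u r s}. num_words n (u \<circ> srefl r s)) =
         (\<Sum>s\<in>{s. cov u s r}. num_words n (u \<circ> srefl r s))"
proof -
  have eq: "{s. covs u r s} = {s. cov u r s} \<union> {s. cov u s r}"
    by (auto simp: covs_def cov_def min_def max_def)
  have fin: "finite {s. cov u r s}" "finite {s. cov u s r}"
    using finite_covs[OF assms(1), of r] unfolding eq by simp_all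
  have disj: "{s. cov u r s} \<inter> {s. cov u s r} = {}" by (auto simp: cov_def)
  let ?g = "\<lambda>s. (if r < s then 1 else - 1) * int (num_words n (u \<circ> srefl r s))"
  have "sum ?g {s. cov u r s} = (\<Sum>s\<in>{s. cov u r s}. int (num_words n (u \<circ> srefl r s)))"
    by (rule sum.cong) (auto simp: cov_def)
  moreover have "sum ?g {s. cov u s r} = - (\<Sum>s\<in>{s. cov u s r}. int (num_words n (u \<circ> srefl r s)))"
    unfolding sum_negf[symmetric] by (rule sum.cong) (auto simp: cov_def)
  ultimately show ?thesis
    using transition_signed[OF assms, of n] sum.union_disjoint[OF fin disj, of ?g]
    unfolding eq by (simp flip: of_nat_sum)
qed

section \<open>Sorting the code by transitions\<close>

text \<open>The Lehmer code of the positive values.\<close>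
definition code :: "(int \<Rightarrow> int) \<Rightarrow> int \<Rightarrow> nat" where
  "code u x = card {v. 0 < v \<and> v < u x \<and> x < inv u v}"

abbreviation right_below :: "(int \<Rightarrow> int) \<Rightarrow> int \<Rightarrow> int set" where
  "right_below u x \<equiv> {v. 0 < v \<and> v < u x \<and> x < inv u v}"

text \<open>The common shape of all elements along the sorting path: the positions
  \<open>-d, ..., -1\<close> stand for the rows of the diagram, and by oddness the negative values
  sit at \<open>1, ..., d\<close> and below \<open>-d\<close>.\<close>

locale rows =
  fixes d :: int and u :: "int \<Rightarrow> int"
  assumes sp: "sperm u"
    and row_pos: "- d \<le> x \<Longrightarrow> x < 0 \<Longrightarrow> 0 < u x"
    and out_pos: "d < x \<Longrightarrow> 0 < u x"
    and out_mono: "d < x \<Longrightarrow> x < y \<Longrightarrow> u x < u y"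
    and d_nonneg: "0 \<le> d"
begin

lemma neg: "u (- x) = - u x"
  using sperm_minus[OF sp] .

lemma zero: "u 0 = 0"
  using sperm_zero[OF sp] .

lemma val_eq: "u x = u y \<longleftrightarrow> x = y"
  using sperm_inj[OF sp] .

lemma inv_val: "inv u (u x) = x" "u (inv u v) = v"
  using sperm_inv[OF sp] by auto

lemma finite_vals: "finite {v :: int. 0 < v \<and> v < a \<and> P v}"
  by (rule finite_subset[of _ "{0..a}"]) auto

lemma pos_cases: "0 < u x \<Longrightarrow> - d \<le> x \<and> x < 0 \<or> d < x"
proof (rule ccontr)
  assume *: "0 < u x" "\<not> (- d \<le> x \<and> x < 0 \<or> d < x)"
  then consider "x = 0" | "d < - x" | "- d \<le> - x" "- x < 0" by linarith
  then show False using * row_pos[of "- x"] out_pos[of "- x"] zero neg[of x] by cases auto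
qed

lemma card_less_code:
  "A \<subseteq> right_below u y \<Longrightarrow> v \<in> right_below u y \<Longrightarrow> v \<notin> A \<Longrightarrow> card A < code u y"
  unfolding code_def by (rule psubset_card_mono[OF finite_vals]) blast

lemma code_less:
  assumes "x < y" "0 < u y" "u y < u x"
  shows "code u y < code u x"
proof -
  have "right_below u y \<subseteq> right_below u x" "u y \<in> right_below u x" "u y \<notin> right_below u y"
    using assms inv_val(1)[of y] by auto
  from card_less_code[OF this] show ?thesis unfolding code_def[of u y] .
qed

lemma increasing_of_code_le:
  assumes "- d \<le> x" "x < y" "y < 0" "code u x \<le> code u y"
  shows "u x < u y"
proof (rule ccontr)
  assume "\<not> u x < u y"
  moreover have "u x \<noteq> u y" using assms val_eq[of x y] by simp
  ultimately show False using code_less[of x y] row_pos[of y] assms by simp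
qed

end

text \<open>
  One step of the sorting: \<open>r\<close> is the first descent of the code and \<open>s\<close> the first row with a larger entry.
  The transition at position \<open>r\<close> of the element with the entries \<open>r\<close> and \<open>s\<close> exchanged has one term on
  either side.
\<close>
locale code_step = rows +
  fixes r s :: int
  assumes s: "- d \<le> s" "s < r" and r: "r < 0"
    and up: "- d \<le> x \<Longrightarrow> x < y \<Longrightarrow> y < r \<Longrightarrow> code u x \<le> code u y"
    and down: "r \<le> x \<Longrightarrow> x < y \<Longrightarrow> y < 0 \<Longrightarrow> code u y \<le> code u x"
    and sr: "code u r < code u s"
    and s_min: "- d \<le> x \<Longrightarrow> x < s \<Longrightarrow> code u x \<le> code u r"
begin

lemma prefix: "- d \<le> x \<Longrightarrow> x < y \<Longrightarrow> y < r \<Longrightarrow> u x < u y"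
  using increasing_of_code_le[of x y] up[of x y] r by linarith

lemma before_s: "- d \<le> x \<Longrightarrow> x < s \<Longrightarrow> u x < u r"
proof (rule ccontr)
  assume *: "- d \<le> x" "x < s" "\<not> u x < u r"
  moreover have "u x \<noteq> u r" using * s val_eq[of x r] by simp
  ultimately show False using code_less[of x r] s_min[of x] row_pos[of r] r s by simp
qed

lemma between: "s < x \<Longrightarrow> x < r \<Longrightarrow> u s < u x"
  using prefix[of s x] s(1) by linarith

text \<open>All values strictly between \<open>s\<close> and \<open>r\<close> exceed
  \<open>u s\<close>. If \<open>u s\<close> were below \<open>u r\<close>, every value counted by
  the code at \<open>s\<close> would also be counted at \<open>r\<close>.\<close>

lemma u_sr: "u r < u s"
proof (rule ccontr)
  assume "\<not> u r < u s"
  then have lt: "u s < u r" using val_eq[of r s] s by linarith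
  have "code u s \<le> code u r" unfolding code_def
  proof (rule card_mono[OF finite_vals], rule subsetI)
    fix v assume v: "v \<in> right_below u s"
    have "\<not> inv u v < r" using between[of "inv u v"] v inv_val(2)[of v] by auto
    moreover have "inv u v \<noteq> r" using v lt inv_val(2)[of v] by auto
    ultimately show "v \<in> right_below u r" using v lt by auto
  qed
  then show False using sr by simp
qed

definition "u1 = u \<circ> srefl s r"

lemma u1_vals:
  "u1 s = u r" "u1 r = u s" "u1 (- s) = - u r" "u1 (- r) = - u s"
  "x \<noteq> s \<Longrightarrow> x \<noteq> r \<Longrightarrow> x \<noteq> - s \<Longrightarrow> x \<noteq> - r \<Longrightarrow> u1 x = u x"
proof -
  have "s \<noteq> r" "s \<noteq> - r" "s \<noteq> - s" "r \<noteq> - r" using s r by auto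
  then show "u1 s = u r" "u1 r = u s" "u1 (- s) = - u r" "u1 (- r) = - u s"
    by (simp_all add: u1_def srefl_def neg)
  show "u1 x = u x" if "x \<noteq> s" "x \<noteq> r" "x \<noteq> - s" "x \<noteq> - r" using that by (simp add: u1_def srefl_def)
qed

lemma sp_u1: "sperm u1"
  unfolding u1_def by (rule sperm_comp_refl[OF sp]) (use s r in linarith)+

text \<open>For every \<open>i\<close> left of \<open>s\<close> the position \<open>s\<close> is
  intermediate, since its new value \<open>u r\<close> exceeds the value at \<open>i\<close>: for
  rows by the choice of \<open>s\<close>, below \<open>-d\<close> by sign. Positions between
  \<open>s\<close> and \<open>r\<close> carry values that are too large.\<close>

lemma cov_left: "{i. cov u1 i r} = {s}"
proof -
  have "cov u1 s r"
  proof -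
    have "u1 e = u e \<and> u s < u e" if "s < e" "e < r" for e
      using between[OF that] u1_vals(5)[of e] that s r by auto
    then show ?thesis unfolding cov_def u1_vals(1,2) using s r u_sr by force
  qed
  moreover have "i = s" if c: "cov u1 i r" for i
  proof (rule ccontr)
    assume "i \<noteq> s"
    have lt: "i < r" "u1 i < u s" and no: "\<And>e. i < e \<Longrightarrow> e < r \<Longrightarrow> u1 i < u1 e \<Longrightarrow> u1 e < u s \<Longrightarrow> e = 0"
      using c by (auto simp: cov_def u1_vals)
    consider "s < i" | "- d \<le> i" "i < s" | "i < - d" using \<open>i \<noteq> s\<close> by linarith
    then show False
    proof cases
      case 1
      then show False using lt between[of i] u1_vals(5)[of i] r s by auto
    next
      case 2
      then have "u1 i = u i" using u1_vals(5)[of i] s r by auto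
      then show False using no[of s] before_s[of i] 2 s u_sr r by (auto simp: u1_vals)
    next
      case 3
      then have "u1 i < 0" using u1_vals(5)[of i] s r out_pos[of "- i"] neg[of i] by auto
      then show False using no[of s] 3 s u_sr r row_pos[of r] by (auto simp: u1_vals)
    qed
  qed
  ultimately show ?thesis by auto
qed

lemma u1_right: "r < i \<Longrightarrow> 0 < u1 i \<Longrightarrow> u1 i = u i"
proof -
  assume *: "r < i" "0 < u1 i"
  have "0 < u s" "0 < u r" using row_pos[of s] row_pos[of r] s r by auto
  then have "i \<noteq> - s" "i \<noteq> - r" using * u1_vals(3,4) by auto
  then show ?thesis using u1_vals(5)[of i] * s by simp
qed

text \<open>In \<open>u1\<close> the position \<open>r\<close> carries \<open>u s\<close>, so these
  are the candidates for an upward cover at \<open>r\<close>.\<close>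

definition "later = {i. r < i \<and> u s < u i}"

lemma u_s_pos: "0 < u s"
  using row_pos[of s] s r by simp

lemma later_cases: "i \<in> later \<Longrightarrow> r < i \<and> i < 0 \<or> d < i"
  using pos_cases[of i] u_s_pos unfolding later_def by fastforce

definition "i0 = (LEAST i. i \<in> later)"

lemma i0: "i0 \<in> later" "i \<in> later \<Longrightarrow> i0 \<le> i"
proof -
  obtain m where m: "\<And>x. \<bar>x\<bar> > m \<Longrightarrow> u x = x" using sp unfolding sperm_def by blast
  let ?b = "\<bar>m\<bar> + \<bar>u s\<bar> + 1"
  have b: "?b \<in> later" using m[of ?b] r by (auto simp: later_def)
  define g where "g = nat \<circ> (\<lambda>i. i - r)"
  obtain j where j: "j \<in> later" "\<And>i. i \<in> later \<Longrightarrow> g j \<le> g i"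
    using ex_has_least_nat[of "\<lambda>i. i \<in> later" ?b g] b by blast
  have "j \<le> i" if "i \<in> later" for i
    using j(1) j(2)[OF that] that by (auto simp: g_def later_def)
  then have "i0 = j" unfolding i0_def using j(1) by (intro Least_equality) auto
  then show "i0 \<in> later" "i \<in> later \<Longrightarrow> i0 \<le> i" using j(1) \<open>\<And>i. i \<in> later \<Longrightarrow> j \<le> i\<close> by auto
qed

lemma i0_facts: "r < i0" "u s < u i0" "i0 \<noteq> 0" "i0 \<noteq> - r" "i0 \<noteq> - s" "i0 < 0 \<or> d < i0"
proof -
  show "r < i0" "u s < u i0" using i0(1) by (simp_all add: later_def)
  show "i0 < 0 \<or> d < i0" using later_cases[OF i0(1)] by blast
  then show "i0 \<noteq> 0" "i0 \<noteq> - r" "i0 \<noteq> - s" using s r by linarith+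
qed

lemma low_before_i0: "r < x \<Longrightarrow> x < i0 \<Longrightarrow> u x < u s"
proof -
  assume *: "r < x" "x < i0"
  then have "x \<notin> later" using i0(2)[of x] by auto
  then have "u x \<le> u s" using * by (simp add: later_def)
  moreover have "u x \<noteq> u s" using val_eq[of x s] * s by simp
  ultimately show ?thesis by simp
qed

text \<open>Here the decrease of the code from \<open>r\<close> on is used. A smaller candidate
  \<open>u j\<close> behind \<open>i0\<close> would be counted at the row \<open>i0\<close> in
  addition to at least as many values as are counted at some row of \<open>r, ..., i0 - 1\<close>,
  so the code would rise.\<close>

lemma i0_least_value:
  assumes j: "j \<in> later" "j \<noteq> i0"
  shows "u i0 < u j"
proof (rule ccontr)
  assume "\<not> u i0 < u j"
  then have lt: "u j < u i0" using val_eq[of j i0] j(2) by linarith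
  have ij: "i0 < j" using i0(2)[OF j(1)] j(2) by simp
  have jr: "u s < u j" using j(1) by (simp add: later_def)
  have i0P: "i0 < 0" using i0_facts(6) out_mono[OF _ ij] lt by auto
  have key: "code u i0 \<le> code u x" if "r \<le> x" "x < i0" for x
    using down[OF that i0P] .
  show False
  proof (cases "i0 = r + 1")
    case True
    \<comment> \<open>No row lies between \<open>r\<close> and \<open>i0\<close>. Compared with the
      count at \<open>s\<close>, the set \<open>?A\<close> loses at most the value
      \<open>u r\<close>, so it still has at least \<open>code u r\<close> elements;
      \<open>u j\<close> is one more for \<open>i0\<close>.\<close>
    let ?A = "{v. 0 < v \<and> v < u s \<and> r < inv u v}"
    have A: "right_below u s \<subseteq> insert (u r) ?A"
    proof
      fix v assume v: "v \<in> right_below u s"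
      have "\<not> inv u v < r" using between[of "inv u v"] v inv_val(2)[of v] by auto
      then show "v \<in> insert (u r) ?A" using v inv_val(2)[of v] by (cases "inv u v = r") auto
    qed
    have finA: "finite ?A" by (rule finite_vals)
    have "code u s \<le> card (insert (u r) ?A)"
      unfolding code_def by (rule card_mono[OF _ A]) (use finA in simp)
    also have "\<dots> \<le> Suc (card ?A)" by (rule card_insert_le_m1) simp_all
    finally have "code u r \<le> card ?A" using sr by simp
    moreover have "card ?A < code u i0"
    proof (rule card_less_code)
      show "?A \<subseteq> right_below u i0"
      proof
        fix v assume v: "v \<in> ?A"
        have "inv u v \<noteq> i0" using v inv_val(2)[of v] i0_facts(2) by auto
        then show "v \<in> right_below u i0" using v i0_facts(2) True by auto
      qed
      show "u j \<in> right_below u i0" using lt ij jr u_s_pos inv_val(1)[of j] by auto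
      show "u j \<notin> ?A" using jr by simp
    qed
    ultimately show False using key[of r] i0_facts(1) by simp
  next
    case False
    have "r + 1 \<in> {r<..<i0}" using False i0_facts(1) by simp
    then have ne: "{r<..<i0} \<noteq> {}" by blast
    then have "Min (u ` {r<..<i0}) \<in> u ` {r<..<i0}" by (intro Min_in) auto
    \<comment> \<open>The row of smallest value between \<open>r\<close> and \<open>i0\<close>:
      whatever is smaller and to its right stands behind \<open>i0\<close>.\<close>
    then obtain p where p: "p \<in> {r<..<i0}" "u p = Min (u ` {r<..<i0})" by force
    have pmin: "u p \<le> u x" if "x \<in> {r<..<i0}" for x
      using that p by simp
    have pl: "u p < u s" using low_before_i0[of p] p(1) by auto
    have "code u p < code u i0"
      unfolding code_def[of u p]
    proof (rule card_less_code)
      show "right_below u p \<subseteq> right_below u i0"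
      proof
        fix v assume v: "v \<in> right_below u p"
        have "\<not> inv u v < i0" using pmin[of "inv u v"] p(1) v inv_val(2)[of v] by auto
        moreover have "inv u v \<noteq> i0" using v inv_val(2)[of v] i0_facts(2) pl by auto
        ultimately show "v \<in> right_below u i0" using v i0_facts(2) pl by auto
      qed
      show "u j \<in> right_below u i0" using lt ij jr u_s_pos inv_val(1)[of j] by auto
      show "u j \<notin> right_below u p" using jr pl by simp
    qed
    then show False using key[of p] p(1) by simp
  qed
qed

text \<open>\<open>i0\<close> is the first candidate in position and the least in value, hence
  intermediate for every other one.\<close>

lemma cov_right: "{i. cov u1 r i} = {i0}"
proof -
  have vi0: "u1 i0 = u i0" using u1_vals(5)[of i0] i0_facts s r by auto
  have vr: "u1 r = u s" by (rule u1_vals)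
  have "u1 e < u s" if "r < e" "e < i0" "0 < u1 e" for e
    using u1_right[OF that(1,3)] low_before_i0[OF that(1,2)] by simp
  then have "cov u1 r i0"
    using i0_facts vi0 r u_s_pos by (force simp: cov_def vr)
  moreover have "i = i0" if c: "cov u1 r i" for i
  proof (rule ccontr)
    assume ne: "i \<noteq> i0"
    have "r < i" "u s < u1 i" using c by (auto simp: cov_def vr)
    then have "u1 i = u i" using u1_right u_s_pos by simp
    then have il: "i \<in> later" using \<open>r < i\<close> \<open>u s < u1 i\<close> by (simp add: later_def)
    have "i0 < i" "u1 i0 < u1 i" using i0(2)[OF il] i0_least_value[OF il ne] ne vi0 \<open>u1 i = u i\<close> by auto
    then show False using c i0_facts vi0 vr unfolding cov_def by (auto dest!: spec[of _ i0])
  qed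
  ultimately show ?thesis by blast
qed

definition "u' = u1 \<circ> srefl r i0"

lemma sp_u': "sperm u'"
  unfolding u'_def by (rule sperm_comp_refl[OF sp_u1]) (use r i0_facts(3) in linarith)+

text \<open>At \<open>u1\<close> and \<open>r\<close> one side of the transition equation is the
  single term for \<open>u\<close>, the other the single term for \<open>u'\<close>.\<close>

lemma num_words_u': "num_words n u' = num_words n u"
proof -
  have "u1 \<circ> srefl r s = u"
    using srefl_commute[of r s] s r by (auto simp: u1_def fun_eq_iff)
  then show ?thesis
    using transition[OF sp_u1, of r n] r by (simp add: cov_left cov_right u'_def)
qed

lemma u'_vals: "u' s = u r" "u' r = u i0" "u' i0 = u s"
  "x \<noteq> s \<Longrightarrow> x \<noteq> r \<Longrightarrow> x \<noteq> i0 \<Longrightarrow> x \<noteq> - s \<Longrightarrow> x \<noteq> - r \<Longrightarrow> x \<noteq> - i0 \<Longrightarrow> u' x = u x"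
proof -
  have ne: "i0 \<noteq> s" "i0 \<noteq> r" "s \<noteq> r" "s \<noteq> - r" "s \<noteq> - i0" using i0_facts s r by auto
  have "srefl r i0 s = s" "srefl r i0 r = i0" "srefl r i0 i0 = r" using ne by (simp_all add: srefl_def)
  moreover have "u1 i0 = u i0" using u1_vals(5)[OF ne(1,2) i0_facts(5,4)] .
  ultimately show "u' s = u r" "u' r = u i0" "u' i0 = u s"
    using u1_vals(1,2) by (simp_all add: u'_def)
  show "u' x = u x" if "x \<noteq> s" "x \<noteq> r" "x \<noteq> i0" "x \<noteq> - s" "x \<noteq> - r" "x \<noteq> - i0"
    using u1_vals(5)[of x] that by (simp add: u'_def srefl_def)
qed

lemma inv_u':
  assumes "0 < w"
  shows "inv u' w = (if w = u r then s else if w = u s then i0 else if w = u i0 then r else inv u w)"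
proof -
  have "u' (inv u w) = w" if "w \<noteq> u r" "w \<noteq> u s" "w \<noteq> u i0"
  proof -
    have "u (inv u w) = w" by (rule inv_val)
    moreover have "0 < u r" "0 < u i0" using row_pos[of r] r s i0_facts(2) u_s_pos by auto
    ultimately have "inv u w \<noteq> s" "inv u w \<noteq> r" "inv u w \<noteq> i0" "inv u w \<noteq> - s" "inv u w \<noteq> - r" "inv u w \<noteq> - i0"
      using that assms u_s_pos neg by force+
    then show ?thesis using u'_vals(4) inv_val by simp
  qed
  then show ?thesis
    using u'_vals(1-3) by (simp add: inv_eq_iff_sperm[OF sp_u'])
qed

lemma rows_u': "rows d u'"
proof
  have di: "- d \<le> i0" using i0_facts(1) s by simp
  have other: "u' x = u x" if "- d \<le> x" "x < 0 \<or> d < x" "x \<noteq> s" "x \<noteq> r" "x \<noteq> i0" for x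
  proof -
    have "x \<noteq> - s" "x \<noteq> - r" "x \<noteq> - i0" using that(1,2) s r i0_facts(1,6) di by linarith+
    then show ?thesis using u'_vals(4)[of x] that by simp
  qed
  have ur: "0 < u r" using row_pos[of r] r s by simp
  have pos: "0 < u' x" if "- d \<le> x" "x < 0 \<or> d < x" for x
    using other[OF that] u'_vals(1-3) ur u_s_pos i0_facts(2) row_pos[of x] out_pos[of x] that
    by (cases "x = s \<or> x = r \<or> x = i0") auto
  show "0 < u' x" if "- d \<le> x" "x < 0" for x using pos that by simp
  show "0 < u' x" if "d < x" for x using pos that d_nonneg by simp
  show "u' x < u' y" if xy: "d < x" "x < y" for x y
  proof -
    have o: "u' z = u z" if "d < z" "z \<noteq> i0" for z
      using other[of z] that s r d_nonneg by auto
    show ?thesis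
    proof (cases "x = i0")
      case True
      then show ?thesis using o[of y] xy out_mono[of x y] i0_facts(2) u'_vals(3) by auto
    next
      case False
      then show ?thesis
        using o[of x] o[of y] xy out_mono[of x y] low_before_i0[of x] u'_vals(3) r d_nonneg
        by (cases "y = i0") auto
    qed
  qed
qed (use sp_u' d_nonneg in auto)

text \<open>Three values move cyclically: \<open>u r\<close> to \<open>s\<close>,
  \<open>u i0\<close> to \<open>r\<close>, and \<open>u s\<close> to \<open>i0\<close>. Row
  \<open>s\<close> takes over the set counted at \<open>r\<close>; a row between \<open>s\<close>
  and \<open>r\<close> trades \<open>u r\<close> for \<open>u s\<close>; the new set at
  \<open>r\<close> is the old set at \<open>s\<close> with \<open>u s\<close> in place of
  \<open>u r\<close>. The sets at the remaining rows do not change.\<close>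

lemma code_u':
  assumes x: "- d \<le> x" "x < 0"
  shows "code u' x = (if x = s then code u r else if x = r then code u s else code u x)"
proof -
  have ur: "0 < u r" using row_pos[of r] r s by simp
  have ui: "0 < u i0" using i0_facts(2) u_s_pos by simp
  have other: "u' x = u x" if "x \<noteq> s" "x \<noteq> r" "x \<noteq> i0"
  proof -
    have "x \<noteq> - s" "x \<noteq> - r" "x \<noteq> - i0" using s r i0_facts(1,6) x by linarith+
    then show ?thesis using u'_vals(4)[of x] that by simp
  qed
  note iv = inv_u'
  consider "x < s" | "x = s" | "s < x" "x < r" | "x = r" | "r < x" "x < i0" | "x = i0" | "i0 < x"
    using s(2) i0_facts(1) by linarith
  then show ?thesis
  proof cases
    case 1
    then have "u' x = u x" using other s i0_facts by auto
    then have "right_below u' x = right_below u x"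
      using 1 s i0_facts inv_val by (auto simp: iv split: if_splits)
    then show ?thesis using 1 s by (simp add: code_def)
  next
    case 2
    have "right_below u' x = right_below u r"
    proof (intro set_eqI)
      fix w
      have "r < inv u w" if "0 < w" "w < u r" "s < inv u w"
        using that between[of "inv u w"] u_sr inv_val[of w] inv_val[of r] by (cases "inv u w = r") force+
      then show "w \<in> right_below u' x \<longleftrightarrow> w \<in> right_below u r"
        using 2 u'_vals(1) u_sr i0_facts(2) s by (auto simp: iv split: if_splits)
    qed
    then show ?thesis using 2 by (simp add: code_def)
  next
    case 3
    let ?A = "{w. 0 < w \<and> w < u x \<and> x < inv u w \<and> w \<noteq> u r \<and> w \<noteq> u s}"
    have ux: "u' x = u x" "u s < u x" using 3 other between i0_facts by auto
    have 1: "right_below u' x = insert (u s) ?A"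
      using 3 ux u_sr u_s_pos i0_facts inv_val by (auto simp: iv split: if_splits)
    have 2: "right_below u x = insert (u r) ?A"
      using 3 ux u_sr ur inv_val by auto
    have "finite ?A" by (rule finite_vals)
    then show ?thesis using 3 unfolding code_def 1 2 by simp
  next
    case 4
    let ?A = "{w. 0 < w \<and> w < u s \<and> r < inv u w}"
    have fin: "finite ?A" by (rule finite_vals)
    have 1: "right_below u' x = insert (u s) ?A"
    proof (intro set_eqI)
      fix w
      have "w < u s" if "0 < w" "w < u i0" "r < inv u w" "w \<noteq> u s"
        using that i0_least_value[of "inv u w"] inv_val[of w] inv_val[of i0] by (force simp: later_def)
      then show "w \<in> right_below u' x \<longleftrightarrow> w \<in> insert (u s) ?A"
        using 4 u'_vals(2) u_sr u_s_pos i0_facts s inv_val by (auto simp: iv split: if_splits)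
    qed
    have 2: "right_below u s = insert (u r) ?A"
    proof (intro set_eqI)
      fix w
      have "r < inv u w" if "w < u s" "s < inv u w" "w \<noteq> u r"
        using that between[of "inv u w"] inv_val[of w] by (cases "inv u w = r") force+
      then show "w \<in> right_below u s \<longleftrightarrow> w \<in> insert (u r) ?A"
        using u_sr ur s inv_val by auto
    qed
    have "u s \<notin> ?A" "u r \<notin> ?A" using inv_val(1)[of r] by auto
    then have "code u' x = Suc (card ?A)" "code u s = Suc (card ?A)"
      unfolding code_def 1 2 using fin by simp_all
    then show ?thesis using 4 s by simp
  next
    case 5
    then have ux: "u' x = u x" "u x < u s" using other low_before_i0 s by auto
    then have "right_below u' x = right_below u x"
      using 5 s i0_facts inv_val by (auto simp: iv split: if_splits)
    then show ?thesis using 5 s by (simp add: code_def)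
  next
    case 6
    have "right_below u' x = right_below u x"
    proof (intro set_eqI)
      fix w
      have "w < u s" if "0 < w" "w < u i0" "i0 < inv u w"
      proof (rule ccontr)
        assume "\<not> w < u s"
        moreover have "w \<noteq> u s" using that(3) inv_val(1)[of s] i0_facts(1) s by auto
        ultimately have "inv u w \<in> later" using that(3) i0_facts(1) inv_val(2)[of w] by (simp add: later_def)
        from i0_least_value[OF this] that show False using inv_val(2)[of w] by auto
      qed
      then show "w \<in> right_below u' x \<longleftrightarrow> w \<in> right_below u x"
        using 6 u'_vals(3) u_sr i0_facts s inv_val by (auto simp: iv split: if_splits)
    qed
    then show ?thesis using 6 i0_facts s by (simp add: code_def)
  next
    case 7
    then have "u' x = u x" using other s i0_facts by auto
    then have "right_below u' x = right_below u x"
      using 7 s i0_facts inv_val by (auto simp: iv split: if_splits)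
    then show ?thesis using 7 s i0_facts by (simp add: code_def)
  qed
qed

end

section \<open>Iterating the exchange until the code is sorted\<close>

lemma mset_swap:
  assumes "finite P" "r \<in> P" "s \<in> P" "r \<noteq> s"
    and "\<And>x. x \<in> P \<Longrightarrow> g x = (if x = s then f r else if x = r then f s else f x)"
  shows "image_mset g (mset_set P) = image_mset f (mset_set P)"
proof -
  have P: "mset_set P = add_mset s (add_mset r (mset_set (P - {s, r})))"
  proof -
    have "P = insert s (insert r (P - {s, r}))" using assms(2,3) by auto
    then show ?thesis using assms(1,4)
      by (metis (no_types, lifting) DiffE finite_Diff finite_insert insertCI insertE mset_set.insert)
  qed
  have "image_mset g (mset_set (P - {s, r})) = image_mset f (mset_set (P - {s, r}))"
    using assms(1,5) by (intro image_mset_cong) auto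
  then show ?thesis unfolding P using assms by simp
qed

definition codes_sorted :: "int \<Rightarrow> (int \<Rightarrow> int) \<Rightarrow> bool" where
  "codes_sorted d u \<longleftrightarrow> (\<forall>x y. - d \<le> x \<and> x < y \<and> y < 0 \<longrightarrow> code u x \<le> code u y)"

text \<open>Nothing is required between the increasing part before \<open>r\<close> and the
  decreasing part from \<open>r\<close> on, so a decreasing code qualifies with
  \<open>r = - d\<close>.\<close>

definition codes_valley :: "int \<Rightarrow> (int \<Rightarrow> int) \<Rightarrow> bool" where
  "codes_valley d u \<longleftrightarrow> (\<exists>r. (\<forall>x y. - d \<le> x \<and> x < y \<and> y < r \<longrightarrow> code u x \<le> code u y) \<and>
     (\<forall>x y. - d \<le> x \<and> r \<le> x \<and> x < y \<and> y < 0 \<longrightarrow> code u y \<le> code u x))"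

lemma valley_step:
  assumes "rows d u" "codes_valley d u" "\<not> codes_sorted d u"
  obtains r s where "code_step d u r s"
proof -
  interpret rows d u by fact
  obtain r0 where r0: "\<And>x y. - d \<le> x \<Longrightarrow> x < y \<Longrightarrow> y < r0 \<Longrightarrow> code u x \<le> code u y"
      "\<And>x y. - d \<le> x \<Longrightarrow> r0 \<le> x \<Longrightarrow> x < y \<Longrightarrow> y < 0 \<Longrightarrow> code u y \<le> code u x"
    using assms(2) unfolding codes_valley_def by blast
  \<comment> \<open>The least such position ends the longest weakly increasing prefix of the
    code.\<close>
  define bad where "bad r \<longleftrightarrow> r < 0 \<and> (\<exists>s. - d \<le> s \<and> s < r \<and> code u r < code u s)" for r
  obtain b where "bad b" using assms(3) unfolding codes_sorted_def bad_def by (metis linorder_not_le)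
  then obtain r where r: "bad r" "\<And>i. bad i \<Longrightarrow> nat (r + d) \<le> nat (i + d)"
    using ex_has_least_nat[of bad b "\<lambda>i. nat (i + d)"] by blast
  have rmin: "r \<le> i" if "bad i" for i
    using r(2)[OF that] that r(1) by (auto simp: bad_def)
  obtain s0 where s0: "- d \<le> s0 \<and> s0 < r \<and> code u r < code u s0" using r(1) by (auto simp: bad_def)
  then obtain s where s: "- d \<le> s \<and> s < r \<and> code u r < code u s"
      "\<And>i. - d \<le> i \<and> i < r \<and> code u r < code u i \<Longrightarrow> nat (s + d) \<le> nat (i + d)"
    using ex_has_least_nat[of "\<lambda>i. - d \<le> i \<and> i < r \<and> code u r < code u i" s0 "\<lambda>i. nat (i + d)"] by blast
  have "r0 \<le> r" using r0(1)[of s r] s(1) by linarith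
  have "code_step d u r s"
  proof
    show "- d \<le> s" "s < r" "code u r < code u s" using s(1) by auto
    show "r < 0" using r(1) by (simp add: bad_def)
    show "code u x \<le> code u y" if "- d \<le> x" "x < y" "y < r" for x y
      using rmin[of y] that r(1) unfolding bad_def by (meson less_trans linorder_not_le)
    show "code u y \<le> code u x" if "r \<le> x" "x < y" "y < 0" for x y
      using r0(2)[of x y] that s(1) \<open>r0 \<le> r\<close> by auto
    show "code u x \<le> code u r" if "- d \<le> x" "x < s" for x
      using s(2)[of x] that s(1) by force
  qed
  then show thesis using that by blast
qed

text \<open>The same \<open>r\<close> works again: by the choice of \<open>s\<close> the smaller
  entry fits into the prefix there, and \<open>r\<close> receives an entry larger than all those
  behind it.\<close>

lemma (in code_step) step_valley: "codes_valley d u'"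
  unfolding codes_valley_def
proof (intro exI[of _ r] conjI allI impI)
  fix x y assume a: "- d \<le> x \<and> x < y \<and> y < r"
  have "code u r \<le> code u z" if "s \<le> z" "z < r" for z
    using up[of s z] sr that s by (cases "z = s") auto
  then show "code u' x \<le> code u' y"
    using a code_u'[of x] code_u'[of y] r up[of x y] s_min[of x] s by auto
next
  fix x y assume a: "- d \<le> x \<and> r \<le> x \<and> x < y \<and> y < 0"
  then show "code u' y \<le> code u' x"
    using code_u'[of x] code_u'[of y] down[of x y] down[of r y] sr s by auto
qed

lemma (in code_step) step_mset:
  "image_mset (code u') (mset_set {- d..<0}) = image_mset (code u) (mset_set {- d..<0})"
  using s r code_u' by (intro mset_swap[of _ r s]) auto

text \<open>The weight \<open>nat (- x)\<close> decreases to the right, and the larger entry moves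
  to the right.\<close>

lemma (in code_step) step_measure:
  "(\<Sum>x\<in>{- d..<0}. nat (- x) * code u' x) < (\<Sum>x\<in>{- d..<0}. nat (- x) * code u x)"
proof -
  let ?P = "{- d..<0}"
  have split: "sum f ?P = f s + f r + sum f (?P - {s, r})" for f :: "int \<Rightarrow> nat"
  proof -
    have "?P = insert s (insert r (?P - {s, r}))" using s r by auto
    then show ?thesis using s
      by (metis (no_types, lifting) DiffE add.assoc finite_Diff finite_atLeastLessThan_int finite_insert insertCI insertE
          less_irrefl sum.insert)
  qed
  obtain b where b: "code u s = code u r + Suc b" using sr less_iff_Suc_add by auto
  obtain c where c: "nat (- s) = nat (- r) + Suc c"
    using s r less_iff_Suc_add[of "nat (- r)" "nat (- s)"] by auto
  have "code u' s = code u r" "code u' r = code u s" using code_u'[of s] code_u'[of r] s r by auto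
  moreover have "(\<Sum>x\<in>?P - {s, r}. nat (- x) * code u' x) = (\<Sum>x\<in>?P - {s, r}. nat (- x) * code u x)"
    using code_u' by (intro sum.cong) auto
  ultimately show ?thesis unfolding split by (simp add: b c algebra_simps)
qed

lemma sort_codes:
  assumes "rows d u" "codes_valley d u"
  shows "\<exists>w. rows d w \<and> codes_sorted d w \<and> (\<forall>n. num_words n w = num_words n u) \<and>
    image_mset (code w) (mset_set {- d..<0}) = image_mset (code u) (mset_set {- d..<0})"
  using assms
proof (induction "\<Sum>x\<in>{- d..<0}. nat (- x) * code u x" arbitrary: u rule: less_induct)
  case less
  show ?case
  proof (cases "codes_sorted d u")
    case True
    then show ?thesis using less.prems by blast
  next
    case False
    then obtain r s where "code_step d u r s" using valley_step less.prems by blast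
    then interpret code_step d u r s .
    show ?thesis
      using less.hyps[OF step_measure rows_u' step_valley] step_mset num_words_u' by auto
  qed
qed

text \<open>Once the rows increase, the positive values below \<open>u x\<close> are those counted
  by the code together with the \<open>x + d\<close> values of the preceding rows.\<close>

lemma (in rows) sorted_value:
  assumes "codes_sorted d u" "- d \<le> x" "x < 0"
  shows "u x = int (code u x) + x + d + 1"
proof -
  have inc: "u y < u z" if "- d \<le> y" "y < z" "z < 0" for y z
    using increasing_of_code_le[OF that] assms(1) that by (auto simp: codes_sorted_def)
  have eq: "{1..u x - 1} = right_below u x \<union> u ` {- d..<x}"
  proof (intro set_eqI)
    fix v
    show "v \<in> {1..u x - 1} \<longleftrightarrow> v \<in> right_below u x \<union> u ` {- d..<x}"
    proof
      assume v: "v \<in> {1..u x - 1}"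
      then have "inv u v \<noteq> x" using inv_val(2)[of v] by auto
      moreover have "- d \<le> inv u v" using pos_cases[of "inv u v"] v inv_val(2)[of v] d_nonneg by auto
      ultimately have "x < inv u v \<or> inv u v \<in> {- d..<x}" by auto
      then show "v \<in> right_below u x \<union> u ` {- d..<x}"
        using v inv_val(2)[of v] by (metis (mono_tags, lifting) UnI1 UnI2 atLeastAtMost_iff image_eqI
            mem_Collect_eq zle_diff1_eq zless_iff_Suc_zadd int_one_le_iff_zero_less)
    next
      assume "v \<in> right_below u x \<union> u ` {- d..<x}"
      moreover have "0 < u y \<and> u y < u x" if "y \<in> {- d..<x}" for y
        using inc[of y x] row_pos[of y] that assms by auto
      ultimately show "v \<in> {1..u x - 1}" by force
    qed
  qed
  have disj: "right_below u x \<inter> u ` {- d..<x} = {}" using inv_val(1) by auto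
  have "inj_on u {- d..<x}" by (rule inj_onI) (simp add: val_eq)
  then have ci: "card (u ` {- d..<x}) = nat (x + d)" by (simp add: card_image)
  have "nat (u x - 1) = card {1..u x - 1}" by simp
  also have "\<dots> = code u x + card (u ` {- d..<x})"
    unfolding eq code_def by (rule card_Un_disjoint[OF finite_vals _ disj]) simp
  finally have "nat (u x - 1) = code u x + card (u ` {- d..<x})" .
  then have "u x - 1 = int (code u x) + int (nat (x + d))" unfolding ci using row_pos[of x] assms by linarith
  then show ?thesis using assms by simp
qed

text \<open>The multiset of code entries is preserved, so sorting a decreasing code reverses it;
  \<open>- d - 1 - x\<close> is the reversal of the rows.\<close>

lemma rows_reduction:
  assumes "rows d u" and "\<And>x y. - d \<le> x \<Longrightarrow> x < y \<Longrightarrow> y < 0 \<Longrightarrow> code u y \<le> code u x"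
  shows "\<exists>w. rows d w \<and> (\<forall>n. num_words n w = num_words n u) \<and>
    (\<forall>x y. - d \<le> x \<and> x < y \<and> y < 0 \<longrightarrow> w x < w y) \<and>
    (\<forall>x. - d \<le> x \<and> x < 0 \<longrightarrow> w x = int (code u (- d - 1 - x)) + x + d + 1)"
proof -
  have "codes_valley d u"
    unfolding codes_valley_def using assms(2) by (intro exI[of _ "- d"]) auto
  from sort_codes[OF assms(1) this] obtain w where w: "rows d w" "codes_sorted d w"
      "\<And>n. num_words n w = num_words n u"
      "image_mset (code w) (mset_set {- d..<0}) = image_mset (code u) (mset_set {- d..<0})" by blast
  interpret rows d w by fact
  let ?L = "[- d..- 1]" and ?f = "\<lambda>x. code u (- d - 1 - x)"
  have L: "mset ?L = mset_set {- d..<0}"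
  proof -
    have "{- d..<0} = set ?L" by auto
    then show ?thesis by (simp only: mset_set_set distinct_upto)
  qed
  have "image_mset ?f (mset_set {- d..<0}) = image_mset (code u) (image_mset (\<lambda>x. - d - 1 - x) (mset_set {- d..<0}))"
    by (simp add: image_mset.compositionality comp_def)
  also have "image_mset (\<lambda>x. - d - 1 - x) (mset_set {- d..<0}) = mset_set ((\<lambda>x. - d - 1 - x) ` {- d..<0})"
    by (rule image_mset_mset_set) (auto intro: inj_onI)
  also have "(\<lambda>x. - d - 1 - x) ` {- d..<0} = {- d..<0}"
    by (auto intro!: image_eqI[of _ _ "- d - 1 - _"])
  finally have "mset (map (code w) ?L) = mset (map ?f ?L)" using w(4) L by simp
  moreover have "sorted (map (code w) ?L)"
    using w(2) by (auto simp: codes_sorted_def sorted_iff_nth_mono_less nth_upto)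
  moreover have "sorted (map ?f ?L)"
    using assms(2) by (auto simp: sorted_iff_nth_mono_less nth_upto)
  ultimately have "map (code w) ?L = map ?f ?L"
    by (metis properties_for_sort)
  then have c: "code w x = ?f x" if "- d \<le> x" "x < 0" for x using that by auto
  have "w x = int (code u (- d - 1 - x)) + x + d + 1" if "- d \<le> x" "x < 0" for x
    using sorted_value[OF w(2) that] c[OF that] by simp
  moreover have "w x < w y" if "- d \<le> x" "x < y" "y < 0" for x y
    using increasing_of_code_le[OF that] w(2) that by (auto simp: codes_sorted_def)
  ultimately show ?thesis using w(1,3) by blast
qed

section \<open>Balanced labellings of inversion sets\<close>

text \<open>
  A pair of positions \<open>x < y\<close> encodes a positive root; \<open>(x, y)\<close> and \<open>(- y, - x)\<close> encode the same root,
  and so do \<open>(x, 0)\<close>, \<open>(0, - x)\<close> and \<open>(x, - x)\<close>. The function \<open>rt\<close> chooses a representative.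
\<close>
definition rt :: "int \<times> int \<Rightarrow> int \<times> int" where
  "rt = (\<lambda>(x, y). if y = 0 then (x, - x) else if x = 0 then (- y, y)
          else if x + y \<le> 0 then (x, y) else (- y, - x))"

definition cinv :: "(int \<Rightarrow> int) \<Rightarrow> (int \<times> int) set" where
  "cinv w = {(x, y). x \<noteq> 0 \<and> y \<noteq> 0 \<and> x + y \<le> 0 \<and> x < y \<and> w y < w x}"

text \<open>
  Contribution of the position \<open>y\<close> to the number of labels larger than that of the root \<open>(x, z)\<close>, minus
  its expected value. If exactly two of the three roots given by positions \<open>a < b < c\<close> are inversions,
  then their order is forced. The relation \<open>R\<close> decides which of the two roots records this constraint:
  the outer root \<open>(a, c)\<close>, where it is a smaller label that is expected, or the inner one.
\<close>
definition gterm :: "(int \<Rightarrow> int \<Rightarrow> bool) \<Rightarrow> (int \<times> int \<Rightarrow> nat) \<Rightarrow> int \<Rightarrow> int \<Rightarrow> int \<Rightarrow> int" where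
  "gterm R f x y z =
     (if x < y \<and> y < z then
        of_bool (f (rt (x, y)) > f (rt (x, z)) \<and> \<not> R y z) +
        of_bool (f (rt (y, z)) > f (rt (x, z)) \<and> \<not> R (- y) (- x)) -
        of_bool (f (rt (x, y)) \<noteq> 0 \<and> f (rt (y, z)) \<noteq> 0)
      else if z < y \<and> R z y then
        of_bool (f (rt (x, y)) > f (rt (x, z))) - of_bool (f (rt (x, y)) \<noteq> 0)
      else if y < x \<and> R (- x) (- y) then
        of_bool (f (rt (y, z)) > f (rt (x, z))) - of_bool (f (rt (y, z)) \<noteq> 0)
      else 0)"

abbreviation balanced_at ::
    "(int \<Rightarrow> int \<Rightarrow> bool) \<Rightarrow> int \<Rightarrow> (int \<times> int \<Rightarrow> nat) \<Rightarrow> int \<Rightarrow> int \<Rightarrow> bool" where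
  "balanced_at R M f x z \<equiv> (\<Sum>y = - M..M. gterm R f x y z) = 0"

text \<open>Non-inversions get the label 0, which exceeds no label and lets
  \<open>f c \<noteq> 0\<close> test for an inversion. The root of a pair \<open>(x, - x)\<close> is
  tested at \<open>(x, 0)\<close>.\<close>

definition balanced_labels ::
    "(int \<Rightarrow> int \<Rightarrow> bool) \<Rightarrow> int \<Rightarrow> nat \<Rightarrow> (int \<Rightarrow> int) \<Rightarrow> (int \<times> int \<Rightarrow> nat) set" where
  "balanced_labels R M n w =
     {f. (\<forall>c. f c \<noteq> 0 \<longrightarrow> c \<in> cinv w) \<and> bij_betw f (cinv w) {1..n} \<and>
         (\<forall>x z. x < z \<and> w z < w x \<and> x \<noteq> - z \<longrightarrow> balanced_at R M f x z)}"

lemma rt_minus: "x < y \<Longrightarrow> rt (- y, - x) = rt (x, y)"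
  by (auto simp: rt_def)

lemma rt_eq_iff:
  "x < y \<Longrightarrow> p < q \<Longrightarrow> p \<noteq> 0 \<Longrightarrow> q \<noteq> 0 \<Longrightarrow> p \<noteq> - q \<Longrightarrow>
    rt (x, y) = rt (p, q) \<longleftrightarrow> (x = p \<and> y = q) \<or> (x = - q \<and> y = - p)"
  by (auto simp: rt_def split: if_splits)

lemma rt_eq_short_iff:
  "x < y \<Longrightarrow> p < 0 \<Longrightarrow>
    rt (x, y) = rt (p, 0) \<longleftrightarrow> (x = p \<and> y = 0) \<or> (x = 0 \<and> y = - p) \<or> (x = p \<and> y = - p)"
  by (auto simp: rt_def split: if_splits)

lemma rt_mem_cinv_iff:
  assumes "sperm w" "x < y"
  shows "rt (x, y) \<in> cinv w \<longleftrightarrow> w y < w x"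
  using assms(2) sperm_zero[OF assms(1)] sperm_minus[OF assms(1), of x] sperm_minus[OF assms(1), of y]
  by (auto simp: rt_def cinv_def)

text \<open>The pairs of values, larger one first, whose order \<open>sgen k\<close> reverses. For
  \<open>k = 0\<close> there are three, matching the three pairs of positions that encode a short
  root.\<close>

definition rem_vals :: "int \<Rightarrow> int \<Rightarrow> int \<Rightarrow> bool" where
  "rem_vals k a b \<longleftrightarrow> a = k + 1 \<and> b = k \<or> a = - k \<and> b = - k - 1 \<or> k = 0 \<and> a = 1 \<and> b = - 1"

lemma sgen_eq:
  "0 < k \<Longrightarrow> sgen k v = (if v = k then k + 1 else if v = k + 1 then k
    else if v = - k then - k - 1 else if v = - k - 1 then - k else v)"
  "sgen 0 v = (if v = 1 then - 1 else if v = - 1 then 1 else v)"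
  by (auto simp: sgen_def srefl_def)

lemma sgen_less_iff:
  assumes "0 \<le> k" "a \<noteq> b" "\<not> rem_vals k b a"
  shows "sgen k b < sgen k a \<longleftrightarrow> b < a \<and> \<not> rem_vals k a b"
proof (cases "k = 0")
  case True
  then show ?thesis using assms unfolding rem_vals_def True sgen_eq(2) by (smt (verit))
next
  case False
  then have "0 < k" using assms by simp
  then show ?thesis using assms unfolding rem_vals_def sgen_eq(1)[OF \<open>0 < k\<close>] by (smt (verit))
qed

text \<open>\<open>R\<close> may be any set of non-inversions. The window \<open>-M..M\<close>
  contains every position that occurs in an inversion, hence all that can contribute to a balance
  sum.\<close>

locale balance =
  fixes w :: "int \<Rightarrow> int" and M :: int and R :: "int \<Rightarrow> int \<Rightarrow> bool"
  assumes sp: "sperm w" and supp: "\<bar>x\<bar> > M \<Longrightarrow> w x = x"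
    and R: "R y z \<Longrightarrow> y < z \<and> w y < w z"
begin

lemma neg: "w (- x) = - w x"
  using sperm_minus[OF sp] .

lemma zero: "w 0 = 0"
  using sperm_zero[OF sp] .

lemma val_eq: "w x = w y \<longleftrightarrow> x = y"
  using sperm_inj[OF sp] .

lemma range_bound: "\<bar>x\<bar> \<le> M \<Longrightarrow> \<bar>w x\<bar> \<le> M"
  by (metis val_eq linorder_not_less supp)

lemma inversion_bound:
  assumes "x < y" "w y < w x"
  shows "x \<in> {- M..M}" "y \<in> {- M..M}"
proof -
  have "- M \<le> x \<and> x \<le> M \<and> - M \<le> y \<and> y \<le> M"
    using assms supp[of x] supp[of y] range_bound[of x] range_bound[of y] by linarith
  then show "x \<in> {- M..M}" "y \<in> {- M..M}" by auto
qed

lemma label_facts: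
  assumes f: "f \<in> balanced_labels R M n w"
  shows "x < y \<Longrightarrow> f (rt (x, y)) \<noteq> 0 \<longleftrightarrow> w y < w x"
    and "f c \<le> n"
    and "x < y \<Longrightarrow> x' < y' \<Longrightarrow> w y < w x \<Longrightarrow> w y' < w x' \<Longrightarrow>
          f (rt (x, y)) = f (rt (x', y')) \<longleftrightarrow> rt (x, y) = rt (x', y')"
proof -
  have nz: "f c \<noteq> 0 \<Longrightarrow> c \<in> cinv w" and bij: "bij_betw f (cinv w) {1..n}" for c
    using f unfolding balanced_labels_def by blast+
  have mem: "f c \<in> {1..n}" if "c \<in> cinv w" for c using bij that by (auto dest: bij_betwE)
  show "f c \<le> n" using mem[of c] nz[of c] by (cases "f c = 0") auto
  show "f (rt (x, y)) \<noteq> 0 \<longleftrightarrow> w y < w x" if "x < y"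
  proof -
    have "f (rt (x, y)) \<noteq> 0 \<longleftrightarrow> rt (x, y) \<in> cinv w"
      using nz mem[of "rt (x, y)"] by (metis atLeastAtMost_iff not_one_le_zero)
    then show ?thesis using rt_mem_cinv_iff[OF sp that] by simp
  qed
  show "f (rt (x, y)) = f (rt (x', y')) \<longleftrightarrow> rt (x, y) = rt (x', y')"
    if "x < y" "x' < y'" "w y < w x" "w y' < w x'"
    using that rt_mem_cinv_iff[OF sp] bij by (metis bij_betw_inv_into_left)
qed

section \<open>The root with the largest label\<close>

lemma gterm_nonpos_at_max:
  assumes "f \<in> balanced_labels R M n w" "f (rt (a, b)) = n"
  shows "gterm R f a y b \<le> 0"
  using label_facts(2)[OF assms(1), of "rt (a, y)"] label_facts(2)[OF assms(1), of "rt (y, b)"] assms(2)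
  by (auto simp: gterm_def)

text \<open>Nothing exceeds the largest label, so all contributions are nonpositive; their sum is
  0.\<close>

lemma gterm_zero_at_max:
  assumes "f \<in> balanced_labels R M n w" "f (rt (a, b)) = n"
    and "a < b" "w b < w a" "a \<noteq> - b" "y \<in> {- M..M}"
  shows "gterm R f a y b = 0"
proof -
  have "(\<Sum>y = - M..M. - gterm R f a y b) = 0"
    using assms by (auto simp: balanced_labels_def sum_negf)
  moreover have "0 \<le> - gterm R f a y b" for y
    using gterm_nonpos_at_max[OF assms(1,2)] by simp
  ultimately show ?thesis
    using sum_nonneg_eq_0_iff[of "{- M..M}" "\<lambda>y. - gterm R f a y b"] assms(6) by simp
qed

lemma max_label_no_between:
  assumes f: "f \<in> balanced_labels R M n w" and ab: "a < b" "w b < w a" "a \<noteq> - b"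
    and max: "f (rt (a, b)) = n" and y: "a < y" "y < b" "w b < w y" "w y < w a"
  shows False
proof -
  have "y \<in> {- M..M}" using inversion_bound[of a y] y by auto
  from gterm_zero_at_max[OF f max ab this] show False
    using y label_facts(1)[OF f, of a y] label_facts(1)[OF f, of y b]
      label_facts(2)[OF f, of "rt (a, y)"] label_facts(2)[OF f, of "rt (y, b)"]
    by (simp add: gterm_def max split: if_splits)
qed

text \<open>
  Otherwise choose such a position \<open>e\<close> with \<open>w e\<close> maximal: then all contributions at the root \<open>(a, e)\<close>
  are nonnegative, and that of \<open>b\<close> is positive.
\<close>
lemma max_label_no_right:
  assumes f: "f \<in> balanced_labels R M n w" and ab: "a < b" "w b < w a" "a \<noteq> - b"
    and max: "f (rt (a, b)) = n" and e: "b < e" "w b < w e" "w e < w a"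
  shows False
proof -
  note L = label_facts(1)[OF f]
  have dev: "balanced_at R M f x z" if "x < z" "w z < w x" "x \<noteq> - z" for x z
    using f that by (auto simp: balanced_labels_def)
  have z: "gterm R f a y b = 0" if "y \<in> {- M..M}" for y
    using gterm_zero_at_max[OF f max ab that] .
  have le: "f c \<le> n" for c using label_facts(2)[OF f] .
  have not_gt: "\<not> n < f c" for c using le[of c] by simp
  note c1 = max_label_no_between[OF f ab max]
  \<comment> \<open>An inversion whose constraint is recorded at \<open>(a, b)\<close> through
    \<open>R\<close>, on the right in \<open>c2\<close> and on the left in \<open>c3\<close>, would
    contribute -1.\<close>
  have c2: False if "R b y" "w y < w a" for y
  proof -
    have "b < y" "w b < w y" using R[OF that(1)] by auto
    moreover have "y \<in> {- M..M}" using inversion_bound[of a y] that ab calculation by auto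
    ultimately show False
      using that L[of a y] not_gt z[of y] ab by (simp add: gterm_def max)
  qed
  have c3: False if "R (- a) (- y)" "w b < w y" for y
  proof -
    have "y < a" "w y < w a" using R[OF that(1)] by (auto simp: neg)
    moreover have "y \<in> {- M..M}" using inversion_bound[of y b] that ab calculation by auto
    ultimately show False
      using that L[of y b] not_gt z[of y] ab by (simp add: gterm_def max)
  qed
  define E where "E = {e. b < e \<and> w b < w e \<and> w e < w a}"
  have "E \<subseteq> {- M..M}"
    using inversion_bound(2)[of a] ab unfolding E_def by fastforce
  then have finE: "finite E" by (rule finite_subset) simp
  have "E \<noteq> {}" using e by (auto simp: E_def)
  then have "Max (w ` E) \<in> w ` E" using finE by simp
  then obtain c where c: "c \<in> E" "w c = Max (w ` E)" by force
  have cmax: "w y \<le> w c" if "y \<in> E" for y using that finE c by simp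
  have cE: "b < c" "w b < w c" "w c < w a" using c(1) by (auto simp: E_def)
  \<comment> \<open>No balance condition is available at \<open>(a, - a)\<close>. In that case
    position 0 would have a larger value within \<open>E\<close> if \<open>b < 0\<close>, and would
    be a forbidden position between \<open>a\<close> and \<open>b\<close> if
    \<open>0 < b\<close>.\<close>
  have "c \<noteq> - a"
  proof
    assume ca: "c = - a"
    then have "w c = - w a" by (simp add: neg)
    then have pos: "0 < w a" "w c < 0" using cE by auto
    have "b \<noteq> 0" using pos cE zero by auto
    then consider "b < 0" | "0 < b" by linarith
    then show False
    proof cases
      case 1
      then have "0 \<in> E" using pos cE zero by (simp add: E_def)
      from cmax[OF this] show False using pos zero by simp
    next
      case 2
      then show False using c1[of 0] pos cE zero ca by auto
    qed
  qed
  have acn: "f (rt (a, c)) < n"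
  proof -
    have "rt (a, b) \<noteq> rt (a, c)" using ab cE \<open>c \<noteq> - a\<close> by (auto simp: rt_def split: if_splits)
    then have "f (rt (a, c)) \<noteq> n"
      using label_facts(3)[OF f, of a b a c] ab cE max by auto
    then show ?thesis using le[of "rt (a, c)"] by simp
  qed
  have nonneg: "0 \<le> gterm R f a y c" for y
  proof (cases "a < y \<and> y < c")
    case True
    have "\<not> (w c < w y \<and> w y < w a)"
    proof
      assume y: "w c < w y \<and> w y < w a"
      then have "y \<noteq> b" using cE by auto
      then consider "y < b" | "b < y" by linarith
      then show False
      proof cases
        case 1
        then show False using c1[of y] True y cE by auto
      next
        case 2
        then have "y \<in> E" using y cE by (auto simp: E_def)
        from cmax[OF this] show False using y by simp
      qed
    qed
    then show ?thesis using True L[of a y] L[of y c] by (auto simp: gterm_def)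
  next
    case False
    have r: False if "c < y" "R c y" "w y < w a"
    proof -
      have "w c < w y" using R[OF that(2)] by simp
      then have "y \<in> E" using that cE by (auto simp: E_def)
      from cmax[OF this] show False using \<open>w c < w y\<close> by simp
    qed
    have l: False if "y < a" "R (- a) (- y)" "w c < w y"
      using c3[OF that(2)] that(3) cE by simp
    show ?thesis using False L[of a y] L[of y c] r l ab cE by (auto simp: gterm_def)
  qed
  \<comment> \<open>\<open>(b, c)\<close> is no inversion, so nothing is expected at
    \<open>b\<close>, whereas \<open>(a, b)\<close> carries the largest label and
    \<open>R b c\<close> is excluded by \<open>c2\<close>.\<close>
  have "gterm R f a b c = 1"
    using ab cE L[of b c] c2[of c] acn by (auto simp: gterm_def max)
  moreover have "b \<in> {- M..M}" using inversion_bound[of a b] ab by simp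
  ultimately have "0 < (\<Sum>y = - M..M. gterm R f a y c)"
    using nonneg by (intro sum_pos2[of _ b]) auto
  then show False using dev[of a c] ab cE \<open>c \<noteq> - a\<close> by auto
qed

text \<open>Otherwise the position of the value \<open>w b + 1\<close> is one of the forbidden ones;
  if it lies left of \<open>a\<close>, negating all positions moves it to the right.\<close>

lemma max_label_adjacent:
  assumes f: "f \<in> balanced_labels R M n w" and ab: "a < b" "w b < w a" "a \<noteq> - b"
    and max: "f (rt (a, b)) = n"
  shows "w a = w b + 1"
proof (rule ccontr)
  assume "w a \<noteq> w b + 1"
  define e where "e = inv w (w b + 1)"
  have we: "w e = w b + 1" using sp by (simp add: e_def sperm_inv)
  with \<open>w a \<noteq> w b + 1\<close> ab have e: "w b < w e" "w e < w a" by auto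
  then have "e \<noteq> a" "e \<noteq> b" by auto
  then consider "b < e" | "e < a" | "a < e" "e < b" by linarith
  then show False
  proof cases
    case 1
    then show False using max_label_no_right[OF f ab max _ e] by blast
  next
    case 2
    have "rt (- b, - a) = rt (a, b)" using ab by (simp add: rt_minus)
    then show False
      using max_label_no_right[OF f, of "- b" "- a" "- e"] 2 ab e max by (auto simp: neg)
  next
    case 3
    then show False using max_label_no_between[OF f ab max _ _ e] by blast
  qed
qed


section \<open>Deleting the root of a descent\<close>

definition removed :: "int \<Rightarrow> int \<times> int" where
  "removed k = rt (inv w (k + 1), inv w k)"

lemma val_iff: "w x = v \<longleftrightarrow> x = inv w v"
  using sperm_inv[OF sp] by metis

lemma inv_neg: "inv w (- v) = - inv w v"
  using sperm_minus[OF sperm_inv_sperm[OF sp]] .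

lemma inv_neg_Suc: "inv w (- k - 1) = - inv w (k + 1)" "inv w (- 1 - k) = - inv w (k + 1)"
proof -
  have "- k - 1 = - (k + 1)" "- 1 - k = - (k + 1)" by simp_all
  then show "inv w (- k - 1) = - inv w (k + 1)" "inv w (- 1 - k) = - inv w (k + 1)"
    by (simp_all only: inv_neg)
qed

lemma rt_removed_iff:
  assumes d: "desc w k" and xy: "x < y"
  shows "rt (x, y) = removed k \<longleftrightarrow> rem_vals k (w x) (w y)"
proof -
  define p q where "p = inv w (k + 1)" and "q = inv w k"
  have k: "0 \<le> k" and pq: "p < q" using d by (auto simp: desc_def p_def q_def)
  have m: "inv w (- k - 1) = - p" "inv w (- k) = - q" "inv w (- 1 - k) = - p"
    by (simp_all add: p_def q_def inv_neg inv_neg_Suc)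
  have wp: "w p = k + 1" "w q = k" using sperm_inv[OF sp] by (simp_all add: p_def q_def)
  show ?thesis
  proof (cases "k = 0")
    case True
    then have "q = 0" using wp zero val_eq by metis
    then have "p < 0" using pq by simp
    have i1: "inv w 1 = p" "inv w (- 1) = - p" "inv w 0 = 0"
      using True m \<open>q = 0\<close> by (simp_all add: p_def q_def)
    show ?thesis
      using rt_eq_short_iff[OF xy \<open>p < 0\<close>] i1
      by (simp add: removed_def rem_vals_def val_iff True)
  next
    case False
    have nz: "p \<noteq> 0" "q \<noteq> 0" using wp zero k False by auto
    have "p \<noteq> - q" using wp neg[of q] k by auto
    then show ?thesis
      using rt_eq_iff[OF xy pq nz] False
      by (simp add: removed_def rem_vals_def val_iff m flip: p_def q_def) 
  qed
qed

lemma inversion_sgen_iff: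
  assumes d: "desc w k" and xy: "x < y"
  shows "(sgen k \<circ> w) y < (sgen k \<circ> w) x \<longleftrightarrow> w y < w x \<and> rt (x, y) \<noteq> removed k"
proof -
  have k: "0 \<le> k" using d by (simp add: desc_def)
  have n: "\<not> rem_vals k (w y) (w x)"
  proof
    assume "rem_vals k (w y) (w x)"
    have m: "inv w (- k - 1) = - inv w (k + 1)" "inv w (- k) = - inv w k"
      by (simp_all add: inv_neg inv_neg_Suc)
    have "inv w 0 = 0" "inv w (- 1) = - inv w 1" using val_iff[of 0 0] zero inv_neg[of 1] by auto
    then show False
      using \<open>rem_vals k (w y) (w x)\<close> d xy m unfolding rem_vals_def desc_def val_iff
      by auto
  qed
  have "w x \<noteq> w y" using xy val_eq by auto
  then show ?thesis
    unfolding rt_removed_iff[OF d xy] using sgen_less_iff[OF k _ n] by simp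
qed

lemma cinv_sgen:
  assumes "desc w k"
  shows "cinv w = insert (removed k) (cinv (sgen k \<circ> w))" "removed k \<notin> cinv (sgen k \<circ> w)"
proof -
  define p q where "p = inv w (k + 1)" and "q = inv w k"
  have pq: "p < q" using assms by (auto simp: desc_def p_def q_def)
  have wp: "w p = k + 1" "w q = k" using sperm_inv[OF sp] by (simp_all add: p_def q_def)
  have r: "removed k = rt (p, q)" by (simp add: removed_def p_def q_def)
  have "removed k \<in> cinv w" unfolding r using rt_mem_cinv_iff[OF sp pq] wp by simp
  moreover have "(x, y) \<in> cinv (sgen k \<circ> w) \<longleftrightarrow> (x, y) \<in> cinv w \<and> (x, y) \<noteq> removed k" for x y
  proof (cases "x \<noteq> 0 \<and> y \<noteq> 0 \<and> x + y \<le> 0 \<and> x < y")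
    case True
    then have "rt (x, y) = (x, y)" by (auto simp: rt_def)
    then show ?thesis using inversion_sgen_iff[OF assms, of x y] True by (simp add: cinv_def)
  next
    case False
    then show ?thesis by (auto simp: cinv_def)
  qed
  then have "c \<in> cinv (sgen k \<circ> w) \<longleftrightarrow> c \<in> cinv w \<and> c \<noteq> removed k" for c
    by (cases c) simp
  ultimately show "cinv w = insert (removed k) (cinv (sgen k \<circ> w))"
    "removed k \<notin> cinv (sgen k \<circ> w)" by auto
qed

text \<open>At another root the largest label enters once as an actually larger label and once as an
  expected one, so deleting it leaves the difference unchanged.\<close>

lemma gterm_remove:
  assumes d: "desc w k"
    and L: "\<And>x y. x < y \<Longrightarrow> f (rt (x, y)) \<noteq> 0 \<longleftrightarrow> w y < w x"
    and n: "f (removed k) = Suc n" and le: "\<And>c. c \<noteq> removed k \<Longrightarrow> f c \<le> n"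
    and xz: "x < z" "w z < w x" "rt (x, z) \<noteq> removed k"
  shows "gterm R f x y z = gterm R (f(removed k := 0)) x y z"
proof -
  note rr = rt_removed_iff[OF d]
  have nx: "\<not> rem_vals k (w x) (w z)" using rr[OF xz(1)] xz(3) by simp
  have l: "f (rt (x, z)) < Suc n" using le[OF xz(3)] by simp
  have nR: "\<not> R a b" if "w b < w a" for a b using R[of a b] that by auto
  show ?thesis
  proof (cases "x < y \<and> y < z")
    case True
    then have xy: "x < y" and yz: "y < z" by auto
    consider (none) "rt (x, y) \<noteq> removed k" "rt (y, z) \<noteq> removed k"
      | (both) "rt (x, y) = removed k" "rt (y, z) = removed k"
      | (left) "rt (x, y) = removed k" "rt (y, z) \<noteq> removed k"
      | (right) "rt (x, y) \<noteq> removed k" "rt (y, z) = removed k" by blast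
    then show ?thesis
    proof cases
      case none
      then show ?thesis using xz True by (simp add: gterm_def)
    next
      case both
      then have "rem_vals k (w x) (w y)" "rem_vals k (w y) (w z)" using rr xy yz by auto
      then have False using nx d by (auto simp: rem_vals_def desc_def)
      then show ?thesis ..
    next
      case left
      then have rv: "rem_vals k (w x) (w y)" using rr xy by simp
      have "R y z \<longleftrightarrow> f (rt (y, z)) = 0 \<and> R y z" using nR[of z y] L[OF yz] by auto
      \<comment> \<open>\<open>sgen k\<close> reverses the order of \<open>w x\<close> and
        \<open>w y\<close>, so a value below \<open>w x\<close> other than \<open>w y\<close> is
        below \<open>w y\<close> as well. The exception is 0 between 1 and -1, which would force
        \<open>z = 0\<close> and \<open>y = - x\<close>, against \<open>x < y < z\<close>.\<close>
      moreover have "w z < w y"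
      proof (rule ccontr)
        assume "\<not> w z < w y"
        then have "w y < w z" using yz val_eq[of y z] by linarith
        then have "w x = 1" "w y = - 1" "w z = 0" using rv xz(2) by (auto simp: rem_vals_def)
        then have "z = 0" "y = - x" using zero val_eq[of z 0] val_eq[of y "- x"] neg[of x] by auto
        then show False using xy yz by simp
      qed
      ultimately show ?thesis
        using left True xz l n L[OF yz] nR[of z y] by (simp add: gterm_def)
    next
      case right
      then have rv: "rem_vals k (w y) (w z)" using rr yz by simp
      have "w y < w x"
      proof (rule ccontr)
        assume "\<not> w y < w x"
        then have "w x < w y" using xy val_eq[of y x] by linarith
        then have "w y = 1" "w z = - 1" "w x = 0" using rv xz(2) by (auto simp: rem_vals_def)
        then have "x = 0" "z = - y" using zero val_eq[of x 0] val_eq[of z "- y"] neg[of y] by auto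
        then show False using xy yz by simp
      qed
      then show ?thesis
        using right True xz l n L[OF xy] nR[of "- x" "- y"] by (simp add: gterm_def neg)
    qed
  next
    case False
    then show ?thesis using xz(3) l n by (auto simp: gterm_def)
  qed
qed

text \<open>Nothing exceeds the largest label, and every expected inversion would need a value
  strictly between \<open>w z\<close> and \<open>w x = w z + 1\<close>.\<close>

lemma gterm_removed:
  assumes d: "desc w k"
    and L: "\<And>x y. x < y \<Longrightarrow> f (rt (x, y)) \<noteq> 0 \<longleftrightarrow> w y < w x"
    and n: "f (removed k) = n" and le: "\<And>c. f c \<le> n"
    and xz: "x < z" "w z < w x" "x \<noteq> - z" "rt (x, z) = removed k"
  shows "gterm R f x y z = 0"
proof -
  have "rem_vals k (w x) (w z)" using rt_removed_iff[OF d xz(1)] xz(4) by simp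
  moreover have "\<not> (w x = 1 \<and> w z = - 1)" using xz(3) val_eq[of x "- z"] neg[of z] by auto
  ultimately have adj: "w x = w z + 1" by (auto simp: rem_vals_def)
  have le': "\<not> n < f c" for c using le[of c] by simp
  show ?thesis using adj le' n xz L[of x y] L[of y z] R[of z y] R[of "- x" "- y"]
    by (auto simp: gterm_def neg)
qed

text \<open>A descent only destroys an inversion, so \<open>R\<close> remains a set of
  non-inversions; this keeps \<open>R\<close> fixed along the recursion.\<close>

lemma balance_sgen: "desc w k \<Longrightarrow> balance (sgen k \<circ> w) M R"
proof
  assume d: "desc w k"
  then have k: "0 \<le> k" by (simp add: desc_def)
  show "sperm (sgen k \<circ> w)" using sp k by (rule sperm_sgen_comp)
  have iv: "inv w v = v" if "\<bar>v\<bar> > M" for v using val_iff[of v v] supp[OF that] by simp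
  have "k < M"
  proof (rule ccontr)
    assume "\<not> k < M"
    then have "inv w (k + 1) = k + 1" using iv[of "k + 1"] k by simp
    moreover have "w (inv w k) = k" using sp by (simp add: sperm_inv)
    ultimately show False
      using d supp[of "inv w k"] range_bound[of "inv w k"] \<open>\<not> k < M\<close> k by (auto simp: desc_def)
  qed
  then show "(sgen k \<circ> w) x = x" if "\<bar>x\<bar> > M" for x
    using that supp[OF that] k by (auto simp: sgen_def srefl_def)
  show "y < z \<and> (sgen k \<circ> w) y < (sgen k \<circ> w) z" if "R y z" for y z
  proof -
    have yz: "y < z" "w y < w z" using R[OF that] by auto
    then have "\<not> (sgen k \<circ> w) z < (sgen k \<circ> w) y" using inversion_sgen_iff[OF d yz(1)] by simp
    moreover have "(sgen k \<circ> w) z \<noteq> (sgen k \<circ> w) y" using yz k by simp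
    ultimately show ?thesis using yz(1) by linarith
  qed
qed


text \<open>Putting the label back inverts the deletion: balance at the deleted root holds by
  \<open>gterm_removed\<close>, and at the others it is unaffected by
  \<open>gterm_remove\<close>.\<close>

lemma remove_bij:
  assumes d: "desc w k"
  shows "bij_betw (\<lambda>f. f(removed k := 0))
    {f \<in> balanced_labels R M (Suc n) w. f (removed k) = Suc n} (balanced_labels R M n (sgen k \<circ> w))"
proof -
  let ?r = "removed k" and ?w = "sgen k \<circ> w"
  interpret w': balance ?w M R by (rule balance_sgen[OF d])
  note C = cinv_sgen[OF d]
  have I: "{1..Suc n} - {Suc n} = {1..n}" "insert (Suc n) {1..n} = {1..Suc n}" by auto
  have fw: "f(?r := 0) \<in> balanced_labels R M n ?w"
    if f: "f \<in> balanced_labels R M (Suc n) w" and r: "f ?r = Suc n" for f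
  proof -
    note L = label_facts(1)[OF f]
    have bij: "bij_betw f (insert ?r (cinv ?w)) {1..Suc n}" and nz: "\<And>c. f c \<noteq> 0 \<Longrightarrow> c \<in> cinv w"
      using f C(1) unfolding balanced_labels_def by auto
    have b': "bij_betw f (cinv ?w) {1..n}"
      using bij notIn_Un_bij_betw3[of ?r "cinv ?w" f "{1..n}"] C(2) r by (simp add: I del: One_nat_def)
    have le: "f c \<le> n" if "c \<noteq> ?r" for c
    proof (cases "f c = 0")
      case False
      then have "c \<in> cinv ?w" using nz[of c] that C(1) by (metis insertE)
      then show ?thesis using b' by (auto dest: bij_betwE)
    qed simp
    have "bij_betw (f(?r := 0)) (cinv ?w) {1..n}"
      using b' C(2) by (subst bij_betw_cong[of _ _ f]) auto
    moreover have "c \<in> cinv ?w" if "(f(?r := 0)) c \<noteq> 0" for c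
      using that nz[of c] C(1) by (metis fun_upd_apply insertE)
    moreover have "balanced_at R M (f(?r := 0)) x z"
      if "x < z" "?w z < ?w x" "x \<noteq> - z" for x z
    proof -
      have *: "w z < w x" "rt (x, z) \<noteq> ?r" using that inversion_sgen_iff[OF d that(1)] by auto
      have "balanced_at R M f x z"
        using f that *(1) by (auto simp: balanced_labels_def)
      then show ?thesis using gterm_remove[OF d L r le that(1) *] by simp
    qed
    ultimately show ?thesis unfolding balanced_labels_def by blast
  qed
  have bw: "g(?r := Suc n) \<in> balanced_labels R M (Suc n) w" and g0: "g ?r = 0"
    if g: "g \<in> balanced_labels R M n ?w" for g
  proof -
    let ?f = "g(?r := Suc n)"
    have bij: "bij_betw g (cinv ?w) {1..n}" and nz: "\<And>c. g c \<noteq> 0 \<Longrightarrow> c \<in> cinv ?w"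
      using g unfolding balanced_labels_def by auto
    show g0: "g ?r = 0" using nz[of ?r] C(2) by blast
    have "bij_betw ?f (cinv ?w) {1..n}"
      using bij C(2) by (subst bij_betw_cong[of _ _ g]) auto
    then have "bij_betw ?f (cinv w) {1..Suc n}"
      using notIn_Un_bij_betw3[of ?r "cinv ?w" ?f "{1..n}"] C by (simp add: I del: One_nat_def)
    moreover have "c \<in> cinv w" if "?f c \<noteq> 0" for c
      using that nz[of c] C(1) by (metis fun_upd_apply insertI1 insertI2)
    moreover have "balanced_at R M ?f x z"
      if xz: "x < z" "w z < w x" "x \<noteq> - z" for x z
    proof -
      have L: "?f (rt (x, y)) \<noteq> 0 \<longleftrightarrow> w y < w x" if "x < y" for x y
        using w'.label_facts(1)[OF g that] inversion_sgen_iff[OF d that] rt_mem_cinv_iff[OF sp that] C(1)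
        by auto
      have r: "?f ?r = Suc n" by simp
      show ?thesis
      proof (cases "rt (x, z) = ?r")
        case True
        have le: "?f c \<le> Suc n" for c using w'.label_facts(2)[OF g, of c] by simp
        show ?thesis by (intro sum.neutral ballI gterm_removed[where f = "?f" and n = "Suc n", OF d _ r _ xz True]) (use L le in auto)
      next
        case False
        have le: "?f c \<le> n" if "c \<noteq> ?r" for c using w'.label_facts(2)[OF g, of c] that by simp
        have "?f(?r := 0) = g" using g0 by auto
        moreover have "balanced_at R M g x z"
        proof -
          have "?w z < ?w x" using inversion_sgen_iff[OF d xz(1)] xz(2) False by blast
          then show ?thesis using g xz(1,3) unfolding balanced_labels_def by blast
        qed
        moreover have "gterm R ?f x y z = gterm R (?f(?r := 0)) x y z" for y
          by (rule gterm_remove[where f = "?f" and n = n, OF d _ r _ xz(1,2) False]) (use L le in auto)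
        ultimately show ?thesis by (simp only:)
      qed
    qed
    ultimately show "?f \<in> balanced_labels R M (Suc n) w" unfolding balanced_labels_def by blast
  qed
  show ?thesis
    by (rule bij_betw_byWitness[where f' = "\<lambda>g. g(?r := Suc n)"]) (use fw bw g0 in auto)
qed

lemma balanced_labels_Suc:
  "balanced_labels R M (Suc n) w =
    (\<Union>k\<in>{k. desc w k}. {f \<in> balanced_labels R M (Suc n) w. f (removed k) = Suc n})"
proof -
  have "\<exists>k. desc w k \<and> f (removed k) = Suc n" if f: "f \<in> balanced_labels R M (Suc n) w" for f
  proof -
    have "bij_betw f (cinv w) {1..Suc n}" using f by (auto simp: balanced_labels_def)
    then obtain c where c: "c \<in> cinv w" "f c = Suc n"
      unfolding bij_betw_def by (metis atLeastAtMost_iff image_iff le_add1 le_refl plus_1_eq_Suc)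
    obtain x y where xy: "c = (x, y)" by force
    have cxy: "x \<noteq> 0" "y \<noteq> 0" "x + y \<le> 0" "x < y" "w y < w x" using c xy by (auto simp: cinv_def)
    obtain a b where ab: "a < b" "w b < w a" "a \<noteq> - b" "f (rt (a, b)) = Suc n"
    \<comment> \<open>A short root is passed on as \<open>(x, 0)\<close>, where a balance condition
      is available.\<close>
    proof (cases "x = - y")
      case True
      then have "rt (x, 0) = c" "x < 0" "0 < w x" using cxy xy neg[of y] by (auto simp: rt_def)
      then show thesis using that[of x 0] c zero cxy by simp
    next
      case False
      then have "rt (x, y) = c" using cxy xy by (auto simp: rt_def)
      then show thesis using that[of x y] False c cxy by simp
    qed
    have adj: "w a = w b + 1" using max_label_adjacent[OF f ab] .
    have ia: "inv w (w a) = a" "inv w (w b) = b" using sperm_inv[OF sp] by auto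
    show ?thesis
    proof (cases "0 \<le> w b")
      case True
      then have "desc w (w b)" "removed (w b) = rt (a, b)"
        using ia ab adj by (simp_all add: desc_def removed_def)
      then show ?thesis using ab by auto
    next
      case False
      have "inv w (- w a) = - a" "inv w (- w a + 1) = - b"
        using inv_neg[of "w a"] inv_neg[of "w b"] ia adj by simp_all
      then have "desc w (- w a)" "removed (- w a) = rt (- b, - a)"
        using ab adj False by (simp_all add: desc_def removed_def)
      then show ?thesis using ab rt_minus[of a b] by metis
    qed
  qed
  then show ?thesis by blast
qed

lemma removed_inj:
  assumes "desc w k" "desc w k'" "removed k = removed k'"
  shows "k = k'"
proof -
  have "inv w (k' + 1) < inv w k'" using assms(2) by (simp add: desc_def)
  from rt_removed_iff[OF assms(1) this] have "rem_vals k (k' + 1) k'"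
    using assms(3) sperm_inv[OF sp] by (simp add: removed_def)
  then show ?thesis using assms by (auto simp: rem_vals_def desc_def)
qed

lemma cinv_empty_iff: "cinv w = {} \<longleftrightarrow> w = id"
proof
  assume e: "cinv w = {}"
  have mono: "w x < w y" if "x < y" for x y
    using rt_mem_cinv_iff[OF sp that] e val_eq[of x y] that by auto
  show "w = id" by (rule sperm_strict_mono_id[OF sp mono])
next
  assume "w = id"
  then show "cinv w = {}" by (auto simp: cinv_def)
qed

lemma balanced_labels_0: "balanced_labels R M 0 w = (if w = id then {\<lambda>_. 0} else {})"
proof (cases "w = id")
  case True
  then have "cinv w = {}" using cinv_empty_iff by simp
  moreover have "\<not> (x < z \<and> w z < w x)" for x z using True by simp
  ultimately have "balanced_labels R M 0 w = {\<lambda>_. 0}"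
    unfolding balanced_labels_def by (auto simp: fun_eq_iff bij_betw_def)
  then show ?thesis using True by simp
next
  case False
  then show ?thesis using cinv_empty_iff by (auto simp: balanced_labels_def bij_betw_def)
qed

end

text \<open>Sorting the labellings by the descent whose root carries the largest label reproduces
  the recursion of \<open>num_words\<close>, whatever \<open>R\<close> is.\<close>

theorem card_balanced_labels:
  assumes "balance w M R"
  shows "finite (balanced_labels R M n w) \<and> card (balanced_labels R M n w) = num_words n w"
  using assms
proof (induction n arbitrary: w)
  case 0
  then show ?case by (simp add: balance.balanced_labels_0)
next
  case (Suc n)
  interpret balance w M R by fact
  let ?S = "\<lambda>k. {f \<in> balanced_labels R M (Suc n) w. f (removed k) = Suc n}"
  have S: "finite (?S k)" "card (?S k) = num_words n (sgen k \<circ> w)" if "desc w k" for k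
  proof -
    note b = remove_bij[OF that, of n]
    note IH = Suc.IH[OF balance_sgen[OF that]]
    show "finite (?S k)" using bij_betw_finite[OF b] IH by blast
    show "card (?S k) = num_words n (sgen k \<circ> w)"
      using bij_betw_same_card[OF b] IH by (metis (lifting))
  qed
  have fin: "finite {k. desc w k}" using finite_desc[OF sp] .
  have disj: "?S k \<inter> ?S k' = {}" if "desc w k" "desc w k'" "k \<noteq> k'" for k k'
  proof -
    have "removed k = removed k'" if "f \<in> ?S k" "f \<in> ?S k'" for f
    proof -
      have "inj_on f (cinv w)" using that by (auto simp: balanced_labels_def bij_betw_def)
      moreover have "removed k \<in> cinv w" "removed k' \<in> cinv w"
        using cinv_sgen(1)[OF \<open>desc w k\<close>] cinv_sgen(1)[OF \<open>desc w k'\<close>] by auto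
      moreover have "f (removed k) = f (removed k')" using that by simp
      ultimately show ?thesis unfolding inj_on_def by blast
    qed
    then show ?thesis using removed_inj that by blast
  qed
  have "card (\<Union>k\<in>{k. desc w k}. ?S k) = (\<Sum>k\<in>{k. desc w k}. card (?S k))"
    by (rule card_UN_disjoint) (use fin S(1) disj in \<open>simp_all\<close>)
  also have "\<dots> = num_words (Suc n) w" using S(2) by simp
  finally have "card (balanced_labels R M (Suc n) w) = num_words (Suc n) w"
    unfolding balanced_labels_Suc[symmetric] .
  moreover have "finite (\<Union>k\<in>{k. desc w k}. ?S k)" using fin S(1) by simp
  then have "finite (balanced_labels R M (Suc n) w)"
    unfolding balanced_labels_Suc[symmetric] .
  ultimately show ?case by simp
qed

section \<open>Grassmannian elements and standard tableaux\<close>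

definition move_down :: "int \<Rightarrow> int set \<Rightarrow> int set" where
  "move_down k S = S - {k + 1} \<union> (if k = 0 then {} else {k})"

text \<open>The recursion in which both sides meet: \<open>S\<close> is the set of parts of a strict
  partition, and the part \<open>k + 1\<close> can lose a box exactly if \<open>k\<close> is not a
  part. A part that shrinks to 0 is dropped.\<close>

fun removal_count :: "nat \<Rightarrow> int set \<Rightarrow> nat" where
  "removal_count 0 S = (if S = {} then 1 else 0)"
| "removal_count (Suc n) S =
    (\<Sum>k\<in>{k. 0 \<le> k \<and> k + 1 \<in> S \<and> k \<notin> S}. removal_count n (move_down k S))"

definition neg_values :: "(int \<Rightarrow> int) \<Rightarrow> int set" where
  "neg_values u = {v. 0 < v \<and> inv u v < 0}"

text \<open>Descents only destroy inversions, so the positive positions stay increasing and, by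
  oddness, so do the negative ones. Hence \<open>k\<close> is a descent exactly if
  \<open>k + 1\<close> stands at a negative position and \<open>k\<close> does not.\<close>

lemma num_words_grassmannian:
  assumes "sperm u" "\<And>x y. 0 < x \<Longrightarrow> x < y \<Longrightarrow> u x < u y"
  shows "num_words n u = removal_count n (neg_values u)"
  using assms
proof (induction n arbitrary: u)
  case 0
  note sp = \<open>sperm u\<close> and mono = 0(2)
  have "u = id \<longleftrightarrow> neg_values u = {}"
  proof
    assume e: "neg_values u = {}"
    have pos: "0 < u x" if "0 < x" for x
    proof (rule ccontr)
      assume "\<not> 0 < u x"
      moreover have "u x \<noteq> 0" using sperm_zero_iff[OF sp, of x] that by simp
      moreover have "inv u (- u x) = - x"
        using sperm_minus[OF sperm_inv_sperm[OF sp], of "u x"] sperm_inv(1)[OF sp, of x] by simp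
      ultimately have "- u x \<in> neg_values u" using that by (simp add: neg_values_def)
      then show False using e by simp
    qed
    show "u = id"
    proof (rule sperm_strict_mono_id[OF sp])
      fix x y :: int assume xy: "x < y"
      have n: "u (- x) = - u x" for x using sperm_minus[OF sp] .
      consider "0 < x" | "y < 0" | "x \<le> 0" "0 \<le> y" by linarith
      then show "u x < u y"
      proof cases
        case 1
        then show ?thesis using mono xy by simp
      next
        case 2
        then show ?thesis using mono[of "- y" "- x"] xy n[of x] n[of y] by simp
      next
        case 3
        then show ?thesis using pos[of "- x"] pos[of y] xy n[of x] sperm_zero[OF sp]
          by (cases "x = 0"; cases "y = 0") auto
      qed
    qed
  next
    assume "u = id"
    then show "neg_values u = {}" by (auto simp: neg_values_def)
  qed
  then show ?case by simp
next
  case (Suc n)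
  note sp = \<open>sperm u\<close> and mono = Suc.prems(2)
  obtain m where supp: "\<And>x. \<bar>x\<bar> > m \<Longrightarrow> u x = x" using sp unfolding sperm_def by blast
  interpret balance u m "\<lambda>_ _. False"
    by standard (use sp supp in auto)
  have iu: "u (inv u v) = v" for v using sperm_inv(2)[OF sp] .
  have i0: "inv u 0 = 0" using sperm_zero[OF sperm_inv_sperm[OF sp]] .
  have inz: "inv u v \<noteq> 0" if "v \<noteq> 0" for v using that iu[of v] zero by auto
  have d: "desc u k \<longleftrightarrow> 0 \<le> k \<and> k + 1 \<in> neg_values u \<and> k \<notin> neg_values u" for k
  proof (cases "0 \<le> k")
    case True
    have "inv u (k + 1) < 0" if "inv u (k + 1) < inv u k"
      using mono[of "inv u (k + 1)" "inv u k"] that iu inz[of "k + 1"] True by force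
    moreover have "0 \<le> inv u k" if "inv u (k + 1) < inv u k"
    proof (rule ccontr)
      assume "\<not> 0 \<le> inv u k"
      then have "u (- inv u k) < u (- inv u (k + 1))" using that by (intro mono) auto
      then show False by (simp add: neg iu)
    qed
    moreover have "inv u (k + 1) < inv u k" if "inv u (k + 1) < 0" "0 \<le> inv u k"
      using that by simp
    ultimately show ?thesis using True i0 by (cases "k = 0") (auto simp: desc_def neg_values_def)
  next
    case False
    then show ?thesis by (simp add: desc_def)
  qed
  have step: "num_words n (sgen k \<circ> u) = removal_count n (move_down k (neg_values u))" if k: "desc u k" for k
  proof -
    have k0: "0 \<le> k" and k1: "k + 1 \<in> neg_values u" "k \<notin> neg_values u" using k d by auto
    have "num_words n (sgen k \<circ> u) = removal_count n (neg_values (sgen k \<circ> u))"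
    proof (rule Suc.IH)
      show sp': "sperm (sgen k \<circ> u)" using sp k0 by (rule sperm_sgen_comp)
      show "(sgen k \<circ> u) x < (sgen k \<circ> u) y" if "0 < x" "x < y" for x y
      proof -
        have "\<not> (sgen k \<circ> u) y < (sgen k \<circ> u) x"
          using inversion_sgen_iff[OF k that(2)] mono[OF that] by simp
        moreover have "(sgen k \<circ> u) y \<noteq> (sgen k \<circ> u) x"
          using sperm_inj[OF sp', of y x] that by simp
        ultimately show ?thesis by linarith
      qed
    qed
    also have "neg_values (sgen k \<circ> u) = move_down k (neg_values u)"
    proof (intro set_eqI)
      fix v
      have "inv u (- 1) = - inv u 1" by (rule inv_neg)
      then show "v \<in> neg_values (sgen k \<circ> u) \<longleftrightarrow> v \<in> move_down k (neg_values u)"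
        using k0 k1 unfolding neg_values_def move_down_def inv_sgen_comp[OF sp k0]
        by (cases "k = 0") (auto simp: sgen_eq split: if_splits)
    qed
    finally show ?thesis .
  qed
  have D: "{k. desc u k} = {k. 0 \<le> k \<and> k + 1 \<in> neg_values u \<and> k \<notin> neg_values u}"
    using d by blast
  have "num_words (Suc n) u = (\<Sum>k\<in>{k. desc u k}. removal_count n (move_down k (neg_values u)))"
    using step by (simp only: num_words.simps) (rule sum.cong, auto)
  then show ?case by (simp only: removal_count.simps D)
qed

section \<open>Standard fillings of shifted diagrams\<close>

definition linear_exts :: "nat \<Rightarrow> (int \<times> int) set \<Rightarrow> (int \<times> int \<Rightarrow> nat) set" where
  "linear_exts n S = {t. t \<in> extensional S \<and> bij_betw t S {1..n} \<and>
     (\<forall>i j j'. (i, j) \<in> S \<and> (i, j') \<in> S \<and> j < j' \<longrightarrow> t (i, j) < t (i, j')) \<and>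
     (\<forall>i i' j. (i, j) \<in> S \<and> (i', j) \<in> S \<and> i < i' \<longrightarrow> t (i, j) < t (i', j))}"

lemma linear_extsD:
  assumes "t \<in> linear_exts n S"
  shows "c \<notin> S \<Longrightarrow> t c = undefined"
    and "(i, j) \<in> S \<Longrightarrow> (i, j') \<in> S \<Longrightarrow> j < j' \<Longrightarrow> t (i, j) < t (i, j')"
    and "(i, j) \<in> S \<Longrightarrow> (i', j) \<in> S \<Longrightarrow> i < i' \<Longrightarrow> t (i, j) < t (i', j)"
  using assms unfolding linear_exts_def extensional_def by blast+

definition cells :: "int \<Rightarrow> (int \<Rightarrow> int) \<Rightarrow> (int \<times> int) set" where
  "cells d p = {(i, j). 1 \<le> i \<and> i - d \<le> j \<and> j < i - d + p i}"

definition parts :: "(int \<Rightarrow> int) \<Rightarrow> int set" where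
  "parts p = {p i |i. 1 \<le> i \<and> 0 < p i}"

locale strict_rows =
  fixes p :: "int \<Rightarrow> int"
  assumes nonneg: "0 \<le> p i"
    and fin: "\<exists>N. \<forall>i > N. p i = 0"
    and strict: "1 \<le> i \<Longrightarrow> i < i' \<Longrightarrow> p i' < p i \<or> p i' = 0"
begin

lemma finite_parts: "finite (parts p)"
proof -
  obtain N where N: "\<And>i. i > N \<Longrightarrow> p i = 0" using fin by blast
  have "parts p \<subseteq> p ` {1..N}"
  proof
    fix v assume "v \<in> parts p"
    then obtain i where i: "v = p i" "1 \<le> i" "0 < p i" by (auto simp: parts_def)
    then have "i \<le> N" using N[of i] by (cases "i \<le> N") auto
    then show "v \<in> p ` {1..N}" using i by auto
  qed
  then show ?thesis by (rule finite_subset) simp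
qed

lemma parts_drop:
  assumes "1 \<le> i" "i \<le> i'" "0 < p i'"
  shows "p i' + (i' - i) \<le> p i"
proof -
  have "p i' + int k \<le> p (i' - int k)" if "1 \<le> i' - int k" for k
    using that
  proof (induction k)
    case (Suc k)
    then have "p i' + int k \<le> p (i' - int k)" by simp
    then show ?case using strict[of "i' - int (Suc k)" "i' - int k"] Suc.prems assms(3) by auto
  qed simp
  from this[of "nat (i' - i)"] show ?thesis using assms by simp
qed

lemma part_row_unique: "1 \<le> i \<Longrightarrow> 1 \<le> i' \<Longrightarrow> 0 < p i \<Longrightarrow> p i = p i' \<Longrightarrow> i = i'"
  using strict[of i i'] strict[of i' i] by force

text \<open>Each row starts one column further to the right. A later row can thus reach below the
  last box of a row of length \<open>k + 1\<close> only if row \<open>i + 1\<close> is nonempty and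
  has length at least \<open>k\<close>; strictness leaves the length \<open>k\<close>, which is not
  a part.\<close>

lemma removable_cell:
  assumes k: "0 \<le> k" "k + 1 \<in> parts p" "k \<notin> parts p" and i: "1 \<le> i" "p i = k + 1"
  shows "strict_rows (p(i := k))" "parts (p(i := k)) = move_down k (parts p)"
    "cells d p = insert (i, i - d + k) (cells d (p(i := k)))" "(i, i - d + k) \<notin> cells d (p(i := k))"
    "\<And>i'. i < i' \<Longrightarrow> (i', i - d + k) \<notin> cells d p" "\<And>j. i - d + k < j \<Longrightarrow> (i, j) \<notin> cells d p"
proof -
  have nk: "p i' \<noteq> k \<or> k = 0" if "1 \<le> i'" for i' using k that by (force simp: parts_def)
  show "strict_rows (p(i := k))"
  proof
    show "0 \<le> (p(i := k)) j" for j using nonneg k by simp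
    obtain N where "\<And>i. i > N \<Longrightarrow> p i = 0" using fin by blast
    then have "\<forall>j > max N i. (p(i := k)) j = 0" by simp
    then show "\<exists>N. \<forall>j > N. (p(i := k)) j = 0" by blast
    show "(p(i := k)) b < (p(i := k)) a \<or> (p(i := k)) b = 0" if "1 \<le> a" "a < b" for a b
      using strict[OF that] nk[of b] that i k by auto
  qed
  show "parts (p(i := k)) = move_down k (parts p)"
  proof (intro set_eqI)
    fix v
    have "i' = i" if "1 \<le> i'" "p i' = k + 1" for i' using part_row_unique[of i i'] i that k by auto
    note u = this
    show "v \<in> parts (p(i := k)) \<longleftrightarrow> v \<in> move_down k (parts p)"
    proof
      assume "v \<in> parts (p(i := k))"
      then obtain i' where i': "v = (p(i := k)) i'" "1 \<le> i'" "0 < v" by (auto simp: parts_def)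
      show "v \<in> move_down k (parts p)"
      proof (cases "i' = i")
        case True
        then show ?thesis using i' by (simp add: move_down_def)
      next
        case False
        then have "v = p i'" "v \<noteq> k + 1" using i' u[of i'] by auto
        then show ?thesis using i' by (auto simp: move_down_def parts_def)
      qed
    next
      assume "v \<in> move_down k (parts p)"
      then consider "v = k" "k \<noteq> 0" | "v \<in> parts p" "v \<noteq> k + 1" by (auto simp: move_down_def split: if_splits)
      then show "v \<in> parts (p(i := k))"
      proof cases
        case 1
        then show ?thesis using i k unfolding parts_def by (intro CollectI exI[of _ i]) simp
      next
        case 2
        then obtain i' where "v = p i'" "1 \<le> i'" "0 < p i'" by (auto simp: parts_def)
        then show ?thesis using 2 i unfolding parts_def by (intro CollectI exI[of _ i']) auto
      qed
    qed
  qed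
  show "cells d p = insert (i, i - d + k) (cells d (p(i := k)))" "(i, i - d + k) \<notin> cells d (p(i := k))"
    using i k by (auto simp: cells_def split: if_splits)
  show "(i', i - d + k) \<notin> cells d p" if "i < i'" for i'
  proof
    assume c: "(i', i - d + k) \<in> cells d p"
    then have pos: "0 < p i'" by (auto simp: cells_def)
    then have "p i' + (i' - (i + 1)) \<le> p (i + 1)" using parts_drop[of "i + 1" i'] i that by simp
    moreover have "p (i + 1) < k"
      using strict[of i "i + 1"] nk[of "i + 1"] i k calculation pos that by force
    ultimately show False using c by (auto simp: cells_def)
  qed
  show "(i, j) \<notin> cells d p" if "i - d + k < j" for j using that i by (auto simp: cells_def)
qed

end

lemma linear_exts_remove:
  assumes c: "c \<notin> S" "c = (i, j)" and right: "\<And>j'. j < j' \<Longrightarrow> (i, j') \<notin> S" and below: "\<And>i'. i < i' \<Longrightarrow> (i', j) \<notin> S"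
  shows "bij_betw (\<lambda>t. t(c := undefined)) {t \<in> linear_exts (Suc n) (insert c S). t c = Suc n} (linear_exts n S)"
proof -
  have I: "insert (Suc n) {1..n} = {1..Suc n}" by auto
  have fw: "t(c := undefined) \<in> linear_exts n S" if t: "t \<in> linear_exts (Suc n) (insert c S)" "t c = Suc n" for t
  proof -
    have b: "bij_betw t (insert c S) {1..Suc n}" using t unfolding linear_exts_def by blast
    have "bij_betw t S {1..n}"
      using b notIn_Un_bij_betw3[of c S t "{1..n}"] c(1) t(2) by (simp add: I del: One_nat_def)
    then have "bij_betw (t(c := undefined)) S {1..n}" using c(1) by (subst bij_betw_cong[of _ _ t]) auto
    moreover have eq: "(t(c := undefined)) x = t x" if "x \<in> S" for x using that c(1) by auto
    moreover have "t(c := undefined) \<in> extensional S"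
      using linear_extsD(1)[OF t(1)] by (simp add: extensional_def)
    ultimately show ?thesis
      using t(1) unfolding linear_exts_def by (simp add: eq)
  qed
  have bw: "t(c := Suc n) \<in> linear_exts (Suc n) (insert c S)" and t0: "t c = undefined" if t: "t \<in> linear_exts n S" for t
  proof -
    show "t c = undefined" using linear_extsD(1)[OF t c(1)] .
    have b: "bij_betw t S {1..n}" using t unfolding linear_exts_def by blast
    have b': "bij_betw (t(c := Suc n)) S {1..n}" using b c(1) by (subst bij_betw_cong[of _ _ t]) auto
    have "bij_betw (t(c := Suc n)) (insert c S) {1..Suc n}"
      using b' notIn_Un_bij_betw3[of c S "t(c := Suc n)" "{1..n}"] c(1) by (simp add: I del: One_nat_def)
    moreover have lt: "t x < Suc n" if "x \<in> S" for x using bij_betwE[OF b] that by fastforce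
    have "(t(c := Suc n)) (a, b) < (t(c := Suc n)) (a, b')"
      if "(a, b) \<in> insert c S" "(a, b') \<in> insert c S" "b < b'" for a b b'
      using that t c right lt by (auto simp: linear_exts_def)
    moreover have "(t(c := Suc n)) (a, b) < (t(c := Suc n)) (a', b)"
      if "(a, b) \<in> insert c S" "(a', b) \<in> insert c S" "a < a'" for a a' b
      using that t c below lt by (auto simp: linear_exts_def)
    moreover have "t(c := Suc n) \<in> extensional (insert c S)"
      using linear_extsD(1)[OF t] by (simp add: extensional_def)
    ultimately show "t(c := Suc n) \<in> linear_exts (Suc n) (insert c S)"
      unfolding linear_exts_def by blast
  qed
  show ?thesis
    by (rule bij_betw_byWitness[where f' = "\<lambda>t. t(c := Suc n)"]) (use fw bw t0 in \<open>auto simp: fun_upd_idem\<close>)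
qed

text \<open>The largest entry stands at the end of a row whose shortening keeps the parts distinct;
  removing it gives the recursion of \<open>removal_count\<close>.\<close>

lemma card_linear_exts:
  assumes "strict_rows p"
  shows "finite (linear_exts n (cells d p)) \<and> card (linear_exts n (cells d p)) = removal_count n (parts p)"
  using assms
proof (induction n arbitrary: p)
  case (0 p)
  interpret strict_rows p by fact
  have e: "cells d p = {} \<longleftrightarrow> parts p = {}"
  proof
    assume "cells d p = {}"
    then have "\<not> 0 < p i" if "1 \<le> i" for i using that by (force simp: cells_def)
    then show "parts p = {}" by (auto simp: parts_def)
  next
    assume "parts p = {}"
    then have "\<not> 0 < p i" if "1 \<le> i" for i using that by (force simp: parts_def)
    then show "cells d p = {}" by (force simp: cells_def)
  qed
  have "linear_exts 0 (cells d p) = (if cells d p = {} then {\<lambda>_. undefined} else {})"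
    by (auto simp: linear_exts_def bij_betw_def)
  then show ?case using e by simp
next
  case (Suc n p)
  interpret strict_rows p by fact
  let ?K = "{k. 0 \<le> k \<and> k + 1 \<in> parts p \<and> k \<notin> parts p}"
  define row where "row k = (SOME i. 1 \<le> i \<and> p i = k + 1)" for k
  have row: "1 \<le> row k" "p (row k) = k + 1" if "k \<in> ?K" for k
  proof -
    have "\<exists>i. 1 \<le> i \<and> p i = k + 1" using that by (auto simp: parts_def)
    then show "1 \<le> row k" "p (row k) = k + 1" unfolding row_def by (metis (mono_tags, lifting) someI_ex)+
  qed
  define c where "c k = (row k, row k - d + k)" for k
  let ?S = "\<lambda>k. {t \<in> linear_exts (Suc n) (cells d p). t (c k) = Suc n}"
  have S: "finite (?S k)" "card (?S k) = removal_count n (move_down k (parts p))" if k: "k \<in> ?K" for k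
  proof -
    have 1: "0 \<le> k" "k + 1 \<in> parts p" "k \<notin> parts p" using k by auto
    note rc = removable_cell[OF 1 row[OF k]]
    have b: "bij_betw (\<lambda>t. t(c k := undefined)) (?S k) (linear_exts n (cells d (p(row k := k))))"
      unfolding rc(3) c_def by (rule linear_exts_remove[OF rc(4) refl]) (use rc(3,5,6) in auto)
    note IH = Suc.IH[OF rc(1)]
    show "finite (?S k)" using bij_betw_finite[OF b] IH by blast
    show "card (?S k) = removal_count n (move_down k (parts p))"
      using bij_betw_same_card[OF b] IH unfolding rc(2)[symmetric] by (metis (lifting))
  qed
  have cover: "linear_exts (Suc n) (cells d p) = (\<Union>k\<in>?K. ?S k)"
  proof -
    have "\<exists>k\<in>?K. t (c k) = Suc n" if t: "t \<in> linear_exts (Suc n) (cells d p)" for t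
    proof -
      have b: "bij_betw t (cells d p) {1..Suc n}" using t unfolding linear_exts_def by blast
      then obtain i j where ij: "(i, j) \<in> cells d p" "t (i, j) = Suc n"
        unfolding bij_betw_def by (metis atLeastAtMost_iff image_iff le_add1 le_refl plus_1_eq_Suc surj_pair)
      have le: "t x \<le> Suc n" if "x \<in> cells d p" for x using bij_betwE[OF b] that by auto
      have "(i, j + 1) \<notin> cells d p"
      proof
        assume a: "(i, j + 1) \<in> cells d p"
        then have "t (i, j) < t (i, j + 1)" using linear_extsD(2)[OF t ij(1)] by simp
        then show False using le[OF a] ij by simp
      qed
      then have j: "j = i - d + p i - 1" "1 \<le> i" "0 < p i" using ij by (auto simp: cells_def)
      \<comment> \<open>Such a part would belong to a later row, so row \<open>i + 1\<close> would
        be long enough to have a box below the largest entry.\<close>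
      have nk: "p i - 1 \<notin> parts p"
      proof
        assume "p i - 1 \<in> parts p"
        then obtain i' where i': "1 \<le> i'" "p i' = p i - 1" "0 < p i'" by (auto simp: parts_def)
        have "i < i'"
        proof (rule ccontr)
          assume "\<not> i < i'"
          moreover have "i' \<noteq> i" using i'(2) by auto
          ultimately have "i' < i" by simp
          from strict[OF i'(1) this] show False using i'(2) j(3) by linarith
        qed
        have "p i' + (i' - (i + 1)) \<le> p (i + 1)" using parts_drop[of "i + 1" i'] i' \<open>i < i'\<close> j by simp
        then have a: "(i + 1, j) \<in> cells d p" using j i' \<open>i < i'\<close> by (simp add: cells_def)
        then have "t (i, j) < t (i + 1, j)" using linear_extsD(3)[OF t ij(1)] by simp
        then show False using le[OF a] ij by simp
      qed
      moreover have "p i - 1 + 1 \<in> parts p" using j by (auto simp: parts_def)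
      ultimately have K: "p i - 1 \<in> ?K" using j by simp
      have "row (p i - 1) = i" using row[OF K] part_row_unique[of i "row (p i - 1)"] j by simp
      then have "c (p i - 1) = (i, j)" using j by (simp add: c_def)
      then show ?thesis using K ij by metis
    qed
    then show ?thesis by blast
  qed
  have disj: "?S k \<inter> ?S k' = {}" if "k \<in> ?K" "k' \<in> ?K" "k \<noteq> k'" for k k'
  proof -
    have mem: "c k \<in> cells d p" if "k \<in> ?K" for k
      using row[OF that] that by (simp add: c_def cells_def)
    have "c k \<noteq> c k'" using row[OF that(1)] row[OF that(2)] that(3) by (auto simp: c_def)
    moreover have "c k = c k'" if "t \<in> ?S k" "t \<in> ?S k'" for t
    proof (rule inj_onD[of t "cells d p"])
      show "inj_on t (cells d p)" using that unfolding linear_exts_def bij_betw_def by blast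
      show "t (c k) = t (c k')" using that by simp
    qed (use mem \<open>k \<in> ?K\<close> \<open>k' \<in> ?K\<close> in blast)+
    ultimately show ?thesis by blast
  qed
  have finK: "finite ?K"
    by (rule finite_subset[of _ "(\<lambda>v. v - 1) ` parts p"]) (use finite_parts in \<open>auto intro: image_eqI[of _ _ "_ + 1"]\<close>)
  have "card (\<Union>k\<in>?K. ?S k) = (\<Sum>k\<in>?K. card (?S k))"
    by (rule card_UN_disjoint) (use finK S(1) disj in auto)
  also have "\<dots> = removal_count (Suc n) (parts p)" using S(2) by simp
  finally have "card (linear_exts (Suc n) (cells d p)) = removal_count (Suc n) (parts p)"
    unfolding cover[symmetric] .
  moreover have "finite (\<Union>k\<in>?K. ?S k)" using finK S(1) by blast
  then have "finite (linear_exts (Suc n) (cells d p))" unfolding cover[symmetric] .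
  ultimately show ?case by simp
qed

definition row_length :: "nat list \<Rightarrow> int \<Rightarrow> int" where
  "row_length l i = (if 1 \<le> i \<and> i \<le> num_parts l then part l i else 0)"

lemma shifted_diagram_iff:
  "(i, j) \<in> shifted_diagram l \<longleftrightarrow>
    1 \<le> i \<and> i \<le> num_parts l \<and> i - num_parts l \<le> j \<and> j \<le> part l i - num_parts l + i - 1"
proof
  assume "1 \<le> i \<and> i \<le> num_parts l \<and> i - num_parts l \<le> j \<and> j \<le> part l i - num_parts l + i - 1"
  then show "(i, j) \<in> shifted_diagram l"
    unfolding shifted_diagram_def by (intro CollectI exI[of _ i] exI[of _ "j + num_parts l - i + 1"]) auto
qed (auto simp: shifted_diagram_def)

lemma part_strict:
  assumes "strict_partition l" "1 \<le> i" "i < i'" "i' \<le> num_parts l"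
  shows "part l i' < part l i"
  using assms unfolding strict_partition_def part_def num_parts_def
  by (auto simp: sorted_wrt_iff_nth_less)

lemma part_pos:
  assumes "strict_partition l" "1 \<le> i" "i \<le> num_parts l"
  shows "0 < part l i"
  using assms unfolding strict_partition_def part_def num_parts_def by auto

lemma card_SYT:
  assumes l: "strict_partition l"
  shows "card (SYT l) = removal_count (sum_list l) (int ` set l)"
proof -
  let ?d = "num_parts l" and ?D = "shifted_diagram l"
  let ?C = "cells ?d (row_length l)"
  have rows: "strict_rows (row_length l)"
  proof
    show "0 \<le> row_length l i" for i by (simp add: row_length_def part_def)
    show "\<exists>N. \<forall>i > N. row_length l i = 0" by (rule exI[of _ ?d]) (simp add: row_length_def)
    show "row_length l i' < row_length l i \<or> row_length l i' = 0" if "1 \<le> i" "i < i'" for i i'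
      using part_strict[OF l that] that by (auto simp: row_length_def)
  qed
  have parts: "parts (row_length l) = int ` set l"
  proof (intro set_eqI iffI)
    fix v assume "v \<in> parts (row_length l)"
    then obtain i where "1 \<le> i" "i \<le> ?d" "v = part l i" by (auto simp: parts_def row_length_def split: if_splits)
    then show "v \<in> int ` set l" by (auto simp: part_def num_parts_def)
  next
    fix v assume "v \<in> int ` set l"
    then obtain m where m: "m < length l" "v = int (l ! m)" by (auto simp: in_set_conv_nth)
    then show "v \<in> parts (row_length l)"
      using part_pos[OF l, of "int m + 1"] unfolding parts_def
      by (intro CollectI exI[of _ "int m + 1"]) (auto simp: row_length_def part_def num_parts_def)
  qed
  have "?D = ?C" by (auto simp: cells_def row_length_def shifted_diagram_iff split: if_splits)
  then have "SYT l = linear_exts (sum_list l) ?C"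
    unfolding SYT_def bijective_fillings_def linear_exts_def by (simp only: mem_Collect_eq conj_assoc)
  then show ?thesis using card_linear_exts[OF rows] parts by simp
qed

section \<open>The dominant element of a strict partition\<close>

text \<open>The permutation of the natural numbers with the given Lehmer code: position 0 gets
  \<open>c\<close>, and the other positions follow the permutation of the tail on the values
  different from \<open>c\<close>.\<close>

fun lehmer :: "nat list \<Rightarrow> nat \<Rightarrow> nat" where
  "lehmer [] x = x"
| "lehmer (c # cs) 0 = c"
| "lehmer (c # cs) (Suc x) = (if lehmer cs x < c then lehmer cs x else Suc (lehmer cs x))"

lemma lehmer_inj: "lehmer cs x = lehmer cs y \<longleftrightarrow> x = y"
proof (induction cs arbitrary: x y)
  case (Cons c cs)
  show ?case using Cons[of "x - 1" "y - 1"] by (cases x; cases y; auto split: if_splits)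
qed simp

lemma lehmer_surj: "\<exists>x. lehmer cs x = v"
proof (induction cs arbitrary: v)
  case (Cons c cs)
  consider "v = c" | "v < c" | v' where "v = Suc v'" "c \<le> v'" by (cases v) (auto simp: less_Suc_eq_le not_le, linarith)
  then show ?case
  proof cases
    case 1
    then have "lehmer (c # cs) 0 = v" by simp
    then show ?thesis by blast
  next
    case 2
    obtain x where "lehmer cs x = v" using Cons by blast
    then have "lehmer (c # cs) (Suc x) = v" using 2 by simp
    then show ?thesis by blast
  next
    case 3
    obtain x where "lehmer cs x = v'" using Cons by blast
    then have "lehmer (c # cs) (Suc x) = v" using 3 by simp
    then show ?thesis by blast
  qed
qed simp

lemma lehmer_eventually_id: "\<exists>N. \<forall>x\<ge>N. lehmer cs x = x"
proof (induction cs)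
  case (Cons c cs)
  then obtain N where N: "\<And>x. x \<ge> N \<Longrightarrow> lehmer cs x = x" by blast
  have "lehmer (c # cs) x = x" if "x \<ge> Suc (max N c)" for x
    using that N[of "x - 1"] by (cases x) auto
  then show ?case by blast
qed auto

lemma lehmer_mono: "length cs \<le> x \<Longrightarrow> x < y \<Longrightarrow> lehmer cs x < lehmer cs y"
proof (induction cs arbitrary: x y)
  case (Cons c cs)
  then obtain x' y' where "x = Suc x'" "y = Suc y'" by (metis Suc_le_D length_Cons less_imp_Suc_add add_Suc)
  then show ?case using Cons.IH[of x' y'] Cons.prems by auto
qed simp

text \<open>In a decreasing code the entries after \<open>c\<close> are at most \<open>c\<close>, so
  prepending \<open>c\<close> shifts no value below them. The smaller values further right therefore
  form an initial segment.\<close>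

lemma lehmer_dominant:
  assumes "sorted_wrt (\<ge>) cs" "i < length cs"
  shows "(i < x \<and> lehmer cs x < lehmer cs i) \<longleftrightarrow> lehmer cs x < cs ! i"
  using assms
proof (induction cs arbitrary: i x)
  case (Cons c cs)
  show ?case
  proof (cases i)
    case 0
    then show ?thesis by (cases x) auto
  next
    case (Suc i')
    then have le: "cs ! i' \<le> c" and i': "i' < length cs" using Cons.prems by auto
    show ?thesis
    proof (cases x)
      case 0
      then show ?thesis using le Suc by simp
    next
      case (Suc x')
      have "(i' < x' \<and> lehmer cs x' < lehmer cs i') \<longleftrightarrow> lehmer cs x' < cs ! i'"
        using Cons.IH[OF _ i'] Cons.prems by simp
      then show ?thesis using le Suc \<open>i = Suc i'\<close> by auto
    qed
  qed
qed simp

text \<open>Positions \<open>-d, \<dots>, -1\<close> and \<open>d + 1, d + 2, \<dots>\<close> carry the positive values, in this order.\<close>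
definition signed_of :: "nat \<Rightarrow> (nat \<Rightarrow> nat) \<Rightarrow> int \<Rightarrow> int" where
  "signed_of d y x =
     (if x = 0 then 0
      else if - int d \<le> x \<and> x < 0 then 1 + int (y (nat (x + int d)))
      else if int d < x then 1 + int (y (nat (x - 1)))
      else if 0 < x then - 1 - int (y (nat (int d - x)))
      else - 1 - int (y (nat (- x - 1))))"

locale signed_word =
  fixes d :: nat and y :: "nat \<Rightarrow> nat"
  assumes inj: "y a = y b \<longleftrightarrow> a = b" and surj: "\<exists>a. y a = v"
    and ev_id: "\<exists>N. \<forall>a\<ge>N. y a = a"
    and mono: "d \<le> a \<Longrightarrow> a < b \<Longrightarrow> y a < y b"
begin

abbreviation "w \<equiv> signed_of d y"

definition pos :: "int \<Rightarrow> nat" where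
  "pos x = (if x < 0 then nat (x + int d) else nat (x - 1))"

lemma w_pos: "- int d \<le> x \<and> x < 0 \<or> int d < x \<Longrightarrow> w x = 1 + int (y (pos x))"
  by (auto simp: signed_of_def pos_def)

lemma w_neg: "w (- x) = - w x"
  by (auto simp: signed_of_def add.commute)

lemma pos_mono: "- int d \<le> x \<and> x < 0 \<or> int d < x \<Longrightarrow> - int d \<le> z \<and> z < 0 \<or> int d < z \<Longrightarrow> pos x < pos z \<longleftrightarrow> x < z"
  by (auto simp: pos_def)

lemma w_sign: "0 < w x \<longleftrightarrow> - int d \<le> x \<and> x < 0 \<or> int d < x"
  by (auto simp: signed_of_def)

lemma w_zero: "w x = 0 \<longleftrightarrow> x = 0"
  by (auto simp: signed_of_def)

lemma w_inj_pos: "0 < w x \<Longrightarrow> w x = w z \<Longrightarrow> x = z"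
proof -
  assume *: "0 < w x" "w x = w z"
  then have "pos x = pos z" using w_sign[of x] w_sign[of z] w_pos[of x] w_pos[of z] inj by auto
  then show ?thesis using pos_mono[of x z] pos_mono[of z x] * w_sign[of x] w_sign[of z] by auto
qed

lemma w_surj_pos: "0 < v \<Longrightarrow> \<exists>x. w x = v"
proof -
  assume "0 < v"
  obtain a where a: "y a = nat (v - 1)" using surj by blast
  let ?x = "if a < d then int a - int d else int a + 1"
  have "pos ?x = a" "- int d \<le> ?x \<and> ?x < 0 \<or> int d < ?x" by (auto simp: pos_def)
  then have "w ?x = v" using w_pos[of ?x] a \<open>0 < v\<close> by auto
  then show ?thesis by blast
qed

lemma sperm_w: "sperm w"
proof -
  have "inj w"
  proof (rule injI)
    fix x z assume e: "w x = w z"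
    consider "0 < w x" | "w x = 0" | "0 < w (- x)" using w_neg[of x] by linarith
    then show "x = z"
      using e w_inj_pos[of x z] w_inj_pos[of "- x" "- z"] w_zero w_neg by cases auto
  qed
  moreover have "\<exists>x. v = w x" for v
  proof -
    consider "0 < v" | "v = 0" | "0 < - v" by linarith
    then show ?thesis
    proof cases
      case 1
      then show ?thesis using w_surj_pos by metis
    next
      case 2
      then show ?thesis using w_zero[of 0] by metis
    next
      case 3
      then obtain x where "w x = - v" using w_surj_pos by blast
      then have "w (- x) = v" using w_neg by simp
      then show ?thesis by metis
    qed
  qed
  ultimately have "bij w" unfolding bij_def surj_def by blast
  moreover have "\<exists>m. \<forall>x. \<bar>x\<bar> > m \<longrightarrow> w x = x"
  proof -
    obtain N where N: "\<And>a. a \<ge> N \<Longrightarrow> y a = a" using ev_id by blast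
    have p: "w x = x" if "x > int N + int d + 1" for x
      using that N[of "nat (x - 1)"] w_pos[of x] by (auto simp: pos_def)
    have "w x = x" if "\<bar>x\<bar> > int N + int d + 1" for x
    proof (cases "0 < x")
      case False
      then have "w (- x) = - x" using that by (intro p) auto
      then show ?thesis using w_neg by simp
    qed (use p that in auto)
    then show ?thesis by blast
  qed
  ultimately show ?thesis using w_neg unfolding sperm_def by blast
qed

lemma rows_w: "rows (int d) w"
proof
  show "sperm w" by (rule sperm_w)
  show "w x < w z" if "int d < x" "x < z" for x z
    using that w_pos[of x] w_pos[of z] mono[of "pos x" "pos z"] pos_mono[of x z] by (auto simp: pos_def)
qed (auto simp: w_sign)

lemma dominant_row:
  assumes dom: "\<And>i x. i < d \<Longrightarrow> (i < x \<and> y x < y i) \<longleftrightarrow> y x < k i"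
    and x: "- int d \<le> x" "x < 0"
  shows "(x < z \<and> 0 < w z \<and> w z < w x) \<longleftrightarrow> (0 < w z \<and> w z \<le> int (k (nat (x + int d))))"
proof (cases "0 < w z")
  case True
  then have z: "- int d \<le> z \<and> z < 0 \<or> int d < z" using w_sign by simp
  have px: "pos x = nat (x + int d)" "pos x < d" using x by (auto simp: pos_def)
  have "x < z \<longleftrightarrow> pos x < pos z" using pos_mono[of x z] z x by simp
  moreover have "w z < w x \<longleftrightarrow> y (pos z) < y (pos x)" using w_pos[of x] w_pos[of z] z x by simp
  moreover have "w z \<le> int (k (pos x)) \<longleftrightarrow> y (pos z) < k (pos x)" using w_pos[of z] z by auto
  ultimately show ?thesis using dom[OF px(2), of "pos z"] True px(1) by auto
qed simp

end

text \<open>Stronger than prescribing the code: the smaller positive values to the right of row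
  \<open>x\<close> are exactly \<open>1, ..., part l (x + d + 1) + x\<close>. This allows columns to
  be identified with values.\<close>

locale dominant = rows +
  fixes l :: "nat list"
  assumes l: "strict_partition l" and d: "d = num_parts l"
    and dom: "- d \<le> x \<Longrightarrow> x < 0 \<Longrightarrow>
      (x < z \<and> 0 < u z \<and> u z < u x) \<longleftrightarrow> (0 < u z \<and> u z \<le> part l (x + d + 1) + x)"

lemma part_drop:
  assumes "strict_partition l" "a < b" "b < length l"
  shows "l ! b + (b - a) \<le> l ! a"
proof -
  have s: "l ! j < l ! i" if "i < j" "j < length l" for i j
    using assms(1) that by (auto simp: strict_partition_def sorted_wrt_iff_nth_less)
  have "l ! (a + k) + k \<le> l ! a" if "a + k < length l" for k
    using that
  proof (induction k)
    case (Suc k)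
    then show ?case using s[of "a + k" "a + Suc k"] by simp
  qed simp
  from this[of "b - a"] show ?thesis using assms by simp
qed

text \<open>The last part is at least 1 and the parts grow by at least 1 per row upwards. Hence the
  subtraction in the code entries is never truncated.\<close>

lemma part_ge:
  assumes "strict_partition l" "m < length l"
  shows "length l \<le> l ! m + m"
proof -
  have "0 < l ! (length l - 1)" using assms by (auto simp: strict_partition_def)
  moreover have "l ! (length l - 1) + (length l - 1 - m) \<le> l ! m"
    using part_drop[OF assms(1), of m "length l - 1"] assms(2) by (cases "m = length l - 1") auto
  ultimately show ?thesis using assms(2) by linarith
qed

lemma dominant_exists:
  assumes l: "strict_partition l"
  shows "\<exists>u. dominant (num_parts l) u l"
proof -
  define ks where "ks = map (\<lambda>m. l ! m + m - length l) [0..<length l]"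
  have k: "ks ! m = l ! m + m - length l" "m < length ks" if "m < length l" for m
    using that by (simp_all add: ks_def)
  have "sorted_wrt (\<ge>) ks"
    unfolding sorted_wrt_iff_nth_less
  proof (intro allI impI)
    fix a b assume ab: "a < b" "b < length ks"
    then have b: "b < length l" by (simp add: ks_def)
    show "ks ! b \<le> ks ! a" using part_drop[OF l ab(1) b] k ab b by simp
  qed
  note dom = lehmer_dominant[OF this]
  interpret signed_word "length l" "lehmer ks"
  proof
    show "lehmer ks a < lehmer ks b" if "length l \<le> a" "a < b" for a b
      using lehmer_mono[of ks a b] that by (simp add: ks_def)
  qed (use lehmer_inj lehmer_surj lehmer_eventually_id in auto)
  interpret rows "int (length l)" w by (rule rows_w)
  have "dominant (num_parts l) w l"
  proof
    show "num_parts l = num_parts l" ..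
    fix x z assume x: "- num_parts l \<le> x" "x < 0"
    have "(x < z \<and> 0 < w z \<and> w z < w x) \<longleftrightarrow> (0 < w z \<and> w z \<le> int (ks ! nat (x + int (length l))))"
      using x by (intro dominant_row dom) (auto simp: num_parts_def ks_def)
    moreover have "int (ks ! nat (x + int (length l))) = part l (x + num_parts l + 1) + x"
      using k(1)[of "nat (x + int (length l))"] part_ge[OF l, of "nat (x + int (length l))"] x
      by (auto simp: num_parts_def part_def algebra_simps)
    ultimately show "(x < z \<and> 0 < w z \<and> w z < w x) \<longleftrightarrow> (0 < w z \<and> w z \<le> part l (x + num_parts l + 1) + x)"
      by simp
  qed (use l rows_w in \<open>auto simp: num_parts_def rows_def\<close>)
  then show ?thesis by blast
qed

text \<open>The unique occurrence of \<open>v\<close> splits the descending list into the larger and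
  the smaller elements.\<close>

lemma kth_largest_iff:
  fixes v :: "'a :: linorder"
  assumes "count M v = 1" "1 \<le> k" "k \<le> size M"
  shows "kth_largest k M = v \<longleftrightarrow> size {#a \<in># M. v < a#} = k - 1"
proof -
  define xs where "xs = rev (sorted_list_of_multiset M)"
  have M: "M = mset xs" by (simp add: xs_def)
  have sorted: "sorted_wrt (\<ge>) xs" by (simp add: xs_def sorted_wrt_rev)
  have "v \<in> set xs" using assms(1) by (metis M count_mset_0_iff zero_neq_one)
  then obtain ys zs where xs: "xs = ys @ v # zs" by (meson split_list)
  have nin: "v \<notin> set ys" "v \<notin> set zs" using assms(1) unfolding M xs by (auto simp: count_mset_0_iff[symmetric] simp del: count_mset_0_iff)
  have ys: "filter (\<lambda>a. v < a) ys = ys"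
    using sorted nin(1) unfolding xs by (intro filter_True) (auto simp: sorted_wrt_append order_le_less)
  have zs: "filter (\<lambda>a. v < a) zs = []"
    using sorted unfolding xs by (auto simp: sorted_wrt_append filter_empty_conv)
  have "size {#a \<in># M. v < a#} = length (filter (\<lambda>a. v < a) xs)" unfolding M by (metis mset_filter size_mset)
  also have "\<dots> = length ys" unfolding xs by (simp add: ys zs)
  finally have sz: "size {#a \<in># M. v < a#} = length ys" .
  have len: "k - 1 < length xs" using assms(2,3) unfolding M by simp
  have "xs ! (k - 1) = v \<longleftrightarrow> k - 1 = length ys"
  proof
    assume e: "xs ! (k - 1) = v"
    show "k - 1 = length ys"
    proof (rule ccontr)
      assume "k - 1 \<noteq> length ys"
      then consider "k - 1 < length ys" | "length ys < k - 1" by linarith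
      then show False
      proof cases
        case 1
        then show False using e nin(1) unfolding xs by (metis nth_append nth_mem)
      next
        case 2
        then obtain m where m: "k - 1 = length ys + Suc m" by (metis add_Suc_right less_imp_Suc_add)
        then show False using e nin(2) len unfolding xs by (auto simp: nth_append)
      qed
    qed
  qed (simp add: xs)
  then show ?thesis unfolding sz by (auto simp: kth_largest_def xs_def)
qed

section \<open>Inversion roots as boxes of the diagram\<close>

context dominant
begin

text \<open>
  Row \<open>i\<close> of the diagram is the position \<open>x = i - d - 1\<close>. The columns are positions as well: the column
  \<open>-j \<le> 0\<close> is the position \<open>j\<close>, and a positive column \<open>j\<close> is the position where the value is \<open>j\<close>. With these
  conventions the extended hook of a box consists of the roots that occur in its balance condition
  for the relation \<open>fwd\<close>, and the added boxes are the second copies of the roots \<open>(x, 0)\<close>.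
\<close>
definition fwd :: "int \<Rightarrow> int \<Rightarrow> bool" where
  "fwd y z \<longleftrightarrow> y < z \<and> u y < u z \<and> \<not> (1 \<le> y \<and> z \<le> d)"

definition row_code :: "int \<Rightarrow> int" where
  "row_code x = part l (x + d + 1) + x"

definition col :: "int \<Rightarrow> int" where
  "col y = (if 0 \<le> y \<and> y \<le> d then - y else u y)"

text \<open>One pair per root: for \<open>- x < y \<le> d\<close> the root of \<open>(x, y)\<close>
  belongs to row \<open>- y\<close>, and \<open>y = - x\<close> gives the root of
  \<open>(x, 0)\<close>.\<close>

definition Y :: "int \<Rightarrow> int set" where
  "Y x = {y. x < y \<and> u y < u x \<and> (y < - x \<or> d < y)}"

definition box :: "int \<Rightarrow> int \<Rightarrow> int \<times> int" where
  "box x y = (x + d + 1, col y)"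

abbreviation "box_hook x z \<equiv> extended_hook l (x + d + 1) (col z)"

abbreviation "rank x z \<equiv> box_rank l (x + d + 1) (col z)"

lemma u_neg: "1 \<le> y \<Longrightarrow> y \<le> d \<Longrightarrow> u y < 0" "y < - d \<Longrightarrow> u y < 0"
  using row_pos[of "- y"] out_pos[of "- y"] neg[of y] by auto

lemma row_code_nonneg: "- d \<le> x \<Longrightarrow> x < 0 \<Longrightarrow> 0 \<le> row_code x"
proof -
  assume x: "- d \<le> x" "x < 0"
  have dl: "d = int (length l)" by (simp add: d num_parts_def)
  have "part l (x + d + 1) = int (l ! nat (x + d))" by (simp add: part_def)
  moreover have "int (length l) \<le> int (l ! nat (x + d)) + int (nat (x + d))"
    using part_ge[OF l, of "nat (x + d)"] x dl by linarith
  moreover have "int (nat (x + d)) = x + d" using x by simp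
  ultimately have "0 \<le> part l (x + d + 1) + x" using dl by linarith
  then show ?thesis unfolding row_code_def .
qed

lemma row_code_iff: "- d \<le> x \<Longrightarrow> x < 0 \<Longrightarrow> (x < z \<and> 0 < u z \<and> u z < u x) \<longleftrightarrow> (0 < u z \<and> u z \<le> row_code x)"
  using dom by (simp add: row_code_def)

lemma diagram_iff: "(x + d + 1, j) \<in> shifted_diagram l \<longleftrightarrow> - d \<le> x \<and> x < 0 \<and> x + 1 \<le> j \<and> j \<le> row_code x"
  unfolding shifted_diagram_iff d[symmetric] row_code_def by auto

lemma col_pos: "- d \<le> y \<Longrightarrow> 0 < col y \<longleftrightarrow> y < 0 \<or> d < y"
  using row_pos[of y] out_pos[of y] by (auto simp: col_def)

lemma col_neg: "- d \<le> y \<Longrightarrow> col y < 0 \<longleftrightarrow> 1 \<le> y \<and> y \<le> d"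
  using row_pos[of y] out_pos[of y] by (auto simp: col_def)

lemma col_inj: "- d \<le> y \<Longrightarrow> - d \<le> y' \<Longrightarrow> col y = col y' \<longleftrightarrow> y = y'"
proof -
  assume *: "- d \<le> y" "- d \<le> y'"
  have "y = y'" if "col y = col y'"
    using that * row_pos[of y] row_pos[of y'] out_pos[of y] out_pos[of y'] val_eq[of y y']
    unfolding col_def by (auto split: if_splits)
  then show "col y = col y' \<longleftrightarrow> y = y'" by blast
qed

lemma Y_ge: "- d \<le> x \<Longrightarrow> y \<in> Y x \<Longrightarrow> - d \<le> y"
  by (auto simp: Y_def)

text \<open>The columns \<open>x + 1, ..., 0\<close> of row \<open>x\<close> are the positions
  \<open>0, ..., - x - 1\<close>. By dominance its columns \<open>1, ..., row_code x\<close> are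
  precisely the smaller positive values to the right.\<close>

lemma box_mem:
  assumes x: "- d \<le> x" "x < 0" and y: "- d \<le> y"
  shows "box x y \<in> shifted_diagram l \<longleftrightarrow> y \<in> Y x"
proof (cases "0 \<le> y \<and> y \<le> d")
  case True
  have "u y < u x" using row_pos[OF x] u_neg(1)[of y] True zero by (cases "y = 0") auto
  then show ?thesis
    using True x row_code_nonneg[OF x] unfolding box_def diagram_iff by (auto simp: col_def Y_def)
next
  case False
  then have "0 < u y" using row_pos[of y] out_pos[of y] y by auto
  then show ?thesis
    using False x row_code_iff[OF x, of y] y unfolding box_def diagram_iff by (auto simp: col_def Y_def)
qed

lemma diagram_box:
  assumes "b \<in> shifted_diagram l"
  obtains x y where "b = box x y" "- d \<le> x" "x < 0" "y \<in> Y x"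
proof -
  obtain i j where b: "b = (i, j)" by force
  define x where "x = i - d - 1"
  have i: "i = x + d + 1" by (simp add: x_def)
  have x: "- d \<le> x" "x < 0" "x + 1 \<le> j" "j \<le> row_code x" using assms unfolding b i diagram_iff by auto
  define y where "y = (if j \<le> 0 then - j else inv u j)"
  have "- d \<le> y \<and> col y = j"
  proof (cases "j \<le> 0")
    case True
    then show ?thesis using x by (auto simp: y_def col_def)
  next
    case False
    then have "u y = j" using inv_val(2) by (simp add: y_def)
    then show ?thesis using pos_cases[of y] False d_nonneg by (auto simp: col_def)
  qed
  then have "b = box x y" "- d \<le> y" using b i by (auto simp: box_def)
  then show thesis using that[of x y] x box_mem[of x y] assms by auto
qed

lemma box_inj:
  "- d \<le> y \<Longrightarrow> - d \<le> y' \<Longrightarrow> box x y = box x' y' \<longleftrightarrow> x = x' \<and> y = y'"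
  using col_inj[of y y'] by (auto simp: box_def)

lemma rt_box_inj:
  assumes "x < 0" "x' < 0" "x < y" "x' < y'" "y < - x \<or> d < y" "y' < - x' \<or> d < y'" "- d \<le> x" "- d \<le> x'"
  shows "rt (x, y) = rt (x', y') \<longleftrightarrow> x = x' \<and> y = y'"
  using assms unfolding rt_def by (auto split: if_splits)

text \<open>For \<open>p < - d\<close> the mirrored pair \<open>(- q, - p)\<close> is used. It
  starts in a row, since the positions beyond \<open>d\<close> carry increasing values.\<close>

lemma cinv_box:
  assumes "c \<in> cinv u"
  obtains x y where "c = rt (x, y)" "- d \<le> x" "x < 0" "y \<in> Y x"
proof -
  obtain p q where c: "c = (p, q)" by force
  have pq: "p \<noteq> 0" "q \<noteq> 0" "p + q \<le> 0" "p < q" "u q < u p" using assms by (auto simp: c cinv_def)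
  then have "p < 0" by linarith
  show thesis
  proof (cases "- d \<le> p")
    case True
    show thesis
    proof (cases "q = - p")
      case True
      have "u p > 0" using row_pos \<open>- d \<le> p\<close> \<open>p < 0\<close> by simp
      then have "0 \<in> Y p" using \<open>p < 0\<close> zero by (simp add: Y_def)
      moreover have "c = rt (p, 0)" using c True by (simp add: rt_def)
      ultimately show thesis using that \<open>- d \<le> p\<close> \<open>p < 0\<close> by blast
    next
      case False
      then have "q \<in> Y p" "c = rt (p, q)" using pq c by (auto simp: Y_def rt_def)
      then show thesis using that \<open>- d \<le> p\<close> \<open>p < 0\<close> by blast
    qed
  next
    case False
    then have "u q < 0" using u_neg(2)[of p] pq by simp
    then have "0 < u (- q)" by (simp add: neg)
    then have "- d \<le> - q \<and> - q < 0 \<or> d < - q" by (rule pos_cases)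
    moreover have "\<not> d < - q"
    proof
      assume "d < - q"
      then have "u (- q) < u (- p)" using out_mono[of "- q" "- p"] pq by simp
      then show False using pq by (simp add: neg)
    qed
    ultimately have q: "- d \<le> - q" "- q < 0" by auto
    have "- p \<in> Y (- q)" using pq False by (auto simp: Y_def neg)
    moreover have "c = rt (- q, - p)" using pq c by (auto simp: rt_def)
    ultimately show thesis using that q by blast
  qed
qed

lemma inversion_source:
  assumes "y < z" "u z < u y" "\<not> (1 \<le> z \<and> z \<le> d)" "- d \<le> z"
  shows "- d \<le> y" "y < 0"
proof -
  have z: "0 \<le> u z" using assms row_pos[of z] out_pos[of z] zero by (cases "z = 0"; cases "z < 0") auto
  then have "0 < u y" using assms by simp
  then have "- d \<le> y \<and> y < 0 \<or> d < y" by (rule pos_cases)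
  moreover have "\<not> d < y" using out_mono[of y z] assms by auto
  ultimately show "- d \<le> y" "y < 0" by auto
qed

text \<open>Two positions in \<open>1, ..., d\<close> have columns in the reverse order of the
  positions, whatever their values are; otherwise the columns follow the values. This is the reason
  for the exception in \<open>fwd\<close>.\<close>

lemma right_iff:
  assumes x: "- d \<le> x" "x < 0" and z: "z \<in> Y x" and y: "x < y" "u y < u x"
  shows "(y < z \<and> \<not> fwd y z) \<or> (z < y \<and> fwd z y) \<longleftrightarrow> y \<in> Y x \<and> col z < col y"
proof -
  have dz: "- d \<le> z" "- d \<le> y" using Y_ge[OF x(1) z] x y by auto
  have zx: "z < - x \<or> d < z" using z by (simp add: Y_def)
  have sgn: "((t < 0 \<or> d < t) \<longrightarrow> 0 < u t \<and> col t = u t) \<and> (t = 0 \<longrightarrow> u t = 0 \<and> col t = 0) \<and>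
      (1 \<le> t \<and> t \<le> d \<longrightarrow> u t < 0 \<and> col t = - t)" if "- d \<le> t" for t
    using row_pos[of t] out_pos[of t] u_neg(1)[of t] zero d_nonneg that by (auto simp: col_def)
  show ?thesis
    using sgn[OF dz(1)] sgn[OF dz(2)] val_eq[of y z] zx x y unfolding fwd_def Y_def mem_Collect_eq
    by (smt (verit))
qed

lemma below_iff:
  assumes x: "- d \<le> x" "x < 0" and z: "z \<in> Y x" "\<not> (1 \<le> z \<and> z \<le> d)"
  shows "x < y \<and> y < z \<and> \<not> fwd (- y) (- x) \<and> u z < u y \<longleftrightarrow> x < y \<and> y < 0 \<and> z \<in> Y y"
    and "\<not> (y < x \<and> fwd (- x) (- y) \<and> u z < u y)"
proof -
  have dz: "- d \<le> z" using Y_ge[OF x(1) z(1)] .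
  have src: "- d \<le> y \<and> y < 0" if "y < z" "u z < u y" using inversion_source[OF that z(2) dz] by simp
  show "x < y \<and> y < z \<and> \<not> fwd (- y) (- x) \<and> u z < u y \<longleftrightarrow> x < y \<and> y < 0 \<and> z \<in> Y y"
    using src x z(2) dz by (auto simp: fwd_def Y_def)
  show "\<not> (y < x \<and> fwd (- x) (- y) \<and> u z < u y)"
    using src x z(1) by (auto simp: fwd_def Y_def)
qed

text \<open>In the column \<open>- z\<close> only the roots \<open>(y, z)\<close> with
  \<open>y < - z\<close> in a row are boxes of the column itself. Those with \<open>- z < y\<close>,
  and those with \<open>y < - d\<close>, appear as \<open>(- z, - y)\<close> in the attached row
  \<open>- z\<close>; the root of \<open>(- z, z)\<close> is the added box.\<close>

lemma below_iff_neg: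
  assumes x: "- d \<le> x" "x < 0" and z: "z \<in> Y x" "1 \<le> z" "z \<le> d"
  shows "{y. x < y \<and> y < z \<and> \<not> fwd (- y) (- x) \<and> u z < u y \<and> P y} =
      {y. x < y \<and> y < - z \<and> z \<in> Y y \<and> P y} \<union> (if P (- z) then {- z} else {}) \<union> uminus ` {y \<in> Y (- z). y < z \<and> P (- y)}"
    and "{y. y < x \<and> fwd (- x) (- y) \<and> u z < u y \<and> P y} = uminus ` {y \<in> Y (- z). d < y \<and> P (- y)}"
proof -
  have zx: "z < - x" using z x by (auto simp: Y_def)
  have uz: "u z < 0" "0 < u (- z)" using u_neg(1)[OF z(2,3)] by (auto simp: neg)
  have ux: "u (- x) < 0" using row_pos[OF x] by (simp add: neg)
  have im: "y \<in> uminus ` {y \<in> Y (- z). Q y} \<longleftrightarrow> - y \<in> Y (- z) \<and> Q (- y)" for y Q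
    by (auto intro!: image_eqI[of _ _ "- y"])
  have Yz: "- y \<in> Y (- z) \<longleftrightarrow> y < z \<and> u z < u y \<and> (- z < y \<or> y < - d)" for y
    by (auto simp: Y_def neg)
  have pos: "u z < u y" if "x < y" "y \<le> 0" for y
    using row_pos[of y] that x uz zero by (cases "y = 0") auto
  have nf: "\<not> fwd (- y) (- x)" if "x < y" "y < z" "u z < u y" for y
  proof (cases "y < 0")
    case True
    then show ?thesis using that x by (auto simp: fwd_def)
  next
    case False
    then have "0 \<le> u (- y)" using that row_pos[of "- y"] z zero by (cases "y = 0") auto
    then show ?thesis using ux by (auto simp: fwd_def)
  qed
  show "{y. x < y \<and> y < z \<and> \<not> fwd (- y) (- x) \<and> u z < u y \<and> P y} =
      {y. x < y \<and> y < - z \<and> z \<in> Y y \<and> P y} \<union> (if P (- z) then {- z} else {}) \<union> uminus ` {y \<in> Y (- z). y < z \<and> P (- y)}"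
  proof (intro set_eqI)
    fix y
    consider "y < - z" | "y = - z" | "- z < y" by linarith
    then show "y \<in> {y. x < y \<and> y < z \<and> \<not> fwd (- y) (- x) \<and> u z < u y \<and> P y} \<longleftrightarrow>
      y \<in> {y. x < y \<and> y < - z \<and> z \<in> Y y \<and> P y} \<union> (if P (- z) then {- z} else {}) \<union> uminus ` {y \<in> Y (- z). y < z \<and> P (- y)}"
    proof cases
      case 1
      have "y \<notin> uminus ` {y \<in> Y (- z). y < z \<and> P (- y)}" unfolding im using 1 by auto
      then show ?thesis using 1 z(2) nf[of y] by (auto simp: Y_def)
    next
      case 2
      have "y \<notin> uminus ` {y \<in> Y (- z). y < z \<and> P (- y)}" unfolding im using 2 by auto
      then show ?thesis using 2 z(2) nf[of y] pos[of y] zx by auto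
    next
      case 3
      then have "y \<in> uminus ` {y \<in> Y (- z). y < z \<and> P (- y)} \<longleftrightarrow> y < z \<and> u z < u y \<and> P y"
        unfolding im Yz using z by auto
      then show ?thesis using 3 zx nf[of y] by auto
    qed
  qed
  show "{y. y < x \<and> fwd (- x) (- y) \<and> u z < u y \<and> P y} = uminus ` {y \<in> Y (- z). d < y \<and> P (- y)}"
  proof (intro set_eqI)
    fix y
    have "0 < u (- y)" if "y < - d" using out_pos[of "- y"] that by simp
    moreover have "y < - d" if "y < x" "fwd (- x) (- y)" using that x by (auto simp: fwd_def)
    moreover have "u z < u y" if "- y \<in> Y (- z)" using that unfolding Yz by simp
    ultimately show "y \<in> {y. y < x \<and> fwd (- x) (- y) \<and> u z < u y \<and> P y} \<longleftrightarrow>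
        y \<in> uminus ` {y \<in> Y (- z). d < y \<and> P (- y)}"
      unfolding im Yz using x ux zx z by (auto simp: fwd_def)
  qed
qed

lemma card_row:
  assumes x: "- d \<le> x" "x < 0" and j: "0 \<le> j"
  shows "{y \<in> Y x. j < col y} = inv u ` {j<..row_code x}" "finite {y \<in> Y x. j < col y}"
    "int (card {y \<in> Y x. j < col y}) = max 0 (row_code x - j)"
proof -
  show eq: "{y \<in> Y x. j < col y} = inv u ` {j<..row_code x}"
  proof (intro set_eqI iffI)
    fix y assume y: "y \<in> {y \<in> Y x. j < col y}"
    then have "- d \<le> y" using Y_ge[OF x(1)] by auto
    then have "0 < u y" "col y = u y" using y j col_pos[of y] row_pos[of y] out_pos[of y] by (auto simp: col_def)
    then have "u y \<in> {j<..row_code x}" using y row_code_iff[OF x, of y] by (auto simp: Y_def)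
    then show "y \<in> inv u ` {j<..row_code x}" using inv_val(1)[of y] by (metis image_eqI)
  next
    fix y assume "y \<in> inv u ` {j<..row_code x}"
    then have uy: "j < u y" "u y \<le> row_code x" using inv_val(2) by auto
    then have "0 < u y" using j by simp
    then have "x < y" "u y < u x" using row_code_iff[OF x, of y] uy by auto
    moreover have "- d \<le> y \<and> y < 0 \<or> d < y" using pos_cases \<open>0 < u y\<close> by blast
    ultimately show "y \<in> {y \<in> Y x. j < col y}" using uy x by (auto simp: Y_def col_def)
  qed
  then show "finite {y \<in> Y x. j < col y}" by simp
  have "inj_on (inv u) {j<..row_code x}" by (rule inj_onI) (metis inv_val(2))
  then show "int (card {y \<in> Y x. j < col y}) = max 0 (row_code x - j)"
    unfolding eq by (simp add: card_image)
qed

end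

context dominant
begin

lemma finite_Y:
  assumes "- d \<le> x" "x < 0"
  shows "finite (Y x)"
proof -
  have "box x ` Y x \<subseteq> shifted_diagram l" using box_mem[OF assms] Y_ge[OF assms(1)] by auto
  then have "finite (box x ` Y x)" using finite_shifted_diagram by (rule finite_subset)
  moreover have "inj_on (box x) (Y x)"
    using box_inj Y_ge[OF assms(1)] by (intro inj_onI) blast
  ultimately show ?thesis by (rule finite_imageD)
qed

lemma finite_below: "finite {y. x < y \<and> y < 0 \<and> P (y :: int)}"
  by (rule finite_subset[of _ "{x..0}"]) auto

lemma zero_mem_Y: "- d \<le> x \<Longrightarrow> x < 0 \<Longrightarrow> 0 \<in> Y x"
  using row_pos[of x] zero by (auto simp: Y_def)

lemma hook_eq:
  assumes x: "- d \<le> x" "x < 0" and z: "z \<in> Y x"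
  shows "box_hook x z =
    {box x z} \<union> box x ` {y \<in> Y x. col z < col y} \<union> (\<lambda>y. box y z) ` {y. x < y \<and> y < 0 \<and> z \<in> Y y} \<union>
    (if 1 \<le> z \<and> z \<le> d then box (- z) ` Y (- z) \<union> {box (- z) z} else {})"
proof -
  have dz: "- d \<le> z" using Y_ge[OF x(1) z] .
  have row: "{(x' + d + 1, j') |j'. (x' + d + 1, j') \<in> shifted_diagram l \<and> P j'} = box x' ` {y \<in> Y x'. P (col y)}"
    (is "?A = ?B") if x': "- d \<le> x'" "x' < 0" for x' P
  proof (intro set_eqI iffI)
    fix b assume b: "b \<in> ?A"
    then obtain j' where j: "b = (x' + d + 1, j')" "b \<in> shifted_diagram l" "P j'" by auto
    from diagram_box[OF j(2)] obtain x'' y where y: "b = box x'' y" "- d \<le> x''" "x'' < 0" "y \<in> Y x''" .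
    then have "x'' = x'" "j' = col y" using j(1) by (auto simp: box_def)
    then show "b \<in> ?B" using y j by auto
  next
    fix b assume "b \<in> ?B"
    then show "b \<in> ?A" using box_mem[OF x'] Y_ge[OF x'(1)] by (auto simp: box_def)
  qed
  note right = row[OF x, of "\<lambda>j'. col z < j'"]
  have below: "{(i', col z) |i'. (i', col z) \<in> shifted_diagram l \<and> x + d + 1 < i'} =
      (\<lambda>y. box y z) ` {y. x < y \<and> y < 0 \<and> z \<in> Y y}" (is "?A = ?B")
  proof (intro set_eqI iffI)
    fix b assume b: "b \<in> ?A"
    then obtain i' where i: "b = (i', col z)" "b \<in> shifted_diagram l" "x + d + 1 < i'" by auto
    from diagram_box[OF i(2)] obtain x' y where y: "b = box x' y" "- d \<le> x'" "x' < 0" "y \<in> Y x'" .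
    then have "i' = x' + d + 1" "col y = col z" using i(1) by (auto simp: box_def)
    then have "y = z" "x < x'" using col_inj[OF Y_ge[OF y(2,4)] dz] i by auto
    then show "b \<in> ?B" using y by auto
  next
    fix b assume "b \<in> ?B"
    then obtain y where y: "b = box y z" "x < y" "y < 0" "z \<in> Y y" by auto
    then show "b \<in> ?A" using box_mem[of y z] dz x by (auto simp: box_def)
  qed
  note neg = col_neg[OF dz]
  show ?thesis
  proof (cases "1 \<le> z \<and> z \<le> d")
    case False
    then have "0 \<le> col z" using neg by auto
    then show ?thesis unfolding extended_hook_def hook_def right below using False by (auto simp: box_def)
  next
    case True
    then have cz: "col z = - z" "col z < 0" using neg by (auto simp: col_def)
    have mz: "- d \<le> - z" "- z < 0" using True by auto
    have row: "{(d + col z + 1, j') |j'. (d + col z + 1, j') \<in> shifted_diagram l} = box (- z) ` Y (- z)"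
      using row[OF mz, of "\<lambda>_. True"] cz by (simp add: add.commute)
    have ext: "(d + 1 + col z, col z) = box (- z) z" using cz by (simp add: box_def)
    show ?thesis
      unfolding extended_hook_def hook_def right below d[symmetric] row ext
      using True cz by (auto simp: box_def)
  qed
qed

lemma box_rank_eq:
  assumes x: "- d \<le> x" "x < 0" and z: "z \<in> Y x"
  shows "rank x z =
    (if 1 \<le> z \<and> z \<le> d then row_code x + row_code (- z) + 2 else row_code x - col z + 1)"
proof -
  have dz: "- d \<le> z" using Y_ge[OF x(1) z] .
  note neg = col_neg[OF dz]
  show ?thesis
  proof (cases "1 \<le> z \<and> z \<le> d")
    case True
    then have "col z = - z" by (auto simp: col_def)
    then show ?thesis using True by (simp add: box_rank_def d[symmetric] row_code_def algebra_simps)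
  next
    case False
    then show ?thesis using neg by (auto simp: box_rank_def d[symmetric] row_code_def)
  qed
qed

end

section \<open>Labellings as fillings and the counts in an extended hook\<close>

locale dominant_labels = dominant +
  fixes M :: int and n :: nat and f :: "int \<times> int \<Rightarrow> nat"
  assumes supp: "\<bar>x\<bar> > M \<Longrightarrow> u x = x"
    and nz: "f c \<noteq> 0 \<Longrightarrow> c \<in> cinv u"
    and bij: "bij_betw f (cinv u) {1..n}"
begin

sublocale balance u M fwd
  by unfold_locales (use sp supp in \<open>auto simp: fwd_def\<close>)

lemma f_nz: "y < z \<Longrightarrow> f (rt (y, z)) \<noteq> 0 \<longleftrightarrow> u z < u y"
proof -
  assume yz: "y < z"
  have "f c \<noteq> 0 \<longleftrightarrow> c \<in> cinv u" for c
    using nz[of c] bij_betwE[OF bij] by (cases "c \<in> cinv u") fastforce+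
  then show ?thesis using rt_mem_cinv_iff[OF sp yz] by simp
qed

lemma f_eq:
  "y < z \<Longrightarrow> y' < z' \<Longrightarrow> u z < u y \<Longrightarrow> u z' < u y' \<Longrightarrow> f (rt (y, z)) = f (rt (y', z')) \<longleftrightarrow> rt (y, z) = rt (y', z')"
  using rt_mem_cinv_iff[OF sp] bij by (metis bij_betw_inv_into_left)

definition filling :: "int \<times> int \<Rightarrow> nat" where
  "filling = restrict (\<lambda>(i, j). f (rt (i - d - 1, if j \<le> 0 then - j else inv u j))) (shifted_diagram l)"

lemma filling_box:
  assumes "- d \<le> x" "x < 0" "y \<in> Y x"
  shows "filling (box x y) = f (rt (x, y))"
proof -
  have dy: "- d \<le> y" using Y_ge assms by blast
  have "(if col y \<le> 0 then - col y else inv u (col y)) = y"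
    using row_pos[of y] out_pos[of y] dy inv_val(1)[of y] by (auto simp: col_def)
  moreover have "box x y \<in> shifted_diagram l" using box_mem[OF assms(1,2) dy] assms by simp
  ultimately show ?thesis by (simp add: filling_def box_def)
qed

text \<open>The added box of row \<open>x\<close> is the position \<open>- x\<close>. Copying the
  entry of column 0 there matches \<open>rt (x, - x) = rt (x, 0)\<close>.\<close>

lemma extended_filling_box:
  assumes x: "- d \<le> x" "x < 0" and y: "y \<in> Y x \<or> y = - x"
  shows "extended_filling l filling (box x y) = f (rt (x, y))"
proof (cases "y \<in> Y x")
  case True
  then have "box x y \<in> shifted_diagram l" using box_mem[OF x] Y_ge[OF x(1)] by blast
  then have "extended_filling l filling (box x y) = filling (box x y)"
    by (simp add: extended_filling_def extended_shape_def box_def)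
  then show ?thesis using filling_box[OF x True] by simp
next
  case False
  then have yx: "y = - x" using y by simp
  then have "col y = x" using x by (auto simp: col_def)
  moreover have "box x y \<notin> shifted_diagram l" using box_mem[OF x, of y] False yx x by auto
  moreover have "box x y \<in> extended_shape l"
    unfolding extended_shape_def using x calculation(1)
    by (intro UnI2 CollectI exI[of _ "x + d + 1"]) (auto simp: box_def d[symmetric])
  ultimately have "extended_filling l filling (box x y) = filling (x + d + 1, 0)"
    by (simp add: extended_filling_def box_def)
  also have "(x + d + 1, 0) = box x 0" using d_nonneg by (simp add: box_def col_def)
  also have "filling (box x 0) = f (rt (x, 0))" by (rule filling_box[OF x zero_mem_Y[OF x]])
  also have "rt (x, 0) = rt (x, y)" using x yx by (auto simp: rt_def)
  finally show ?thesis .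
qed

text \<open>The first three cardinalities collect the labels that are actually larger, the last
  three those that are expected to be.\<close>

lemma sum_gterm:
  assumes xz: "x < z" "u z < u x"
  defines "v \<equiv> f (rt (x, z))"
  shows "(\<Sum>y = - M..M. gterm fwd f x y z) =
     int (card {y. x < y \<and> u y < u x \<and> ((y < z \<and> \<not> fwd y z) \<or> (z < y \<and> fwd z y)) \<and> v < f (rt (x, y))})
   + int (card {y. x < y \<and> y < z \<and> \<not> fwd (- y) (- x) \<and> u z < u y \<and> v < f (rt (y, z))})
   + int (card {y. y < x \<and> fwd (- x) (- y) \<and> u z < u y \<and> v < f (rt (y, z))})
   - int (card {y. x < y \<and> y < z \<and> u y < u x \<and> u z < u y})
   - int (card {y. z < y \<and> fwd z y \<and> u y < u x})
   - int (card {y. y < x \<and> fwd (- x) (- y) \<and> u z < u y})"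
    (is "_ = int (card ?P1) + int (card ?P2) + int (card ?P4) - int (card ?N1) - int (card ?N3) - int (card ?N4)")
proof -
  have pos: "y < y' \<and> u y' < u y" if "y < y'" "v < f (rt (y, y'))" for y y'
    using f_nz[OF that(1)] that by auto
  have g: "gterm fwd f x y z = of_bool (y \<in> ?P1) + of_bool (y \<in> ?P2) + of_bool (y \<in> ?P4)
      - of_bool (y \<in> ?N1) - of_bool (y \<in> ?N3) - of_bool (y \<in> ?N4)" for y
  proof -
    consider "x < y \<and> y < z" | "z < y" | "y < x" | "y = x" | "y = z" using xz by linarith
    then show ?thesis
    proof cases
      case 1
      then show ?thesis
        using f_nz[of x y] f_nz[of y z] pos[of x y] pos[of y z]
        by (auto simp: gterm_def v_def[symmetric])
    next
      case 2
      then show ?thesis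
        using f_nz[of x y] pos[of x y] xz by (auto simp: gterm_def v_def[symmetric])
    next
      case 3
      then show ?thesis
        using f_nz[of y z] pos[of y z] xz by (auto simp: gterm_def v_def[symmetric])
    next
      case 4
      then show ?thesis using xz by (auto simp: gterm_def fwd_def)
    next
      case 5
      then show ?thesis using xz by (auto simp: gterm_def fwd_def)
    qed
  qed
  have sub: "int (card S) = (\<Sum>y = - M..M. of_bool (y \<in> S))" if "S \<subseteq> {- M..M}" for S
  proof -
    have "(\<Sum>y = - M..M. of_bool (y \<in> S)) = int (card ({- M..M} \<inter> {y. y \<in> S}))"
      by (simp add: sum_of_bool_eq)
    also have "{- M..M} \<inter> {y. y \<in> S} = S" using that by auto
    finally show ?thesis by simp
  qed
  have xin: "y \<in> {- M..M}" if "x < y" "u y < u x" for y using inversion_bound(2)[OF that] .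
  have zin: "y \<in> {- M..M}" if "y < z" "u z < u y" for y using inversion_bound(1)[OF that] .
  have "?P1 \<subseteq> {- M..M}" "?P2 \<subseteq> {- M..M}" "?P4 \<subseteq> {- M..M}" "?N1 \<subseteq> {- M..M}" "?N3 \<subseteq> {- M..M}" "?N4 \<subseteq> {- M..M}"
    using xin zin xz by (blast, blast, force, blast, force, force)
  note S = this[THEN sub]
  show ?thesis unfolding S g sum.distrib sum_subtractf ..
qed

text \<open>Balance is a property of the root and not of the pair that encodes it: negating and
  exchanging the ends permutes the cases of \<open>gterm\<close>.\<close>

lemma gterm_mirror: "x < z \<Longrightarrow> gterm fwd f (- z) (- y) (- x) = gterm fwd f x y z"
proof -
  assume xz: "x < z"
  consider "x < y \<and> y < z" | "z < y" | "y < x" | "y = x" | "y = z" using xz by linarith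
  then show ?thesis
    using xz by cases (auto simp: gterm_def rt_minus)
qed

lemma sum_gterm_mirror:
  assumes "x < z"
  shows "(\<Sum>y = - M..M. gterm fwd f (- z) y (- x)) = (\<Sum>y = - M..M. gterm fwd f x y z)"
proof -
  have "(\<Sum>y = - M..M. gterm fwd f (- z) y (- x)) = (\<Sum>y\<in>uminus ` {- M..M}. gterm fwd f (- z) y (- x))"
    by simp
  also have "\<dots> = (\<Sum>y = - M..M. gterm fwd f (- z) (- y) (- x))"
    by (subst sum.reindex) (auto intro: inj_onI)
  also have "\<dots> = (\<Sum>y = - M..M. gterm fwd f x y z)" using gterm_mirror[OF assms] by simp
  finally show ?thesis .
qed

end

context dominant_labels
begin

lemma card_uminus_image: "card (uminus ` S) = card (S :: int set)"
  by (rule card_image) (auto intro: inj_onI)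

text \<open>The first set is the part of the hook to the right of the box. The other two are the
  boxes below and, for a negative column, the attached row and the added box.\<close>

lemma count_larger:
  assumes x: "- d \<le> x" "x < 0" and z: "z \<in> Y x"
  defines "v \<equiv> f (rt (x, z))"
  shows "card {b \<in> box_hook x z. v < extended_filling l filling b} =
     card {y. x < y \<and> u y < u x \<and> ((y < z \<and> \<not> fwd y z) \<or> (z < y \<and> fwd z y)) \<and> v < f (rt (x, y))}
   + card {y. x < y \<and> y < z \<and> \<not> fwd (- y) (- x) \<and> u z < u y \<and> v < f (rt (y, z))}
   + card {y. y < x \<and> fwd (- x) (- y) \<and> u z < u y \<and> v < f (rt (y, z))}"
    (is "card ?G = card ?P1 + card ?P2 + card ?P4")
proof -
  let ?EF = "extended_filling l filling"
  let ?S1 = "{y \<in> Y x. col z < col y \<and> v < f (rt (x, y))}"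
  have dz: "- d \<le> z" using Y_ge[OF x(1) z] .
  have xz: "x < z" "u z < u x" using z by (auto simp: Y_def)
  have P1: "?P1 = ?S1" using right_iff[OF x z] by (auto simp: Y_def)
  have EFz: "?EF (box x z) = v" unfolding v_def by (rule extended_filling_box[OF x]) (use z in simp)
  have EFr: "?EF (box x y) = f (rt (x, y))" if "y \<in> Y x" for y
    by (rule extended_filling_box[OF x]) (use that in simp)
  have EFb: "?EF (box y z) = f (rt (y, z))" if "x < y" "y < 0" "z \<in> Y y" for y
    by (rule extended_filling_box) (use that x in auto)
  have fin1: "finite ?S1" using finite_Y[OF x] by simp
  have cS1: "card (box x ` ?S1) = card ?S1"
    using box_inj Y_ge[OF x(1)] by (intro card_image inj_onI) blast
  show ?thesis
  proof (cases "1 \<le> z \<and> z \<le> d")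
    case False
    let ?B = "{y. x < y \<and> y < 0 \<and> z \<in> Y y \<and> v < f (rt (y, z))}"
    have P2: "?P2 = ?B" and P4: "?P4 = {}"
      using below_iff[OF x z False] by blast+
    have G: "?G = box x ` ?S1 \<union> (\<lambda>y. box y z) ` ?B"
      unfolding hook_eq[OF x z] using False EFz EFr EFb by auto
    have cB: "card ((\<lambda>y. box y z) ` ?B) = card ?B"
      using box_inj[OF dz dz] by (intro card_image inj_onI) blast
    have finB: "finite ?B" by (rule finite_below)
    have "box x ` ?S1 \<inter> (\<lambda>y. box y z) ` ?B = {}"
      by (auto simp: box_def)
    then show ?thesis unfolding G P1 P2 P4 using fin1 finB by (subst card_Un_disjoint) (auto simp: cS1 cB)
  next
    case True
    have mz: "- d \<le> - z" "- z < 0" using True by auto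
    let ?S2 = "{y. x < y \<and> y < - z \<and> z \<in> Y y \<and> v < f (rt (y, z))}"
    let ?E = "if v < f (rt (- z, z)) then {- z} else {}"
    let ?C1 = "{y \<in> Y (- z). y < z \<and> v < f (rt (- y, z))}"
    let ?C2 = "{y \<in> Y (- z). d < y \<and> v < f (rt (- y, z))}"
    let ?C = "{y \<in> Y (- z). v < f (rt (- z, y))}"
    have P2: "?P2 = ?S2 \<union> ?E \<union> uminus ` ?C1" and P4: "?P4 = uminus ` ?C2"
      using below_iff_neg[OF x z, of "\<lambda>y. v < f (rt (y, z))"] True by auto
    have finC: "finite ?C" "finite ?C1" "finite ?C2" using finite_Y[OF mz] by auto
    have finS2: "finite ?S2" by (rule finite_subset[of _ "{x..- z}"]) auto
    have rtm: "rt (- y, z) = rt (- z, y)" if "y \<in> Y (- z)" for y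
      using rt_minus[of "- z" y] that by (auto simp: Y_def)
    have C: "?C = ?C1 \<union> ?C2" using rtm by (auto simp: Y_def)
    have C12: "?C1 \<inter> ?C2 = {}" using True by auto
    have cC: "card ?C = card ?C1 + card ?C2" unfolding C by (rule card_Un_disjoint[OF finC(2,3) C12])
    note cu = card_uminus_image
    have d1: "?S2 \<inter> ?E = {}" by auto
    have d2: "(?S2 \<union> ?E) \<inter> uminus ` ?C1 = {}" by (auto simp: Y_def)
    have cP2: "card ?P2 = card ?S2 + card ?E + card ?C1"
      unfolding P2 using finS2 finC d1 d2 by (subst card_Un_disjoint; (subst card_Un_disjoint)?) (auto simp: cu)
    have cP4: "card ?P4 = card ?C2" unfolding P4 by (rule cu)
    have B: "{y. x < y \<and> y < 0 \<and> z \<in> Y y} = {y. x < y \<and> y < - z \<and> z \<in> Y y}"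
      using True by (auto simp: Y_def)
    have EFm: "?EF (box (- z) y) = f (rt (- z, y))" if "y \<in> Y (- z) \<or> y = z" for y
      by (rule extended_filling_box[OF mz]) (use that in auto)
    let ?E' = "if v < f (rt (- z, z)) then {box (- z) z} else {}"
    have EFb': "?EF (box y z) = f (rt (y, z))" if "x < y" "y < - z" "z \<in> Y y" for y
      using EFb[of y] that mz by simp
    have G: "?G = box x ` ?S1 \<union> (\<lambda>y. box y z) ` ?S2 \<union> box (- z) ` ?C \<union> ?E'"
      unfolding hook_eq[OF x z] B using True EFz EFr EFb' EFm by auto
    have cS2: "card ((\<lambda>y. box y z) ` ?S2) = card ?S2"
      using box_inj[OF dz dz] by (intro card_image inj_onI) blast
    have cC': "card (box (- z) ` ?C) = card ?C"
      using box_inj Y_ge[OF mz(1)] by (intro card_image inj_onI) blast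
    have zx: "x < - z" using z True by (auto simp: Y_def)
    have e1: "box x ` ?S1 \<inter> (\<lambda>y. box y z) ` ?S2 = {}"
      by (auto simp: box_def)
    have e2: "(box x ` ?S1 \<union> (\<lambda>y. box y z) ` ?S2) \<inter> box (- z) ` ?C = {}"
      using zx by (auto simp: box_def)
    have nz: "z \<notin> Y (- z)" using True by (auto simp: Y_def)
    have e3: "(box x ` ?S1 \<union> (\<lambda>y. box y z) ` ?S2 \<union> box (- z) ` ?C) \<inter> ?E' = {}"
    proof -
      have "box (- z) z \<notin> box x ` ?S1" using zx by (auto simp: box_def)
      moreover have "box (- z) z \<notin> (\<lambda>y. box y z) ` ?S2" by (auto simp: box_def)
      moreover have "box (- z) z \<notin> box (- z) ` ?C" using box_inj[OF dz Y_ge[OF mz(1)]] nz by blast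
      ultimately show ?thesis by auto
    qed
    have "card ?G = card ?S1 + card ?S2 + card ?C + card ?E'"
    proof -
      have "card ?G = card (box x ` ?S1 \<union> (\<lambda>y. box y z) ` ?S2 \<union> box (- z) ` ?C) + card ?E'"
        unfolding G by (rule card_Un_disjoint[OF _ _ e3]) (use fin1 finS2 finC in auto)
      also have "card (box x ` ?S1 \<union> (\<lambda>y. box y z) ` ?S2 \<union> box (- z) ` ?C) =
          card (box x ` ?S1 \<union> (\<lambda>y. box y z) ` ?S2) + card (box (- z) ` ?C)"
        by (rule card_Un_disjoint[OF _ _ e2]) (use fin1 finS2 finC in auto)
      also have "card (box x ` ?S1 \<union> (\<lambda>y. box y z) ` ?S2) = card (box x ` ?S1) + card ((\<lambda>y. box y z) ` ?S2)"
        by (rule card_Un_disjoint[OF _ _ e1]) (use fin1 finS2 in auto)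
      finally show ?thesis unfolding cS1 cS2 cC' .
    qed
    then show ?thesis unfolding P1 cP2 cP4 cC by simp
  qed
qed

text \<open>In a nonnegative column the expected labels are the boxes to the right. In a negative
  one they are the positive columns of row \<open>x\<close>, those of row \<open>- z\<close>, and
  position 0, which supplies the extra 1 in the rank.\<close>

lemma count_expected:
  assumes x: "- d \<le> x" "x < 0" and z: "z \<in> Y x"
  shows "rank x z = 1 +
     int (card {y. x < y \<and> y < z \<and> u y < u x \<and> u z < u y})
   + int (card {y. z < y \<and> fwd z y \<and> u y < u x})
   + int (card {y. y < x \<and> fwd (- x) (- y) \<and> u z < u y})"
    (is "_ = 1 + int (card ?N1) + int (card ?N3) + int (card ?N4)")
proof -
  have dz: "- d \<le> z" using Y_ge[OF x(1) z] .
  have xz: "x < z" "u z < u x" using z by (auto simp: Y_def)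
  note neg = col_neg[OF dz]
  show ?thesis
  proof (cases "1 \<le> z \<and> z \<le> d")
    case False
    then have j: "0 \<le> col z" using neg by (metis not_less)
    have N4: "?N4 = {}" using below_iff(2)[OF x z False] by blast
    have N13: "?N1 \<union> ?N3 = {y \<in> Y x. col z < col y}"
    proof (intro set_eqI)
      fix y
      show "y \<in> ?N1 \<union> ?N3 \<longleftrightarrow> y \<in> {y \<in> Y x. col z < col y}"
      proof (cases "x < y \<and> u y < u x")
        case True
        have "y < z \<Longrightarrow> \<not> fwd y z \<longleftrightarrow> u z < u y"
          using False val_eq[of y z] by (auto simp: fwd_def)
        then show ?thesis using right_iff[OF x z, of y] True by auto
      next
        case False
        then show ?thesis using xz by (auto simp: Y_def)
      qed
    qed
    have fin: "finite (?N1 \<union> ?N3)" unfolding N13 by (rule card_row(2)[OF x j])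
    have "?N1 \<inter> ?N3 = {}" by auto
    then have "card ?N1 + card ?N3 = card {y \<in> Y x. col z < col y}"
      unfolding N13[symmetric] using fin by (subst card_Un_disjoint) auto
    moreover have "col z \<le> row_code x"
      using box_mem[OF x dz] z unfolding box_def diagram_iff by simp
    ultimately have "int (card ?N1) + int (card ?N3) = row_code x - col z"
      using card_row(3)[OF x j] by linarith
    then show ?thesis unfolding box_rank_eq[OF x z] N4 if_not_P[OF False] by simp
  next
    case True
    have mz: "- d \<le> - z" "- z < 0" using True by auto
    have uz: "u z < 0" using u_neg(1) True by simp
    have zx: "z < - x" using z True by (auto simp: Y_def)
    have K: "int (card {y \<in> Y a. y < 0}) + int (card {y \<in> Y a. d < y}) = row_code a" if a: "- d \<le> a" "a < 0" for a
    proof -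
      have "{y \<in> Y a. 0 < col y} = {y \<in> Y a. y < 0} \<union> {y \<in> Y a. d < y}"
        using col_pos Y_ge[OF a(1)] by blast
      moreover have "{y \<in> Y a. y < 0} \<inter> {y \<in> Y a. d < y} = {}" using d_nonneg by auto
      ultimately have "card {y \<in> Y a. 0 < col y} = card {y \<in> Y a. y < 0} + card {y \<in> Y a. d < y}"
        using finite_Y[OF a] by (simp add: card_Un_disjoint)
      then show ?thesis using card_row(3)[OF a, of 0] row_code_nonneg[OF a] by simp
    qed
    have N1: "?N1 = {y \<in> Y x. y < 0} \<union> {0} \<union> uminus ` {y \<in> Y (- z). y < 0}"
    proof (intro set_eqI)
      fix y
      have im: "y \<in> uminus ` {y \<in> Y (- z). y < 0} \<longleftrightarrow> 0 < y \<and> y < z \<and> u z < u y"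
      proof -
        have "y \<in> uminus ` {y \<in> Y (- z). y < 0} \<longleftrightarrow> - y \<in> Y (- z) \<and> - y < 0"
          by (auto intro!: image_eqI[of _ _ "- y"])
        also have "\<dots> \<longleftrightarrow> 0 < y \<and> y < z \<and> u z < u y"
          using True sperm_minus[OF sp, of y] sperm_minus[OF sp, of z] by (auto simp: Y_def)
        finally show ?thesis .
      qed
      consider "y < 0" | "y = 0" | "0 < y" by linarith
      then show "y \<in> ?N1 \<longleftrightarrow> y \<in> {y \<in> Y x. y < 0} \<union> {0} \<union> uminus ` {y \<in> Y (- z). y < 0}"
      proof cases
        case 1
        have "u z < u y" if "x < y" using row_pos[of y] that x 1 uz by auto
        then show ?thesis using 1 im True x by (auto simp: Y_def)
      next
        case 2
        then show ?thesis using True x uz row_pos[OF x] zero by auto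
      next
        case 3
        have "u y < u x" if "y < z" using u_neg(1)[of y] that 3 True row_pos[OF x] by auto
        then show ?thesis using 3 im x by auto
      qed
    qed
    have N3: "?N3 = {y \<in> Y x. d < y}"
    proof -
      have "u z < u y" if "d < y" for y using out_pos[OF that] uz by simp
      then show ?thesis using True zx x uz by (auto simp: fwd_def Y_def)
    qed
    have N4: "?N4 = uminus ` {y \<in> Y (- z). d < y}"
      using below_iff_neg(2)[OF x z, of "\<lambda>_. True"] True by simp
    note cu = card_uminus_image
    have "card ?N1 = card {y \<in> Y x. y < 0} + 1 + card {y \<in> Y (- z). y < 0}"
    proof -
      have 1: "({y \<in> Y x. y < 0} \<union> {0}) \<inter> uminus ` {y \<in> Y (- z). y < 0} = {}" by auto
      have 2: "{y \<in> Y x. y < 0} \<inter> {0} = {}" by auto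
      have "card ?N1 = card ({y \<in> Y x. y < 0} \<union> {0}) + card (uminus ` {y \<in> Y (- z). y < 0})"
        unfolding N1 by (rule card_Un_disjoint[OF _ _ 1]) (use finite_Y[OF x] finite_Y[OF mz] in auto)
      also have "card ({y \<in> Y x. y < 0} \<union> {0}) = card {y \<in> Y x. y < 0} + card {0 :: int}"
        by (rule card_Un_disjoint[OF _ _ 2]) (use finite_Y[OF x] in auto)
      finally show ?thesis unfolding cu by simp
    qed
    then show ?thesis
      unfolding box_rank_eq[OF x z] N3 N4 cu using True K[OF x] K[OF mz] by simp
  qed
qed

text \<open>The rank has to be within the size of the hook for \<open>kth_largest\<close> to be
  meaningful. The box, the boxes to its right in positive columns and, for a negative column, column
  0 of the row and the positive columns of the attached row suffice.\<close>

lemma hook_size: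
  assumes x: "- d \<le> x" "x < 0" and z: "z \<in> Y x"
  shows "rank x z \<le> int (card (box_hook x z))"
proof -
  let ?H = "box_hook x z"
  have dz: "- d \<le> z" using Y_ge[OF x(1) z] .
  have finH: "finite ?H" by (rule finite_extended_hook)
  note neg = col_neg[OF dz]
  have cb: "card (box a ` S) = card S" if "- d \<le> a" "S \<subseteq> Y a" for a S
    using box_inj Y_ge[OF that(1)] that(2) by (intro card_image inj_onI) blast
  show ?thesis
  proof (cases "1 \<le> z \<and> z \<le> d")
    case False
    then have j: "0 \<le> col z" using neg by (metis not_less)
    let ?S = "{y \<in> Y x. col z < col y}"
    have "box x ` insert z ?S \<subseteq> ?H" unfolding hook_eq[OF x z] by auto
    then have "card (box x ` insert z ?S) \<le> card ?H" using finH by (rule card_mono[rotated])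
    moreover have "card (box x ` insert z ?S) = Suc (card ?S)"
      using cb[OF x(1), of "insert z ?S"] z finite_Y[OF x] by (simp add: card_insert_if)
    ultimately show ?thesis
      using card_row(3)[OF x j] unfolding box_rank_eq[OF x z] using False by auto
  next
    case True
    have mz: "- d \<le> - z" "- z < 0" using True by auto
    have cz: "col z = - z" using True by (simp add: col_def)
    have c0: "col 0 = 0" using d_nonneg by (simp add: col_def)
    let ?S = "{y \<in> Y x. 0 < col y}" and ?T = "{y \<in> Y (- z). 0 < col y}"
    have z0: "0 \<in> Y x" by (rule zero_mem_Y[OF x])
    have sub: "box x ` insert z (insert 0 ?S) \<union> box (- z) ` ?T \<subseteq> ?H"
      unfolding hook_eq[OF x z] using True cz c0 z0 by auto
    have disj: "box x ` insert z (insert 0 ?S) \<inter> box (- z) ` ?T = {}"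
      using z True by (auto simp: box_def Y_def)
    have f: "finite ?S" "finite ?T" using finite_Y[OF x] finite_Y[OF mz] by auto
    have "card (box x ` insert z (insert 0 ?S) \<union> box (- z) ` ?T) =
        card (box x ` insert z (insert 0 ?S)) + card (box (- z) ` ?T)"
      by (rule card_Un_disjoint[OF _ _ disj]) (use f in auto)
    also have "card (box (- z) ` ?T) = card ?T" by (rule cb[OF mz(1)]) auto
    also have "card (box x ` insert z (insert 0 ?S)) = card (insert z (insert 0 ?S))"
      by (rule cb[OF x(1)]) (use z z0 in auto)
    also have "\<dots> = Suc (Suc (card ?S))" using f(1) c0 cz True by (simp add: card_insert_if)
    finally have "Suc (Suc (card ?S)) + card ?T \<le> card ?H" using card_mono[OF finH sub] by simp
    then show ?thesis
      using card_row(3)[OF x, of 0] card_row(3)[OF mz, of 0] row_code_nonneg[OF x] row_code_nonneg[OF mz]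
      unfolding box_rank_eq[OF x z] using True by simp
  qed
qed

text \<open>An extended hook may contain a label twice, at \<open>(- z, 0)\<close> and at the added
  box \<open>(- z, z)\<close>. The label of the box itself is not repeated: no other box of the hook
  has the same root, and \<open>x \<noteq> - z\<close>.\<close>

lemma self_unique:
  assumes x: "- d \<le> x" "x < 0" and z: "z \<in> Y x"
  shows "{b \<in> box_hook x z. extended_filling l filling b = f (rt (x, z))} = {box x z}"
proof -
  let ?EF = "extended_filling l filling"
  have xz: "x < z" "u z < u x" "z < - x \<or> d < z" using z by (auto simp: Y_def)
  have EFz: "?EF (box x z) = f (rt (x, z))" by (rule extended_filling_box[OF x]) (use z in simp)
  have ne: "?EF (box a y) \<noteq> f (rt (x, z))"
    if a: "- d \<le> a" "a < 0" and y: "y \<in> Y a" and n: "\<not> (a = x \<and> y = z)" for a y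
  proof -
    have ay: "a < y" "u y < u a" "y < - a \<or> d < y" using y by (auto simp: Y_def)
    then have "rt (a, y) \<noteq> rt (x, z)" using rt_box_inj[of a x y z] a x xz n by simp
    then show ?thesis
      using f_eq[of a y x z] xz ay extended_filling_box[OF a, of y] y by simp
  qed
  have ne2: "?EF (box (- z) z) \<noteq> f (rt (x, z))" if zd: "1 \<le> z" "z \<le> d"
  proof -
    have mz: "- d \<le> - z" "- z < 0" using zd by auto
    have "rt (- z, z) \<noteq> rt (x, z)" using xz zd by (auto simp: rt_def)
    moreover have "u z < u (- z)" using u_neg(1)[OF zd] by (simp add: neg)
    ultimately show ?thesis
      using f_eq[of "- z" z x z] xz zd extended_filling_box[OF mz, of z] by simp
  qed
  have zx: "z < - x" if "1 \<le> z" "z \<le> d" using xz that by auto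
  have z0: "?EF b \<noteq> f (rt (x, z))" if b: "b \<in> box_hook x z" "b \<noteq> box x z" for b
  proof -
    consider y where "b = box x y" "y \<in> Y x" "y \<noteq> z" | y where "b = box y z" "x < y" "y < 0" "z \<in> Y y"
      | y where "1 \<le> z" "z \<le> d" "b = box (- z) y" "y \<in> Y (- z)" | "1 \<le> z" "z \<le> d" "b = box (- z) z"
      using b unfolding hook_eq[OF x z] by (auto split: if_splits)
    then show ?thesis
    proof cases
      case 1
      then show ?thesis using ne[OF x] by blast
    next
      case 2
      then show ?thesis using ne[of y z] x by auto
    next
      case 3
      then show ?thesis using ne[of "- z" y] zx by auto
    next
      case 4
      then show ?thesis using ne2 by blast
    qed
  qed
  have "box x z \<in> box_hook x z" unfolding hook_eq[OF x z] by simp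
  then show ?thesis using z0 EFz by blast
qed

text \<open>The entry occurs once, so its rank is determined by the number of larger entries;
  subtracting the expected number turns the condition into the vanishing of the balance sum.\<close>

lemma box_condition:
  assumes x: "- d \<le> x" "x < 0" and z: "z \<in> Y x"
  shows "filling (box x z) = kth_largest (nat (rank x z))
      (image_mset (extended_filling l filling) (mset_set (box_hook x z))) \<longleftrightarrow>
    balanced_at fwd M f x z"
proof -
  let ?H = "box_hook x z" and ?EF = "extended_filling l filling"
  let ?v = "f (rt (x, z))" and ?k = "rank x z"
  let ?M = "image_mset ?EF (mset_set ?H)"
  have finH: "finite ?H" by (rule finite_extended_hook)
  have xz: "x < z" "u z < u x" using z by (auto simp: Y_def)
  have k: "1 \<le> ?k" "?k \<le> int (card ?H)" using count_expected[OF assms] hook_size[OF assms] by linarith+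
  have "count ?M ?v = size {#a \<in># ?M. a = ?v#}" by (simp add: filter_eq_replicate_mset)
  also have "\<dots> = card {b \<in> ?H. ?EF b = ?v}" using finH by (simp add: filter_mset_image_mset)
  finally have c: "count ?M ?v = 1" unfolding self_unique[OF assms] by simp
  have s: "size {#a \<in># ?M. ?v < a#} = card {b \<in> ?H. ?v < ?EF b}"
    using finH by (simp add: filter_mset_image_mset filter_mset_mset_set)
  have "kth_largest (nat ?k) ?M = ?v \<longleftrightarrow> card {b \<in> ?H. ?v < ?EF b} = nat ?k - 1"
    unfolding s[symmetric] by (rule kth_largest_iff[OF c]) (use k finH in auto)
  also have "\<dots> \<longleftrightarrow> int (card {b \<in> ?H. ?v < ?EF b}) = ?k - 1" using k by linarith
  also have "\<dots> \<longleftrightarrow> balanced_at fwd M f x z"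
    unfolding sum_gterm[OF xz] count_larger[OF assms] count_expected[OF assms] by auto
  finally show ?thesis using filling_box[OF assms] by auto
qed

end

section \<open>Balanced tableaux as balanced labellings, and the comparison of both counts\<close>

context dominant
begin

definition box_root :: "int \<times> int \<Rightarrow> int \<times> int" where
  "box_root = (\<lambda>(i, j). rt (i - d - 1, if j \<le> 0 then - j else inv u j))"

lemma box_root_box:
  assumes "- d \<le> x" "y \<in> Y x"
  shows "box_root (box x y) = rt (x, y)"
proof -
  have "(if col y \<le> 0 then - col y else inv u (col y)) = y"
    using row_pos[of y] out_pos[of y] Y_ge[OF assms] inv_val(1)[of y] by (auto simp: col_def)
  then show ?thesis by (simp add: box_root_def box_def)
qed

lemma box_root_bij: "bij_betw box_root (shifted_diagram l) (cinv u)"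
  unfolding bij_betw_def
proof
  show "inj_on box_root (shifted_diagram l)"
  proof (rule inj_onI)
    fix b b' assume b: "b \<in> shifted_diagram l" "b' \<in> shifted_diagram l" and e: "box_root b = box_root b'"
    from diagram_box[OF b(1)] obtain x y where x: "b = box x y" "- d \<le> x" "x < 0" "y \<in> Y x" .
    from diagram_box[OF b(2)] obtain x' y' where x': "b' = box x' y'" "- d \<le> x'" "x' < 0" "y' \<in> Y x'" .
    have "rt (x, y) = rt (x', y')" using e box_root_box x x' by simp
    then have "x = x' \<and> y = y'"
      using rt_box_inj[of x x' y y'] x x' by (simp add: Y_def)
    then show "b = b'" using x x' by simp
  qed
  show "box_root ` shifted_diagram l = cinv u"
  proof (intro set_eqI iffI)
    fix c assume "c \<in> box_root ` shifted_diagram l"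
    then obtain b where b: "b \<in> shifted_diagram l" "c = box_root b" by auto
    from diagram_box[OF b(1)] obtain x y where x: "b = box x y" "- d \<le> x" "x < 0" "y \<in> Y x" .
    then show "c \<in> cinv u"
      using b box_root_box[of x y] rt_mem_cinv_iff[OF sp, of x y] by (auto simp: Y_def)
  next
    fix c assume "c \<in> cinv u"
    from cinv_box[OF this] obtain x y where x: "c = rt (x, y)" "- d \<le> x" "x < 0" "y \<in> Y x" .
    then have "box x y \<in> shifted_diagram l" using box_mem Y_ge by blast
    then show "c \<in> box_root ` shifted_diagram l" using box_root_box[of x y] x by (metis image_eqI)
  qed
qed

lemma card_BS: "card (BS l) = num_words (sum_list l) u"
proof -
  obtain M where supp: "\<And>x. \<bar>x\<bar> > M \<Longrightarrow> u x = x" using sp unfolding sperm_def by blast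
  let ?n = "sum_list l" and ?D = "shifted_diagram l"
  have bal: "balance u M fwd" by unfold_locales (use sp supp in \<open>auto simp: fwd_def\<close>)
  define F where "F f = restrict (\<lambda>b. f (box_root b)) ?D" for f :: "int \<times> int \<Rightarrow> nat"
  define G where "G B c = (if c \<in> cinv u then B (the_inv_into ?D box_root c) else (0 :: nat))" for B :: "int \<times> int \<Rightarrow> nat" and c
  note bj = box_root_bij
  have labels: "dominant_labels d u l M ?n f"
    if "\<And>c. f c \<noteq> 0 \<Longrightarrow> c \<in> cinv u" "bij_betw f (cinv u) {1..?n}" for f
    by unfold_locales (use that supp in auto)
  have fill: "dominant_labels.filling d u l f = F f"
    if "dominant_labels d u l M ?n f" for f
    unfolding dominant_labels.filling_def[OF that] F_def box_root_def by (rule restrict_ext) (auto split: prod.split)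
  have cond: "(\<forall>(i, j)\<in>?D. F f (i, j) = kth_largest (nat (box_rank l i j))
        (image_mset (extended_filling l (F f)) (mset_set (extended_hook l i j)))) \<longleftrightarrow>
      (\<forall>x z. x < z \<and> u z < u x \<and> x \<noteq> - z \<longrightarrow> balanced_at fwd M f x z)" (is "?L \<longleftrightarrow> ?R")
    if f: "dominant_labels d u l M ?n f" for f
  proof -
    interpret dominant_labels d u l M ?n f by fact
    have FF: "F f = filling" using fill[OF f] by simp
    have "?L \<longleftrightarrow> (\<forall>x z. - d \<le> x \<and> x < 0 \<and> z \<in> Y x \<longrightarrow> balanced_at fwd M f x z)"
    proof
      assume L: ?L
      show "\<forall>x z. - d \<le> x \<and> x < 0 \<and> z \<in> Y x \<longrightarrow> balanced_at fwd M f x z"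
      proof (intro allI impI)
        fix x z assume a: "- d \<le> x \<and> x < 0 \<and> z \<in> Y x"
        then have "box x z \<in> ?D" using box_mem Y_ge by blast
        then show "balanced_at fwd M f x z"
          using L box_condition[of x z] a unfolding FF box_def by auto
      qed
    next
      assume R: "\<forall>x z. - d \<le> x \<and> x < 0 \<and> z \<in> Y x \<longrightarrow> balanced_at fwd M f x z"
      show ?L
      proof (clarify)
        fix i j assume b: "(i, j) \<in> ?D"
        from diagram_box[OF b] obtain x y where x: "(i, j) = box x y" "- d \<le> x" "x < 0" "y \<in> Y x" .
        then have ij: "i = x + d + 1" "j = col y" by (auto simp: box_def)
        show "F f (i, j) = kth_largest (nat (box_rank l i j))
            (image_mset (extended_filling l (F f)) (mset_set (extended_hook l i j)))"
          using box_condition[OF x(2-4)] R x(2-4) unfolding FF ij box_def by blast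
      qed
    qed
    also have "\<dots> \<longleftrightarrow> ?R"
    proof
      assume S: "\<forall>x z. - d \<le> x \<and> x < 0 \<and> z \<in> Y x \<longrightarrow> balanced_at fwd M f x z"
      show ?R
      proof (intro allI impI)
        fix x z assume a: "x < z \<and> u z < u x \<and> x \<noteq> - z"
        then have "rt (x, z) \<in> cinv u" using rt_mem_cinv_iff[OF sp] by blast
        from cinv_box[OF this] obtain x' z' where x': "rt (x, z) = rt (x', z')" "- d \<le> x'" "x' < 0" "z' \<in> Y x'" .
        \<comment> \<open>Every inversion other than \<open>(x, - x)\<close> is a pair of some row
          or the mirror of one, so the conditions at the boxes cover all balance conditions.\<close>
        have "(x = x' \<and> z = z') \<or> (x = - z' \<and> z = - x')"
          using x' a unfolding rt_def Y_def by (auto split: if_splits)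
        then show "balanced_at fwd M f x z"
        proof
          assume "x = x' \<and> z = z'"
          then show ?thesis using S x' by blast
        next
          assume e: "x = - z' \<and> z = - x'"
          have "x' < z'" using x'(4) by (simp add: Y_def)
          from sum_gterm_mirror[OF this] show ?thesis using S x' e by simp
        qed
      qed
    next
      assume S: ?R
      show "\<forall>x z. - d \<le> x \<and> x < 0 \<and> z \<in> Y x \<longrightarrow> balanced_at fwd M f x z"
      proof (intro allI impI)
        fix x z assume a: "- d \<le> x \<and> x < 0 \<and> z \<in> Y x"
        then have "x < z \<and> u z < u x \<and> x \<noteq> - z" by (auto simp: Y_def)
        then show "balanced_at fwd M f x z" using S by blast
      qed
    qed
    finally show ?thesis .
  qed
  have inv1: "the_inv_into ?D box_root (box_root b) = b" if "b \<in> ?D" for b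
    using the_inv_into_f_f[OF bij_betw_imp_inj_on[OF bj] that] .
  have inv2: "box_root (the_inv_into ?D box_root c) = c" "the_inv_into ?D box_root c \<in> ?D" if "c \<in> cinv u" for c
    using f_the_inv_into_f_bij_betw[OF bj] that bij_betw_the_inv_into[OF bj] by (auto dest: bij_betwE)
  have FB: "F f \<in> BS l" if f: "f \<in> balanced_labels fwd M ?n u" for f
  proof -
    have f': "\<And>c. f c \<noteq> 0 \<Longrightarrow> c \<in> cinv u" "bij_betw f (cinv u) {1..?n}"
        "\<forall>x z. x < z \<and> u z < u x \<and> x \<noteq> - z \<longrightarrow> balanced_at fwd M f x z"
      using f unfolding balanced_labels_def by blast+
    have "bij_betw (F f) ?D {1..?n}"
      using bij_betw_trans[OF bj f'(2)] by (subst bij_betw_cong[of _ _ "f \<circ> box_root"]) (auto simp: F_def)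
    moreover have "F f \<in> extensional ?D" by (simp add: F_def)
    ultimately show ?thesis
      using cond[OF labels[OF f'(1,2)]] f'(3) unfolding BS_def bijective_fillings_def by blast
  qed
  have GB: "G B \<in> balanced_labels fwd M ?n u" and FG: "F (G B) = B" if B: "B \<in> BS l" for B
  proof -
    have B': "B \<in> extensional ?D" "bij_betw B ?D {1..?n}"
      "\<forall>(i, j)\<in>?D. B (i, j) = kth_largest (nat (box_rank l i j))
            (image_mset (extended_filling l B) (mset_set (extended_hook l i j)))"
      using B unfolding BS_def bijective_fillings_def by blast+
    show FG: "F (G B) = B"
    proof
      fix b
      show "F (G B) b = B b"
      proof (cases "b \<in> ?D")
        case True
        then have "box_root b \<in> cinv u" using bij_betwE[OF bj] by blast
        then show ?thesis using True inv1[OF True] by (simp add: F_def G_def)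
      next
        case False
        then show ?thesis using extensional_arb[OF B'(1) False] by (simp add: F_def)
      qed
    qed
    have bG: "bij_betw (G B) (cinv u) {1..?n}"
      using bij_betw_trans[OF bij_betw_the_inv_into[OF bj] B'(2)]
      by (subst bij_betw_cong[of _ _ "B \<circ> the_inv_into ?D box_root"]) (auto simp: G_def)
    have nz: "c \<in> cinv u" if "G B c \<noteq> 0" for c using that by (auto simp: G_def split: if_splits)
    have "\<forall>x z. x < z \<and> u z < u x \<and> x \<noteq> - z \<longrightarrow> balanced_at fwd M (G B) x z"
      using cond[OF labels[OF nz bG]] B'(3) unfolding FG by blast
    with bG nz show "G B \<in> balanced_labels fwd M ?n u"
      unfolding balanced_labels_def by blast
  qed
  have GF: "G (F f) = f" if f: "f \<in> balanced_labels fwd M ?n u" for f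
  proof
    fix c
    have "f c = 0" if "c \<notin> cinv u" using f that unfolding balanced_labels_def by blast
    then show "G (F f) c = f c" using inv2[of c] by (simp add: G_def F_def)
  qed
  have "bij_betw F (balanced_labels fwd M ?n u) (BS l)"
    by (rule bij_betw_byWitness[where f' = G]) (use FB GB FG GF in auto)
  then show ?thesis
    using card_balanced_labels[OF bal] bij_betw_same_card by metis
qed

lemma code_dominant:
  assumes "- d \<le> x" "x < 0"
  shows "int (code u x) = row_code x"
proof -
  have "right_below u x = {1..row_code x}"
  proof (intro set_eqI)
    fix v
    show "v \<in> right_below u x \<longleftrightarrow> v \<in> {1..row_code x}"
      using row_code_iff[OF assms, of "inv u v"] unfolding inv_val(2) by auto
  qed
  then show ?thesis using row_code_nonneg[OF assms] by (simp add: code_def)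
qed

lemma num_words_dominant: "num_words n u = removal_count n (int ` set l)"
proof -
  have dl: "d = int (length l)" by (simp add: d num_parts_def)
  have dec: "code u y \<le> code u x" if "- d \<le> x" "x < y" "y < 0" for x y
  proof -
    have "l ! nat (y + d) + (nat (y + d) - nat (x + d)) \<le> l ! nat (x + d)"
      by (rule part_drop[OF l]) (use that dl in auto)
    then have "row_code y \<le> row_code x" using that unfolding row_code_def part_def by simp
    then show ?thesis using code_dominant[of x] code_dominant[of y] that by linarith
  qed
  have "rows d u" by unfold_locales
  from rows_reduction[OF this dec] obtain w where w: "rows d w" "\<And>n. num_words n w = num_words n u"
      and inc: "\<And>x y. - d \<le> x \<Longrightarrow> x < y \<Longrightarrow> y < 0 \<Longrightarrow> w x < w y"
      and val: "\<And>x. - d \<le> x \<Longrightarrow> x < 0 \<Longrightarrow> w x = int (code u (- d - 1 - x)) + x + d + 1" by blast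
  interpret w: rows d w by (rule w(1))
  \<comment> \<open>Reversing the rows gives
    \<open>row_code (- d - 1 - x) = part l (- x) - d - 1 - x\<close>, and the remaining summands
    cancel against \<open>x + d + 1\<close>.\<close>
  have val': "w x = part l (- x)" if "- d \<le> x" "x < 0" for x
    using val[OF that] code_dominant[of "- d - 1 - x"] that by (simp add: row_code_def)
  have "neg_values w = int ` set l"
  proof (intro set_eqI iffI)
    fix v assume "v \<in> neg_values w"
    then have v: "0 < w (inv w v)" "inv w v < 0" using w.inv_val(2) by (auto simp: neg_values_def)
    then have x: "- d \<le> inv w v" using w.pos_cases[OF v(1)] d_nonneg by auto
    have "v = part l (- inv w v)" using val'[OF x v(2)] w.inv_val(2) by simp
    then show "v \<in> int ` set l" using x v(2) dl by (auto simp: part_def)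
  next
    fix v assume "v \<in> int ` set l"
    then obtain m where m: "m < length l" "v = int (l ! m)" by (auto simp: in_set_conv_nth)
    have x: "- d \<le> - int m - 1" "- int m - 1 < 0" using m dl by auto
    have "w (- int m - 1) = v" using val'[OF x] m by (simp add: part_def)
    then show "v \<in> neg_values w" using w.row_pos[OF x] w.inv_val(1)[of "- int m - 1"] by (auto simp: neg_values_def)
  qed
  moreover have "w x < w y" if "0 < x" "x < y" for x y
  proof -
    consider "y \<le> d" | "x \<le> d" "d < y" | "d < x" by linarith
    then show ?thesis
    proof cases
      case 1
      then show ?thesis using inc[of "- y" "- x"] that by (simp add: w.neg)
    next
      case 2
      then have "0 < w (- x)" "0 < w y" using w.row_pos[of "- x"] w.out_pos[of y] that by auto
      then show ?thesis by (simp add: w.neg)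
    next
      case 3
      then show ?thesis using w.out_mono that by simp
    qed
  qed
  ultimately show ?thesis using num_words_grassmannian[OF w.sp] w(2) by metis
qed

end

theorem theorem1p1:
  fixes l :: "nat list"
  assumes "strict_partition l"
  shows "card (SYT l) = card (BS l)"
proof -
  obtain u where "dominant (num_parts l) u l" using dominant_exists[OF assms] by blast
  then interpret dominant "num_parts l" u l .
  show ?thesis using card_SYT[OF assms] card_BS num_words_dominant by simp
qed

end
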